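(* Let $k$ be an algebraically closed field, let $A$ be a basic finite-dimensional self-injective $k$-algebra, and let $M$ be a right $A$-module with $\dim_k M = d$. Suppose that $\operatorname{cx}_A(M) = 1$ and that the $\mathrm{GL}_d(k)$-orbit $\mathcal{O}(M)$ of $M$ is Zariski open in $\mathrm{Mod}^A_d$. Then $M$ is periodic.
   Context: For a finitely generated $k$-algebra $A$, fix a presentation $A \cong k\langle x_1,\dots,x_s\rangle/(\rho_i)_{i\in I}$ (with $x_1 - 1$ among the relations). The module variety $\mathrm{Mod}^A_d$ is the affine variety of tuples $(X_1,\dots,X_s)$ of $d\times d$ matrices over $k$ with $X_1 = I$ satisfying all relations $\rho_i$; its points correspond to right $A$-module structures on $k^d$. The group $\mathrm{GL}_d(k)$ acts on it by simultaneous conjugation, and the orbits correspond bijectively to isomorphism classes of $d$-dimensional $A$-modules; $\mathcal{O}(M)$ denotes the orbit of (the point corresponding to) $M$. The complexity of $M$ is $\operatorname{cx}_A(M) = \inf\{n \ge 0 : \exists C>0,\ \dim_k P^t \le C t^{n-1}\ \forall t\ge 0\}$, where $P^\bullet$ is a minimal projective resolution of $M$. A module $M$ is periodic if it has a periodic projective resolution, equivalently (over a self-injective algebra, for $M$ without projective summands) $\Omega^n M \cong M$ for some $n \ge 1$, where $\Omega$ is the syzygy functor. *)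

theory Defs
  imports "Jordan_Normal_Form.Matrix" "HOL-Computational_Algebra.Polynomial" "HOL-Library.Extended_Nat"
begin

text \<open>A finite-dimensional k-algebra A is given concretely as k^n (vectors of length n)
  with a bilinear associative multiplication and a unit.\<close>

record 'k fdalg =
  dimA :: nat
  mulA :: "'k vec \<Rightarrow> 'k vec \<Rightarrow> 'k vec"
  oneA :: "'k vec"

definition fd_algebra :: "'k::field fdalg \<Rightarrow> bool" where
  "fd_algebra A \<longleftrightarrow>
     (let n = dimA A; m = mulA A in
      oneA A \<in> carrier_vec n \<and>
      (\<forall>a\<in>carrier_vec n. \<forall>b\<in>carrier_vec n. m a b \<in> carrier_vec n) \<and>
      (\<forall>a\<in>carrier_vec n. \<forall>b\<in>carrier_vec n. \<forall>c\<in>carrier_vec n.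
          m (a + b) c = m a c + m b c \<and> m a (b + c) = m a b + m a c \<and>
          m (m a b) c = m a (m b c)) \<and>
      (\<forall>a\<in>carrier_vec n. \<forall>b\<in>carrier_vec n. \<forall>x::'k.
          m (x \<cdot>\<^sub>v a) b = x \<cdot>\<^sub>v m a b \<and> m a (x \<cdot>\<^sub>v b) = x \<cdot>\<^sub>v m a b) \<and>
      (\<forall>a\<in>carrier_vec n. m (oneA A) a = a \<and> m a (oneA A) = a))"

definition vmul :: "'k::field vec \<Rightarrow> 'k mat \<Rightarrow> 'k vec" where
  "vmul v F = vec (dim_col F) (\<lambda>j. v \<bullet> col F j)"

text \<open>A finite-dimensional right A-module: the space k^m of row vectors with
  v\<cdot>a = v * rho a, where rho : A \<rightarrow> M_m(k) is a unital k-algebra homomorphism.\<close>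
type_synonym 'k fdmod = "nat \<times> ('k vec \<Rightarrow> 'k mat)"

definition is_module :: "'k::field fdalg \<Rightarrow> 'k fdmod \<Rightarrow> bool" where
  "is_module A M \<longleftrightarrow>
     (let n = dimA A; m = fst M; \<rho> = snd M in
      (\<forall>a\<in>carrier_vec n. \<rho> a \<in> carrier_mat m m) \<and>
      (\<forall>a\<in>carrier_vec n. \<forall>b\<in>carrier_vec n. \<rho> (a + b) = \<rho> a + \<rho> b \<and>
            \<rho> (mulA A a b) = \<rho> a * \<rho> b) \<and>
      (\<forall>a\<in>carrier_vec n. \<forall>x::'k. \<rho> (x \<cdot>\<^sub>v a) = x \<cdot>\<^sub>m \<rho> a) \<and>
      \<rho> (oneA A) = 1\<^sub>m m)"

definition mcar :: "'k fdmod \<Rightarrow> 'k vec set" where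
  "mcar M = carrier_vec (fst M)"

definition is_hom :: "'k::field fdalg \<Rightarrow> 'k fdmod \<Rightarrow> 'k fdmod \<Rightarrow> 'k mat \<Rightarrow> bool" where
  "is_hom A M N F \<longleftrightarrow> F \<in> carrier_mat (fst M) (fst N) \<and>
     (\<forall>a\<in>carrier_vec (dimA A). snd M a * F = F * snd N a)"

definition himage :: "'k fdmod \<Rightarrow> 'k::field mat \<Rightarrow> 'k vec set" where
  "himage M F = (\<lambda>v. vmul v F) ` mcar M"

definition hkernel :: "'k fdmod \<Rightarrow> 'k::field mat \<Rightarrow> 'k vec set" where
  "hkernel M F = {v \<in> mcar M. vmul v F = 0\<^sub>v (dim_col F)}"

definition submodule :: "'k::field fdalg \<Rightarrow> 'k fdmod \<Rightarrow> 'k vec set \<Rightarrow> bool" where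
  "submodule A M S \<longleftrightarrow> S \<subseteq> mcar M \<and> 0\<^sub>v (fst M) \<in> S \<and>
     (\<forall>u\<in>S. \<forall>v\<in>S. u + v \<in> S) \<and> (\<forall>u\<in>S. \<forall>x::'k. x \<cdot>\<^sub>v u \<in> S) \<and>
     (\<forall>u\<in>S. \<forall>a\<in>carrier_vec (dimA A). vmul u (snd M a) \<in> S)"

definition projective :: "'k::field fdalg \<Rightarrow> 'k fdmod \<Rightarrow> bool" where
  "projective A P \<longleftrightarrow>
     (\<forall>N N' g f. is_module A N \<and> is_module A N' \<and> is_hom A N N' g \<and>
        himage N g = mcar N' \<and> is_hom A P N' f \<longrightarrow>
        (\<exists>h. is_hom A P N h \<and> h * g = f))"

definition injective :: "'k::field fdalg \<Rightarrow> 'k fdmod \<Rightarrow> bool" where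
  "injective A I \<longleftrightarrow>
     (\<forall>N' N f g. is_module A N' \<and> is_module A N \<and> is_hom A N' N f \<and>
        hkernel N' f = {0\<^sub>v (fst N')} \<and> is_hom A N' I g \<longrightarrow>
        (\<exists>h. is_hom A N I h \<and> f * h = g))"

definition regular :: "'k::field fdalg \<Rightarrow> 'k fdmod" where
  "regular A = (dimA A, \<lambda>a. mat (dimA A) (dimA A)
       (\<lambda>(i,j). mulA A (unit_vec (dimA A) i) a $ j))"

definition self_injective :: "'k::field fdalg \<Rightarrow> bool" where
  "self_injective A \<longleftrightarrow> injective A (regular A)"

definition maximal_right_ideal :: "'k::field fdalg \<Rightarrow> 'k vec set \<Rightarrow> bool" where
  "maximal_right_ideal A I \<longleftrightarrow> submodule A (regular A) I \<and> I \<noteq> carrier_vec (dimA A) \<and>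
     (\<forall>J. submodule A (regular A) J \<and> I \<subseteq> J \<and> J \<noteq> carrier_vec (dimA A) \<longrightarrow> J = I)"

definition radA :: "'k::field fdalg \<Rightarrow> 'k vec set" where
  "radA A = carrier_vec (dimA A) \<inter> \<Inter> {I. maximal_right_ideal A I}"

text \<open>Basic: A / rad A is isomorphic, as a k-algebra, to k \<times> ... \<times> k.\<close>
definition basic :: "'k::field fdalg \<Rightarrow> bool" where
  "basic A \<longleftrightarrow> (\<exists>m \<phi>. \<phi> ` carrier_vec (dimA A) = carrier_vec m \<and>
     (\<forall>a\<in>carrier_vec (dimA A). \<forall>b\<in>carrier_vec (dimA A).
        \<phi> (a + b) = \<phi> a + \<phi> b \<and>
        \<phi> (mulA A a b) = vec m (\<lambda>i. \<phi> a $ i * \<phi> b $ i)) \<and>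
     (\<forall>a\<in>carrier_vec (dimA A). \<forall>x::'k. \<phi> (x \<cdot>\<^sub>v a) = x \<cdot>\<^sub>v \<phi> a) \<and>
     \<phi> (oneA A) = vec m (\<lambda>_. 1) \<and>
     {a \<in> carrier_vec (dimA A). \<phi> a = 0\<^sub>v m} = radA A)"

definition superfluous :: "'k::field fdalg \<Rightarrow> 'k fdmod \<Rightarrow> 'k vec set \<Rightarrow> bool" where
  "superfluous A P K \<longleftrightarrow> (\<forall>L. submodule A P L \<and> {k + l | k l. k \<in> K \<and> l \<in> L} = mcar P
      \<longrightarrow> L = mcar P)"

definition proj_resolution :: "'k::field fdalg \<Rightarrow> 'k fdmod \<Rightarrow> (nat \<Rightarrow> 'k fdmod) \<Rightarrow>
    (nat \<Rightarrow> 'k mat) \<Rightarrow> 'k mat \<Rightarrow> bool" where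
  "proj_resolution A M P d e \<longleftrightarrow>
     (\<forall>t. is_module A (P t) \<and> projective A (P t) \<and> is_hom A (P (Suc t)) (P t) (d t)) \<and>
     is_hom A (P 0) M e \<and> himage (P 0) e = mcar M \<and>
     himage (P 1) (d 0) = hkernel (P 0) e \<and>
     (\<forall>t. himage (P (Suc (Suc t))) (d (Suc t)) = hkernel (P (Suc t)) (d t))"

text \<open>Minimal: every map onto its image is a projective cover (superfluous kernel).\<close>
definition minimal_proj_resolution :: "'k::field fdalg \<Rightarrow> 'k fdmod \<Rightarrow> (nat \<Rightarrow> 'k fdmod) \<Rightarrow>
    (nat \<Rightarrow> 'k mat) \<Rightarrow> 'k mat \<Rightarrow> bool" where
  "minimal_proj_resolution A M P d e \<longleftrightarrow> proj_resolution A M P d e \<and>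
     superfluous A (P 0) (hkernel (P 0) e) \<and>
     (\<forall>t. superfluous A (P (Suc t)) (hkernel (P (Suc t)) (d t)))"

definition complexity :: "'k::field fdalg \<Rightarrow> 'k fdmod \<Rightarrow> enat" where
  "complexity A M = Inf {enat n | n. \<exists>P d e. minimal_proj_resolution A M P d e \<and>
      (\<exists>C::real. C > 0 \<and> (\<forall>t::nat. t \<ge> 1 \<longrightarrow>
          real (fst (P t)) \<le> C * (real t) powi (int n - 1)))}"

definition periodic :: "'k::field fdalg \<Rightarrow> 'k fdmod \<Rightarrow> bool" where
  "periodic A M \<longleftrightarrow> (\<exists>P d e n. proj_resolution A M P d e \<and> n \<ge> 1 \<and>
      (\<forall>t. P (t + n) = P t \<and> d (t + n) = d t))"

inductive_set gen_subalg :: "'k::field fdalg \<Rightarrow> 'k vec list \<Rightarrow> 'k vec set"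
  for A gs where
  one: "oneA A \<in> gen_subalg A gs"
| gen: "g \<in> set gs \<Longrightarrow> g \<in> gen_subalg A gs"
| add: "a \<in> gen_subalg A gs \<Longrightarrow> b \<in> gen_subalg A gs \<Longrightarrow> a + b \<in> gen_subalg A gs"
| smult: "a \<in> gen_subalg A gs \<Longrightarrow> x \<cdot>\<^sub>v a \<in> gen_subalg A gs"
| mul: "a \<in> gen_subalg A gs \<Longrightarrow> b \<in> gen_subalg A gs \<Longrightarrow> mulA A a b \<in> gen_subalg A gs"

text \<open>A presentation k<x_1..x_s>/(rels) \<cong> A with x_1 - 1 among the relations amounts
  to a list of algebra generators (images of x_i) whose first entry is 1.\<close>
definition presentation_gens :: "'k::field fdalg \<Rightarrow> 'k vec list \<Rightarrow> bool" where
  "presentation_gens A gs \<longleftrightarrow> gs \<noteq> [] \<and> gs ! 0 = oneA A \<and>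
     set gs \<subseteq> carrier_vec (dimA A) \<and> gen_subalg A gs = carrier_vec (dimA A)"

text \<open>Mod^A_d: the tuples (X_1..X_s) satisfying the relations, i.e. the images of the
  generators under the d-dimensional right module structures.\<close>
definition modvar :: "'k::field fdalg \<Rightarrow> 'k vec list \<Rightarrow> nat \<Rightarrow> 'k mat list set" where
  "modvar A gs d = {map \<rho> gs | \<rho>. is_module A (d, \<rho>)}"

definition orbit :: "'k vec list \<Rightarrow> 'k::field fdmod \<Rightarrow> 'k mat list set" where
  "orbit gs M = {map (\<lambda>g. S * snd M g * T) gs | S T.
      S \<in> carrier_mat (fst M) (fst M) \<and> T \<in> carrier_mat (fst M) (fst M) \<and>
      S * T = 1\<^sub>m (fst M) \<and> T * S = 1\<^sub>m (fst M)}"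

inductive_set polyfun :: "nat \<Rightarrow> nat \<Rightarrow> ('k::field mat list \<Rightarrow> 'k) set" for s d where
  const: "(\<lambda>_. c) \<in> polyfun s d"
| coord: "i < s \<Longrightarrow> r < d \<Longrightarrow> c < d \<Longrightarrow> (\<lambda>Xs. (Xs ! i) $$ (r, c)) \<in> polyfun s d"
| add: "f \<in> polyfun s d \<Longrightarrow> g \<in> polyfun s d \<Longrightarrow> (\<lambda>x. f x + g x) \<in> polyfun s d"
| mul: "f \<in> polyfun s d \<Longrightarrow> g \<in> polyfun s d \<Longrightarrow> (\<lambda>x. f x * g x) \<in> polyfun s d"

definition zariski_open_in :: "nat \<Rightarrow> nat \<Rightarrow> 'k::field mat list set \<Rightarrow> 'k mat list set \<Rightarrow> bool" where
  "zariski_open_in s d S U \<longleftrightarrow> U \<subseteq> S \<and>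
     (\<exists>F. F \<subseteq> polyfun s d \<and> S - U = {x \<in> S. \<forall>f\<in>F. f x = 0})"

definition alg_closed_field :: "'k::field itself \<Rightarrow> bool" where
  "alg_closed_field _ \<longleftrightarrow> (\<forall>p :: 'k poly. degree p > 0 \<longrightarrow> (\<exists>x. poly p x = 0))"

end

theory Submission
  imports Defs "HOL-Library.Function_Algebras" "Jordan_Normal_Form.Determinant"
begin

text \<open>Complexity 1 bounds the dimensions in a projective resolution of \<open>M\<close>, so some dimension is shared
  by infinitely many syzygies \<open>K s\<close>. For each such \<open>s\<close>, being
  an \<open>s\<close>-fold syzygy of \<open>M\<close> is an open condition near \<open>K s\<close>: since projectives are injective, the embedding
  of \<open>K s\<close> into the projective module of the resolution extends to a polynomial family of maps from the
  nearby module structures, the cokernels form a rational family, and iterating this pulls back the open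
  orbit of \<open>M\<close>. This gives polynomials \<open>f s\<close> not vanishing at \<open>K s\<close>. By Hilbert's basis theorem some
  \<open>f m\<close> is a combination of earlier ones, so an earlier \<open>f s\<close> does not vanish at \<open>K m\<close>. Hence \<open>K m\<close> is
  an \<open>s\<close>-fold syzygy of \<open>M\<close>, and by Schanuel's lemma \<open>M\<close> is stably isomorphic to \<open>K (m - s)\<close>. Splitting off
  projective summands, \<open>M\<close> itself becomes the \<open>(m - s)\<close>-th kernel of a projective resolution of \<open>M\<close>.\<close>

text \<open>The sets where the \<open>f s\<close> do not vanish are open in one module variety, so
  the appeal to Hilbert's theorem is quasi-compactness: infinitely many syzygies cannot each avoid
  the open sets of all earlier ones. This is why they need a common dimension. Openness is carried
  along embeddings into projectives because a linear functional on the underlying space gives a map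
  into the dual of \<open>A\<close> for every module structure at once, by a formula linear in that
  structure. Self-injectivity makes every projective module a summand of a power of this dual, so
  the formula also governs maps into projectives. Periodicity is demanded literally, as equality of
  the modules and maps of a resolution, so a stable isomorphism is not yet enough. The projective
  middle term of one sequence is changed until its kernel is \<open>M\<close> on the nose, and the
  resulting finite chain of sequences is repeated cyclically. Maps act on row vectors:
  \<open>F * G\<close> is \<open>F\<close> followed by \<open>G\<close>.\<close>

section \<open>Hilbert's basis theorem\<close>

definition is_subring :: "'a::comm_ring_1 set \<Rightarrow> bool" where
  "is_subring R \<longleftrightarrow> 0 \<in> R \<and> 1 \<in> R \<and> (\<forall>a\<in>R. \<forall>b\<in>R. a + b \<in> R \<and> a * b \<in> R \<and> - a \<in> R)"

definition span_below :: "'a::comm_ring_1 set \<Rightarrow> (nat \<Rightarrow> 'a) \<Rightarrow> nat \<Rightarrow> 'a set" where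
  "span_below R f m = {\<Sum>j<m. r j * f j | r. \<forall>j. r j \<in> R}"

text \<open>The ascending chain condition in the form consumed at the end: in any sequence some term
  lies in the ideal generated by its predecessors. It speaks of a subset \<open>R\<close> of a type
  so that it can be applied inside a ring of functions that is far from Noetherian as a
  whole.\<close>

definition noetherian :: "'a::comm_ring_1 set \<Rightarrow> bool" where
  "noetherian R \<longleftrightarrow> (\<forall>f. (\<forall>i. f i \<in> R) \<longrightarrow> (\<exists>m. f m \<in> span_below R f m))"

lemma span_belowI: "a = (\<Sum>j<m. r j * f j) \<Longrightarrow> \<forall>j. r j \<in> R \<Longrightarrow> a \<in> span_below R f m"
  unfolding span_below_def by blast

lemma span_belowE:
  assumes "a \<in> span_below R f m"
  obtains r where "a = (\<Sum>j<m. r j * f j)" "\<forall>j. r j \<in> R"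
  using assms unfolding span_below_def by blast

lemma is_subringD:
  assumes "is_subring R"
  shows subring_0: "0 \<in> R" and subring_1: "1 \<in> R"
    and subring_add: "a \<in> R \<Longrightarrow> b \<in> R \<Longrightarrow> a + b \<in> R"
    and subring_mult: "a \<in> R \<Longrightarrow> b \<in> R \<Longrightarrow> a * b \<in> R"
    and subring_uminus: "a \<in> R \<Longrightarrow> - a \<in> R"
  using assms unfolding is_subring_def by blast+

lemma subring_sum:
  assumes "is_subring R" "\<And>i. i \<in> I \<Longrightarrow> f i \<in> R"
  shows "sum f I \<in> R"
  using assms(2)
proof (induction I rule: infinite_finite_induct)
  case (insert x F)
  then show ?case by (simp add: subring_add[OF assms(1)])
qed (simp_all add: subring_0[OF assms(1)])

lemma span_below_add:
  assumes "is_subring R" "a \<in> span_below R f m" "b \<in> span_below R f m"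
  shows "a + b \<in> span_below R f m"
proof -
  obtain r s where "a = (\<Sum>j<m. r j * f j)" "b = (\<Sum>j<m. s j * f j)"
    and rs: "\<forall>j. r j \<in> R" "\<forall>j. s j \<in> R"
    using span_belowE[OF assms(2)] span_belowE[OF assms(3)] by metis
  then have "a + b = (\<Sum>j<m. (r j + s j) * f j)"
    by (simp add: sum.distrib distrib_right)
  moreover have "\<forall>j. r j + s j \<in> R"
    using rs by (simp add: subring_add[OF assms(1)])
  ultimately show ?thesis
    by (rule span_belowI)
qed

lemma span_below_mult:
  assumes "is_subring R" "a \<in> span_below R f m" "c \<in> R"
  shows "c * a \<in> span_below R f m"
proof -
  obtain r where "a = (\<Sum>j<m. r j * f j)" and r: "\<forall>j. r j \<in> R"
    using assms(2) by (rule span_belowE)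
  then have "c * a = (\<Sum>j<m. (c * r j) * f j)"
    by (simp add: sum_distrib_left mult.assoc)
  moreover have "\<forall>j. c * r j \<in> R"
    using r by (simp add: subring_mult[OF assms(1,3)])
  ultimately show ?thesis
    by (rule span_belowI)
qed

lemma span_below_zero: "is_subring R \<Longrightarrow> 0 \<in> span_below R f m"
  by (rule span_belowI[where r = "\<lambda>_. 0"]) (simp_all add: subring_0)

lemma span_below_sum:
  fixes n :: nat
  assumes "is_subring R" "\<And>i. i < n \<Longrightarrow> a i \<in> span_below R f m"
  shows "(\<Sum>i<n. a i) \<in> span_below R f m"
  using assms(2)
  by (induction n) (auto intro: span_below_zero span_below_add assms(1))

lemma span_below_base:
  assumes "is_subring R" "j < m"
  shows "f j \<in> span_below R f m"
proof -
  have "f j = (\<Sum>i<m. (if i = j then 1 else 0) * f i)"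
    using assms(2) by (simp add: if_distrib[of "\<lambda>x. x * _"] cong: if_cong)
  moreover have "\<forall>i. (if i = j then 1 else 0) \<in> R"
    by (simp add: subring_0[OF assms(1)] subring_1[OF assms(1)])
  ultimately show ?thesis
    by (rule span_belowI)
qed

lemma span_below_subset:
  assumes "is_subring R" "\<And>i. i < n \<Longrightarrow> g i \<in> span_below R f m"
  shows "span_below R g n \<subseteq> span_below R f m"
proof
  fix a assume "a \<in> span_below R g n"
  then obtain r where "a = (\<Sum>j<n. r j * g j)" "\<forall>j. r j \<in> R"
    by (rule span_belowE)
  then show "a \<in> span_below R f m"
    using assms by (auto intro!: span_below_sum span_below_mult)
qed

lemma span_below_mono: "is_subring R \<Longrightarrow> m \<le> n \<Longrightarrow> span_below R f m \<subseteq> span_below R f n"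
  by (intro span_below_subset) (auto intro: span_below_base)

lemma subring_polys:
  assumes "is_subring R"
  shows "is_subring {p. \<forall>i. coeff p i \<in> R}"
proof -
  have "(\<Sum>i\<le>n. coeff p i * coeff q (n - i)) \<in> R"
    if "\<forall>i. coeff p i \<in> R" "\<forall>i. coeff q i \<in> R" for p q n
    using that by (intro subring_sum[OF assms] subring_mult[OF assms]) simp_all
  then show ?thesis
    unfolding is_subring_def[of "{p. _ p}"]
    by (simp add: coeff_mult coeff_1 subring_0[OF assms] subring_1[OF assms] subring_add[OF assms]
        subring_uminus[OF assms])
qed

text \<open>Hilbert's argument: in an ideal that is not finitely generated choose successively elements
  \<open>g k\<close> of least degree outside the ideal generated by the previous ones. A relation between the
  leading coefficients cancels the leading term of some \<open>g m\<close>.\<close>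

lemma hilbert_basis:
  fixes R :: "'a::comm_ring_1 set"
  assumes R: "is_subring R" and N: "noetherian R"
  shows "noetherian {p. \<forall>i. coeff p i \<in> R}"
proof (rule ccontr)
  let ?P = "{p. \<forall>i. coeff p i \<in> R}"
  note P = subring_polys[OF R]
  assume "\<not> noetherian ?P"
  then obtain f where f: "\<And>i. f i \<in> ?P" and bad: "\<And>m. f m \<notin> span_below ?P f m"
    unfolding noetherian_def by blast
  define I where "I = (\<Union>m. span_below ?P f m)"
  \<comment> \<open>\<open>I\<close> is an increasing union, so finitely many of its elements
    already lie in one stage. Hence no finite subset generates \<open>I\<close>.\<close>
  have fin: "\<exists>m. \<forall>j<k. g j \<in> span_below ?P f m" if "\<forall>j<k. g j \<in> I" for g :: "nat \<Rightarrow> 'a poly" and k :: nat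
  proof -
    have "\<forall>j. \<exists>m. j < k \<longrightarrow> g j \<in> span_below ?P f m"
      using that unfolding I_def by blast
    then obtain M where M: "\<And>j. j < k \<Longrightarrow> g j \<in> span_below ?P f (M j)"
      by metis
    have "g j \<in> span_below ?P f (\<Sum>j<k. M j)" if "j < k" for j
      using M[OF that] span_below_mono[OF P] that member_le_sum[of j "{..<k}" M] by fastforce
    then show ?thesis by blast
  qed
  have I_add: "a + b \<in> I" if "a \<in> I" "b \<in> I" for a b
  proof -
    have "\<forall>j<2. (if j = (0::nat) then a else b) \<in> I"
      using that by simp
    then obtain m where m: "\<forall>j<2. (if j = (0::nat) then a else b) \<in> span_below ?P f m"
      using fin[of 2 "\<lambda>j. if j = 0 then a else b"] by blast
    have "a \<in> span_below ?P f m" "b \<in> span_below ?P f m"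
      using m[rule_format, of 0] m[rule_format, of 1] by simp_all
    then show ?thesis
      unfolding I_def using span_below_add[OF P] by blast
  qed
  have I_mult: "c * a \<in> I" if "a \<in> I" "c \<in> ?P" for a c
    using that span_below_mult[OF P] unfolding I_def by blast
  have I_sub: "I \<subseteq> ?P"
  proof
    fix p assume "p \<in> I"
    then obtain m where "p \<in> span_below ?P f m"
      unfolding I_def by blast
    then obtain r where p: "p = (\<Sum>j<m. r j * f j)" "\<forall>j. r j \<in> ?P"
      by (rule span_belowE)
    show "p \<in> ?P"
      unfolding p(1) using p(2) f by (intro subring_sum[OF P] subring_mult[OF P]) blast+
  qed
  define Q where "Q = (\<lambda>(g :: nat \<Rightarrow> 'a poly) k p. p \<in> I \<and> p \<notin> span_below ?P g k
      \<and> (\<forall>q\<in>I. q \<notin> span_below ?P g k \<longrightarrow> degree p \<le> degree q))"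
  have "\<exists>g. \<forall>k. Q g k (g k)"
  \<comment> \<open>The condition on \<open>g k\<close> refers to all earlier values, so the choice
    recurses over the well-founded order rather than from \<open>k\<close> to
    \<open>Suc k\<close>.\<close>
  proof (rule dependent_wf_choice[OF wf_less])
    fix g h :: "nat \<Rightarrow> 'a poly" and k p
    assume eq: "\<And>z. (z, k) \<in> {(x, y). x < y} \<Longrightarrow> g z = h z"
    have "span_below ?P g k = span_below ?P h k"
      unfolding span_below_def using eq by (intro Collect_cong ex_cong1) auto
    then show "Q g k p = Q h k p"
      by (simp add: Q_def)
  next
    fix k and g :: "nat \<Rightarrow> 'a poly"
    assume "\<And>y. (y, k) \<in> {(x, y). x < y} \<Longrightarrow> Q g y (g y)"
    then have "\<forall>j<k. g j \<in> I"
      by (auto simp: Q_def)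
    then obtain m where "\<forall>j<k. g j \<in> span_below ?P f m"
      using fin by blast
    then have "f m \<notin> span_below ?P g k"
      using span_below_subset[OF P, of k g f m] bad by blast
    moreover have "f m \<in> I"
      unfolding I_def using span_below_base[OF P, of m "Suc m" f] by blast
    ultimately have "\<exists>p. p \<in> I \<and> p \<notin> span_below ?P g k" by blast
    from ex_has_least_nat[of "\<lambda>p. p \<in> I \<and> p \<notin> span_below ?P g k" _ degree] this
    show "\<exists>p. Q g k p"
      unfolding Q_def by blast
  qed
  then obtain g where g: "\<And>k. Q g k (g k)" by blast
  have gI: "g k \<in> I" and gn: "g k \<notin> span_below ?P g k" for k
    using g[of k] by (auto simp: Q_def)
  have gmin: "degree (g k) \<le> degree q" if "q \<in> I" "q \<notin> span_below ?P g k" for k q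
    using g[of k] that by (auto simp: Q_def)
  have deg: "degree (g j) \<le> degree (g m)" if "j < m" for j m
    using gmin[of "g m" j] gI[of m] gn[of m] span_below_mono[OF P, of j m g] that by auto
  have "\<forall>k. lead_coeff (g k) \<in> R"
    using gI I_sub by auto
  then obtain m where "lead_coeff (g m) \<in> span_below R (\<lambda>k. lead_coeff (g k)) m"
    using N[unfolded noetherian_def, rule_format, of "\<lambda>k. lead_coeff (g k)"] by blast
  then obtain r where r: "lead_coeff (g m) = (\<Sum>j<m. r j * lead_coeff (g j))" "\<forall>j. r j \<in> R"
    by (rule span_belowE)
  \<comment> \<open>The relation between leading coefficients, lifted to polynomials: each
    \<open>g j\<close> is shifted up to the degree of \<open>g m\<close>. By \<open>deg\<close> the
    subtraction of degrees is never truncated.\<close>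
  define s where "s = (\<Sum>j<m. monom (r j) (degree (g m) - degree (g j)) * g j)"
  define h where "h = g m + (- 1) * s"
  have mon: "monom c n \<in> ?P" if "c \<in> R" for c n
    using that subring_0[OF R] by simp
  have s_span: "s \<in> span_below ?P g m"
    unfolding s_def by (rule span_belowI[OF refl]) (use mon r(2) in blast)
  have m1: "- 1 \<in> ?P"
    by (intro subring_uminus[OF P] subring_1[OF P])
  have "h \<notin> span_below ?P g m"
  proof
    assume "h \<in> span_below ?P g m"
    then have "h + s \<in> span_below ?P g m"
      using s_span span_below_add[OF P] by blast
    then show False using gn[of m] by (simp add: h_def)
  qed
  moreover have "s \<in> I"
  proof -
    obtain k where "\<forall>j<m. g j \<in> span_below ?P f k"
      using fin gI by blast
    then have "s \<in> span_below ?P f k"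
      using span_below_subset[OF P, of m g f k] s_span by blast
    then show ?thesis by (auto simp: I_def)
  qed
  then have "h \<in> I"
    unfolding h_def by (intro I_add I_mult gI m1)
  ultimately have "degree (g m) \<le> degree h"
    using gmin by blast
  \<comment> \<open>Needed when \<open>g m\<close> is constant: cancelling its leading coefficient
    then cannot lower the degree, and only \<open>h \<noteq> 0\<close> gives the
    contradiction.\<close>
  have hn0: "h \<noteq> 0"
    using \<open>h \<notin> _\<close> span_below_zero[OF P] by metis
  have "degree s \<le> degree (g m)"
    unfolding s_def
  proof (intro degree_sum_le)
    fix j assume "j \<in> {..<m}"
    then have "degree (g j) \<le> degree (g m)" using deg by auto
    then show "degree (monom (r j) (degree (g m) - degree (g j)) * g j) \<le> degree (g m)"
      using degree_mult_le[of "monom (r j) (degree (g m) - degree (g j))" "g j"]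
        degree_monom_le[of "r j" "degree (g m) - degree (g j)"] by linarith
  qed auto
  then have "degree h \<le> degree (g m)"
    unfolding h_def by (intro degree_add_le) auto
  moreover have "coeff s (degree (g m)) = lead_coeff (g m)"
    unfolding s_def coeff_sum r(1)
    by (intro sum.cong refl) (use deg in \<open>auto simp: coeff_monom_mult\<close>)
  then have "coeff h (degree (g m)) = 0"
    by (simp add: h_def)
  ultimately show False
    using \<open>degree (g m) \<le> degree h\<close> hn0 leading_coeff_0_iff[of h] by simp
qed

text \<open>Evaluation at \<open>t\<close> maps the polynomials over \<open>R\<close> onto a subring
  containing \<open>R\<close> and \<open>t\<close>. A relation found among polynomial lifts of a
  sequence evaluates to a relation in the image, whatever relations \<open>t\<close> satisfies over
  \<open>R\<close>.\<close>

lemma noetherian_adjoin: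
  fixes R :: "'a::comm_ring_1 set"
  assumes R: "is_subring R" and N: "noetherian R"
  shows "\<exists>R'. is_subring R' \<and> noetherian R' \<and> insert t R \<subseteq> R'"
proof -
  let ?P = "{p. \<forall>i. coeff p i \<in> R}"
  let ?S = "(\<lambda>p. poly p t) ` ?P"
  have P: "is_subring ?P" and NP: "noetherian ?P"
    using subring_polys[OF R] hilbert_basis[OF R N] .
  have "is_subring ?S"
    unfolding is_subring_def
  proof (intro conjI ballI)
    show "0 \<in> ?S" by (intro image_eqI[of _ _ 0] subring_0[OF P]) simp
    show "1 \<in> ?S" by (intro image_eqI[of _ _ 1] subring_1[OF P]) simp
    fix a b assume "a \<in> ?S" "b \<in> ?S"
    then obtain p q where pq: "a = poly p t" "b = poly q t" "p \<in> ?P" "q \<in> ?P" by blast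
    then have "p + q \<in> ?P" "p * q \<in> ?P" "- p \<in> ?P"
      by (simp_all only: subring_add[OF P] subring_mult[OF P] subring_uminus[OF P])
    moreover have "a + b = poly (p + q) t" "a * b = poly (p * q) t" "- a = poly (- p) t"
      using pq by auto
    ultimately show "a + b \<in> ?S" "a * b \<in> ?S" "- a \<in> ?S" by blast+
  qed
  moreover have "noetherian ?S"
    unfolding noetherian_def
  proof (intro allI impI)
    fix f :: "nat \<Rightarrow> 'a" assume "\<forall>i. f i \<in> ?S"
    then obtain p where p: "\<And>i. p i \<in> ?P" "\<And>i. f i = poly (p i) t"
      unfolding image_iff by metis
    obtain m where "p m \<in> span_below ?P p m"
      using NP[unfolded noetherian_def, rule_format, of p] p(1) by blast
    then obtain r where r: "p m = (\<Sum>j<m. r j * p j)" "\<forall>j. r j \<in> ?P"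
      by (rule span_belowE)
    have "f m = (\<Sum>j<m. poly (r j) t * f j)"
      by (simp add: p(2) r(1) poly_sum)
    moreover have "\<forall>j. poly (r j) t \<in> ?S"
      using r(2) by blast
    ultimately have "f m \<in> span_below ?S f m"
      by (rule span_belowI)
    then show "\<exists>m. f m \<in> span_below ?S f m" ..
  qed
  moreover have "insert t R \<subseteq> ?S"
  proof
    fix a assume "a \<in> insert t R"
    then consider "a = t" | "a \<in> R" by blast
    then show "a \<in> ?S"
    proof cases
      case 1
      then show ?thesis
        using subring_0[OF R] subring_1[OF R]
        by (intro image_eqI[of _ _ "[:0, 1:]"]) (auto simp: coeff_pCons split: nat.splits)
    next
      case 2
      then show ?thesis
        using subring_0[OF R]
        by (intro image_eqI[of _ _ "[:a:]"]) (auto simp: coeff_pCons split: nat.splits)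
    qed
  qed
  ultimately show ?thesis by blast
qed

text \<open>The constant functions are a copy of the field: either \<open>f 0\<close> is zero and
  lies in the empty span, or \<open>f 1\<close> is a multiple of \<open>f 0\<close>.\<close>

lemma noetherian_constants: "is_subring (range (\<lambda>(c::'k::field) (x::'x). c))"
  "noetherian (range (\<lambda>(c::'k::field) (x::'x). c))"
proof -
  let ?K = "range (\<lambda>(c::'k::field) (x::'x). c)"
  show K: "is_subring ?K"
    unfolding is_subring_def
    by (auto simp: zero_fun_def one_fun_def plus_fun_def times_fun_def fun_Compl_def)
  show "noetherian ?K"
    unfolding noetherian_def
  proof (intro allI impI)
    fix f :: "nat \<Rightarrow> 'x \<Rightarrow> 'k" assume "\<forall>i. f i \<in> ?K"
    then have "\<forall>i. \<exists>c. f i = (\<lambda>x. c)" by blast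
    then obtain c where c: "\<And>i. f i = (\<lambda>x. c i)" by metis
    show "\<exists>m. f m \<in> span_below ?K f m"
    proof (cases "c 0 = 0")
      case True
      then have "f 0 = 0" using c by (simp add: zero_fun_def)
      then show ?thesis using span_below_zero[OF K] by metis
    next
      case False
      then have "f 1 = (\<lambda>x. c 1 / c 0) * f 0"
        by (simp add: c times_fun_def)
      moreover have "(\<lambda>x. c 1 / c 0) * f 0 \<in> span_below ?K f 1"
        by (intro span_below_mult[OF K] span_below_base[OF K]) auto
      ultimately show ?thesis by metis
    qed
  qed
qed

text \<open>The elements of \<open>T\<close> will be the coordinate functions. Using functions
  instead of formal polynomials lets a relation be evaluated directly at a module structure.\<close>

lemma noetherian_function_ring:
  fixes T :: "('x \<Rightarrow> 'k::field) set"
  assumes "finite T"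
  shows "\<exists>R. is_subring R \<and> noetherian R \<and> range (\<lambda>c x. c) \<union> T \<subseteq> R"
  using assms
proof (induction T)
  case empty
  then show ?case using noetherian_constants by auto
next
  case (insert t T)
  then obtain R where R: "is_subring R" "noetherian R" "range (\<lambda>c x. c) \<union> T \<subseteq> R" by blast
  from noetherian_adjoin[OF R(1,2), of t] R(3) show ?case
    by (meson Un_subset_iff insert_subset subset_trans)
qed

section \<open>Matrices over a field\<close>

text \<open>This and the next laws take dimension equations as premises, so that the simplifier can
  discharge them from a collected list of dimension facts. Products are normalised to the
  right.\<close>

lemma mat_assoc: "dim_col A = dim_row B \<Longrightarrow> dim_col B = dim_row C \<Longrightarrow> (A * B) * C = A * (B * (C :: 'a::semiring_0 mat))"
  by (rule assoc_mult_mat[of _ "dim_row A" "dim_row B" _ "dim_row C"]) auto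

lemma mat_add_mult: "dim_row A = dim_row B \<Longrightarrow> dim_col A = dim_col B \<Longrightarrow> dim_col A = dim_row C \<Longrightarrow>
    (A + B) * C = A * C + B * (C :: 'a::semiring_0 mat)"
  by (rule add_mult_distrib_mat[of _ "dim_row A" "dim_row C"]) auto

lemma mat_mult_add: "dim_row B = dim_row C \<Longrightarrow> dim_col B = dim_col C \<Longrightarrow> dim_col A = dim_row B \<Longrightarrow>
    A * (B + C) = A * B + A * (C :: 'a::semiring_0 mat)"
  by (rule mult_add_distrib_mat[of _ "dim_row A" "dim_row B" _ "dim_col B"]) auto

lemma mat_minus_mult: "dim_row A = dim_row B \<Longrightarrow> dim_col A = dim_col B \<Longrightarrow> dim_col A = dim_row C \<Longrightarrow>
    (A - B) * C = A * C - B * (C :: 'a::ring mat)"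
  by (rule minus_mult_distrib_mat[of _ "dim_row A" "dim_row C"]) auto

lemma mat_mult_minus: "dim_row B = dim_row C \<Longrightarrow> dim_col B = dim_col C \<Longrightarrow> dim_col A = dim_row B \<Longrightarrow>
    A * (B - C) = A * B - A * (C :: 'a::ring mat)"
  by (rule mult_minus_distrib_mat[of _ "dim_row A" "dim_row B" _ "dim_col B"]) auto

lemma mat_one_mult: "dim_row A = n \<Longrightarrow> 1\<^sub>m n * A = (A :: 'a::semiring_1 mat)"
  by (rule left_mult_one_mat[of _ _ "dim_col A"]) auto

lemma mat_mult_one: "dim_col A = n \<Longrightarrow> A * 1\<^sub>m n = (A :: 'a::semiring_1 mat)"
  by (rule right_mult_one_mat[of _ "dim_row A"]) auto

lemma mat_zero_mult: "dim_row A = n \<Longrightarrow> 0\<^sub>m m n * A = 0\<^sub>m m (dim_col (A :: 'a::semiring_0 mat))"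
  by (rule left_mult_zero_mat[of _ _ "dim_col A"]) auto

lemma mat_mult_zero: "dim_col A = n \<Longrightarrow> A * 0\<^sub>m n m = 0\<^sub>m (dim_row (A :: 'a::semiring_0 mat)) m"
  by (rule right_mult_zero_mat[of _ "dim_row A"]) auto

lemma mat_add_zero: "dim_row A = m \<Longrightarrow> dim_col A = n \<Longrightarrow> A + 0\<^sub>m m n = (A :: 'a::monoid_add mat)"
  by (rule right_add_zero_mat[of _ m n]) auto

lemma mat_zero_add: "dim_row A = m \<Longrightarrow> dim_col A = n \<Longrightarrow> 0\<^sub>m m n + A = (A :: 'a::monoid_add mat)"
  by (rule left_add_zero_mat[of _ m n]) auto

lemma mat_minus_zero: "dim_row A = m \<Longrightarrow> dim_col A = n \<Longrightarrow> A - 0\<^sub>m m n = (A :: 'a::group_add mat)"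
  by (intro eq_matI) auto

lemma mat_minus_self: "A - A = 0\<^sub>m (dim_row A) (dim_col (A :: 'a::group_add mat))"
  by (intro eq_matI) auto

lemmas mat_ring = mat_assoc mat_add_mult mat_mult_add mat_minus_mult mat_mult_minus mat_one_mult
  mat_mult_one mat_zero_mult mat_mult_zero mat_add_zero mat_zero_add mat_minus_zero mat_minus_self

text \<open>Applies a known product at the head of a right-associated product, where the equation
  itself no longer matches.\<close>

lemma mat_assoc_eq:
  "A * B = C \<Longrightarrow> dim_col A = dim_row B \<Longrightarrow> dim_col B = dim_row X \<Longrightarrow> A * (B * X) = C * (X :: 'a::semiring_0 mat)"
  by (metis mat_assoc)

lemma mat_assoc_eq3:
  "A * (B * C) = D \<Longrightarrow> dim_col A = dim_row B \<Longrightarrow> dim_col B = dim_row C \<Longrightarrow> dim_col C = dim_row X \<Longrightarrow>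
    A * (B * (C * X)) = D * (X :: 'a::semiring_0 mat)"
  by (metis mat_assoc index_mult_mat(2,3))

lemma mat_eq_iff_minus:
  "dim_row A = dim_row B \<Longrightarrow> dim_col A = dim_col B \<Longrightarrow> A - B = 0\<^sub>m (dim_row A) (dim_col A) \<longleftrightarrow> A = (B :: 'a::group_add mat)"
  by (auto simp: mat_eq_iff)

lemma mult_mat_entry:
  "i < dim_row A \<Longrightarrow> j < dim_col B \<Longrightarrow> dim_col A = n \<Longrightarrow> dim_row B = n \<Longrightarrow>
    (A * B) $$ (i, j) = (\<Sum>l<n. A $$ (i, l) * B $$ (l, j))"
  by (simp add: scalar_prod_def lessThan_atLeast0)

text \<open>If \<open>m < k\<close>, padding with zeros gives square matrices of size
  \<open>k\<close> with \<open>F' * G' = 1\<close>. Then also \<open>G' * F' = 1\<close>, although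
  row \<open>m\<close> of \<open>G'\<close> vanishes.\<close>

lemma right_inverse_le:
  fixes F :: "'k::field mat"
  assumes "F \<in> carrier_mat k m" "G \<in> carrier_mat m k" "F * G = 1\<^sub>m k"
  shows "k \<le> m"
proof (rule ccontr)
  assume "\<not> k \<le> m"
  then have mk: "m < k" by simp
  define F' where "F' = mat k k (\<lambda>(r, c). if c < m then F $$ (r, c) else 0)"
  define G' where "G' = mat k k (\<lambda>(r, c). if r < m then G $$ (r, c) else 0)"
  have "F' * G' = 1\<^sub>m k"
  proof (rule eq_matI)
    fix i j assume ij: "i < dim_row (1\<^sub>m k)" "j < dim_col (1\<^sub>m k)"
    have "(F' * G') $$ (i, j) = (\<Sum>l<k. F' $$ (i, l) * G' $$ (l, j))"
      using ij by (intro mult_mat_entry) (auto simp: F'_def G'_def)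
    also have "\<dots> = (\<Sum>l<m. F $$ (i, l) * G $$ (l, j))"
      using ij mk by (intro sum.mono_neutral_cong_right) (auto simp: F'_def G'_def)
    also have "\<dots> = (F * G) $$ (i, j)"
      using ij assms by (intro mult_mat_entry[symmetric]) auto
    finally show "(F' * G') $$ (i, j) = 1\<^sub>m k $$ (i, j)" using assms(3) by simp
  qed (auto simp: F'_def G'_def)
  then have GF: "G' * F' = 1\<^sub>m k"
    by (intro mat_mult_left_right_inverse[of F' k G']) (auto simp: F'_def G'_def)
  have "(G' * F') $$ (m, m) = (\<Sum>l<k. G' $$ (m, l) * F' $$ (l, m))"
    using mk by (intro mult_mat_entry) (auto simp: F'_def G'_def)
  also have "\<dots> = 0"
    using mk by (intro sum.neutral) (simp add: G'_def)
  finally show False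
    using mk by (simp add: GF del: index_mult_mat)
qed

text \<open>Take \<open>b\<close>, \<open>c\<close> of the largest size \<open>k\<close> that split
  off a part of \<open>e\<close>. The remainder \<open>r = e - b * c\<close> is an idempotent
  annihilated by \<open>c\<close> and \<open>b\<close>; a nonzero entry of \<open>r\<close> would
  provide one more row and column.\<close>

lemma idempotent_splits:
  fixes e :: "'k::field mat"
  assumes e: "e \<in> carrier_mat m m" and ee: "e * e = e"
  obtains k b c where "b \<in> carrier_mat m k" "c \<in> carrier_mat k m" "c * b = 1\<^sub>m k" "b * c = e"
proof -
  define Q where "Q k b c \<longleftrightarrow> b \<in> carrier_mat m k \<and> c \<in> carrier_mat k m \<and> c * b = 1\<^sub>m k
    \<and> c * e = c \<and> e * b = b" for k and b c :: "'k mat"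
  have Q0: "\<exists>b c. Q 0 b c"
    unfolding Q_def using e
    by (intro exI[of _ "0\<^sub>m m 0"] exI[of _ "0\<^sub>m 0 m"]) auto
  have "k \<le> m" if "\<exists>b c. Q k b c" for k
    using that right_inverse_le unfolding Q_def by blast
  then obtain k where k: "\<exists>b c. Q k b c" and max: "\<And>l. (\<exists>b c. Q l b c) \<Longrightarrow> l \<le> k"
    using Q0 Nat.ex_has_greatest_nat[of "\<lambda>k. \<exists>b c. Q k b c" 0 m] by metis
  from k obtain b c where "Q k b c" by blast
  then have b: "b \<in> carrier_mat m k" and c: "c \<in> carrier_mat k m" and cb: "c * b = 1\<^sub>m k"
    and ce: "c * e = c" and eb: "e * b = b"
    by (auto simp: Q_def)
  define r where "r = e - b * c"
  have r: "r \<in> carrier_mat m m"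
    using e b c by (auto simp: r_def)
  note d = carrier_matD[OF e] carrier_matD[OF b] carrier_matD[OF c] carrier_matD[OF r]
  have cr: "c * r = 0\<^sub>m k m"
    unfolding r_def by (simp add: d mat_ring ce mat_assoc_eq[OF cb])
  have rb: "r * b = 0\<^sub>m m k"
    unfolding r_def by (simp add: d mat_ring eb cb)
  have re: "r * e = r"
    unfolding r_def by (simp add: d mat_ring ce ee)
  have er: "e * r = r"
    unfolding r_def by (simp add: d mat_ring mat_assoc_eq[OF eb] ee)
  have rr: "r * r = r"
  proof -
    have "r * r = r * e - r * (b * c)"
      by (subst (2) r_def) (simp add: d mat_ring)
    then show ?thesis
      by (simp add: d mat_ring mat_assoc_eq[OF rb] re)
  qed
  have "r = 0\<^sub>m m m"
  proof (rule ccontr)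
    assume "r \<noteq> 0\<^sub>m m m"
    then obtain i0 j0 where ij: "i0 < m" "j0 < m" and nz: "r $$ (i0, j0) \<noteq> 0"
      using r by (metis (no_types, lifting) carrier_matD eq_matI index_zero_mat)
    \<comment> \<open>Row \<open>i0\<close> of \<open>r\<close> times column \<open>j0\<close> of
      \<open>r\<close> is this entry of \<open>r * r = r\<close>, so dividing the new column by
      \<open>s\<close> makes the new diagonal entry 1.\<close>
    define s where "s = r $$ (i0, j0)"
    define c2 where "c2 = mat (Suc k) m (\<lambda>(i, j). if i < k then c $$ (i, j) else r $$ (i0, j))"
    define b2 where "b2 = mat m (Suc k) (\<lambda>(i, j). if j < k then b $$ (i, j) else r $$ (i, j0) / s)"
    have d2: "dim_row c2 = Suc k" "dim_col c2 = m" "dim_row b2 = m" "dim_col b2 = Suc k"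
      by (auto simp: c2_def b2_def)
    have c2_mult: "(c2 * X) $$ (i, j) = (if i < k then (c * X) $$ (i, j) else (r * X) $$ (i0, j))"
      if "i < Suc k" "j < dim_col X" "dim_row X = m" for X i j
    proof -
      have "(c2 * X) $$ (i, j) = (\<Sum>l<m. c2 $$ (i, l) * X $$ (l, j))"
        by (rule mult_mat_entry) (use that d2 in auto)
      moreover have "(c * X) $$ (i, j) = (\<Sum>l<m. c $$ (i, l) * X $$ (l, j))" if "i < k"
        by (rule mult_mat_entry) (use that \<open>j < _\<close> \<open>dim_row X = m\<close> d in auto)
      moreover have "(r * X) $$ (i0, j) = (\<Sum>l<m. r $$ (i0, l) * X $$ (l, j))"
        by (rule mult_mat_entry) (use that d ij in auto)
      ultimately show ?thesis
        using that by (auto simp: c2_def)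
    qed
    have mult_b2: "(X * b2) $$ (i, j) = (if j < k then (X * b) $$ (i, j) else (X * r) $$ (i, j0) / s)"
      if "j < Suc k" "i < dim_row X" "dim_col X = m" for X i j
    proof -
      have "(X * b2) $$ (i, j) = (\<Sum>l<m. X $$ (i, l) * b2 $$ (l, j))"
        by (rule mult_mat_entry) (use that d2 in auto)
      moreover have "(X * b) $$ (i, j) = (\<Sum>l<m. X $$ (i, l) * b $$ (l, j))" if "j < k"
        by (rule mult_mat_entry) (use that \<open>i < _\<close> \<open>dim_col X = m\<close> d in auto)
      moreover have "(X * r) $$ (i, j0) = (\<Sum>l<m. X $$ (i, l) * r $$ (l, j0))"
        by (rule mult_mat_entry) (use that d ij in auto)
      ultimately show ?thesis
        using that by (auto simp: b2_def sum_divide_distrib)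
    qed
    have "c2 * b2 = 1\<^sub>m (Suc k)"
    proof (rule eq_matI)
      fix i j assume "i < dim_row (1\<^sub>m (Suc k))" "j < dim_col (1\<^sub>m (Suc k))"
      then have "i < Suc k" "j < Suc k" by auto
      have A: "(c2 * b2) $$ (i, j) = (if i < k then (c * b2) $$ (i, j) else (r * b2) $$ (i0, j))"
        by (rule c2_mult) (use \<open>i < Suc k\<close> \<open>j < Suc k\<close> d2 in auto)
      show "(c2 * b2) $$ (i, j) = 1\<^sub>m (Suc k) $$ (i, j)"
      proof (cases "i < k")
        case True
        have "(c * b2) $$ (i, j) = (if j < k then (c * b) $$ (i, j) else (c * r) $$ (i, j0) / s)"
          by (rule mult_b2) (use \<open>j < Suc k\<close> True d in auto)
        then show ?thesis
          using A True \<open>j < Suc k\<close> ij by (auto simp: cb cr)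
      next
        case False
        have "(r * b2) $$ (i0, j) = (if j < k then (r * b) $$ (i0, j) else (r * r) $$ (i0, j0) / s)"
          by (rule mult_b2) (use \<open>j < Suc k\<close> d ij in auto)
        then show ?thesis
          using A False \<open>i < Suc k\<close> \<open>j < Suc k\<close> ij nz by (auto simp: rb rr s_def)
      qed
    qed (auto simp: d2)
    moreover have "c2 * e = c2"
    proof (rule eq_matI)
      fix i j assume "i < dim_row c2" "j < dim_col c2"
      then have ij: "i < Suc k" "j < m" using d2 by auto
      have "(c2 * e) $$ (i, j) = (if i < k then (c * e) $$ (i, j) else (r * e) $$ (i0, j))"
        by (rule c2_mult) (use ij d in auto)
      then show "(c2 * e) $$ (i, j) = c2 $$ (i, j)"
        using ij by (auto simp: ce re c2_def)
    qed (auto simp: d d2)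
    moreover have "e * b2 = b2"
    proof (rule eq_matI)
      fix i j assume "i < dim_row b2" "j < dim_col b2"
      then have ij: "i < m" "j < Suc k" using d2 by auto
      have "(e * b2) $$ (i, j) = (if j < k then (e * b) $$ (i, j) else (e * r) $$ (i, j0) / s)"
        by (rule mult_b2) (use ij d in auto)
      then show "(e * b2) $$ (i, j) = b2 $$ (i, j)"
        using ij by (auto simp: eb er b2_def)
    qed (auto simp: d d2)
    ultimately have "Q (Suc k) b2 c2"
      unfolding Q_def using d2 by auto
    then show False using max[of "Suc k"] by auto
  qed
  then have "e = b * c"
    using mat_eq_iff_minus[of e "b * c"] by (simp add: r_def d)
  then show thesis using that b c cb by simp
qed

text \<open>Only unit rows have to be reached, one at a time; this matches the construction of a
  free module by adding one summand per coordinate.\<close>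

lemma stack_rows:
  fixes F :: "'k::field mat"
  assumes "F \<in> carrier_mat n m"
    and "\<And>c. c < m \<Longrightarrow> \<exists>k\<in>carrier_mat 1 n. k * F = mat 1 m (\<lambda>(_, j). if j = c then 1 else 0)"
  shows "\<exists>G\<in>carrier_mat m n. G * F = 1\<^sub>m m"
proof -
  obtain k where k: "\<And>c. c < m \<Longrightarrow> k c \<in> carrier_mat 1 n"
    "\<And>c. c < m \<Longrightarrow> k c * F = mat 1 m (\<lambda>(_, j). if j = c then 1 else 0)"
    using assms(2) by metis
  let ?G = "mat m n (\<lambda>(i, j). k i $$ (0, j))"
  have "?G * F = 1\<^sub>m m"
  proof (rule eq_matI)
    fix i j assume "i < dim_row (1\<^sub>m m)" "j < dim_col (1\<^sub>m m)"
    then have ij: "i < m" "j < m" by auto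
    have "(?G * F) $$ (i, j) = (\<Sum>l<n. ?G $$ (i, l) * F $$ (l, j))"
      by (rule mult_mat_entry) (use ij assms in auto)
    also have "\<dots> = (\<Sum>l<n. k i $$ (0, l) * F $$ (l, j))"
      using ij by simp
    also have "\<dots> = (k i * F) $$ (0, j)"
      by (rule mult_mat_entry[symmetric]) (use ij assms k(1)[of i] in auto)
    finally show "(?G * F) $$ (i, j) = 1\<^sub>m m $$ (i, j)"
      using k(2)[of i] ij by auto
  qed (use assms in auto)
  then show ?thesis by (intro bexI[of _ ?G]) auto
qed

lemma stack_cols:
  fixes F :: "'k::field mat"
  assumes F: "F \<in> carrier_mat m n"
    and "\<And>c. c < m \<Longrightarrow> \<exists>k\<in>carrier_mat n 1. F * k = mat m 1 (\<lambda>(i, _). if i = c then 1 else 0)"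
  shows "\<exists>G\<in>carrier_mat n m. F * G = 1\<^sub>m m"
proof -
  have "\<exists>G\<in>carrier_mat m n. G * transpose_mat F = 1\<^sub>m m"
  proof (rule stack_rows)
    fix c assume "c < m"
    then obtain k where k: "k \<in> carrier_mat n 1" "F * k = mat m 1 (\<lambda>(i, _). if i = c then 1 else 0)"
      using assms(2) by blast
    have "transpose_mat k * transpose_mat F = transpose_mat (F * k)"
      by (rule transpose_mult[symmetric]) (use F k in auto)
    then show "\<exists>k\<in>carrier_mat 1 n. k * transpose_mat F = mat 1 m (\<lambda>(_, j). if j = c then 1 else 0)"
      using k by (intro bexI[of _ "transpose_mat k"]) (auto simp: mat_eq_iff)
  qed (use F in auto)
  then obtain G where G: "G \<in> carrier_mat m n" "G * transpose_mat F = 1\<^sub>m m" by blast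
  have "F * transpose_mat G = transpose_mat (G * transpose_mat F)"
    by (subst transpose_mult[of G m n _ m]) (use F G in auto)
  then show ?thesis
    using G by (intro bexI[of _ "transpose_mat G"]) auto
qed

section \<open>Action of matrices on row vectors\<close>

lemma vmul_carrier: "F \<in> carrier_mat m n \<Longrightarrow> vmul v F \<in> carrier_vec n"
  by (auto simp: vmul_def)

lemma vmul_eq: "vmul v F = transpose_mat F *\<^sub>v v" if "dim_vec v = dim_row F"
  using that by (auto simp: vmul_def mult_mat_vec_def intro!: eq_vecI comm_scalar_prod carrier_vecI)

lemma vmul_mult:
  assumes "v \<in> carrier_vec m" "F \<in> carrier_mat m n" "G \<in> carrier_mat n l"
  shows "vmul v (F * G) = vmul (vmul v F) G"
proof -
  have "vmul v (F * G) = transpose_mat G * transpose_mat F *\<^sub>v v"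
    using assms by (simp add: vmul_eq transpose_mult)
  also have "\<dots> = transpose_mat G *\<^sub>v (transpose_mat F *\<^sub>v v)"
    using assms by (intro assoc_mult_mat_vec[of _ l n _ m]) auto
  finally show ?thesis
    using assms by (simp add: vmul_eq vmul_carrier)
qed

lemma vmul_one: "v \<in> carrier_vec m \<Longrightarrow> vmul v (1\<^sub>m m) = v"
  by (simp add: vmul_eq)

lemma vmul_zero_mat: "v \<in> carrier_vec m \<Longrightarrow> vmul v (0\<^sub>m m n) = 0\<^sub>v n"
  by (auto simp: vmul_def intro!: eq_vecI)

lemma vmul_zero_vec: "F \<in> carrier_mat m n \<Longrightarrow> vmul (0\<^sub>v m) F = 0\<^sub>v n"
  by (auto simp: vmul_def intro!: eq_vecI)

lemma vmul_add_mat: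
  "v \<in> carrier_vec m \<Longrightarrow> F \<in> carrier_mat m n \<Longrightarrow> G \<in> carrier_mat m n \<Longrightarrow>
    vmul v (F + G) = vmul v F + vmul v G"
  by (auto simp: vmul_def scalar_prod_add_distrib[of _ m] intro!: eq_vecI)

lemma vmul_unit:
  assumes "F \<in> carrier_mat m n" "i < m"
  shows "vmul (unit_vec m i) F = row F i"
  using assms by (auto simp: vmul_def intro!: eq_vecI)

lemma mat_eq_if_vmul_eq:
  assumes "F \<in> carrier_mat m n" "G \<in> carrier_mat m n" "\<And>v. v \<in> carrier_vec m \<Longrightarrow> vmul v F = vmul v G"
  shows "F = G"
proof (rule eq_rowI)
  fix i assume "i < dim_row G"
  then show "row F i = row G i"
    using assms vmul_unit by (metis carrier_matD(1) unit_vec_carrier)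
qed (use assms in auto)

lemma surjective_right_inverse:
  fixes F :: "'k::field mat"
  assumes F: "F \<in> carrier_mat m n" and surj: "\<And>w. w \<in> carrier_vec n \<Longrightarrow> \<exists>v\<in>carrier_vec m. vmul v F = w"
  shows "\<exists>G\<in>carrier_mat n m. G * F = 1\<^sub>m n"
proof -
  have "\<forall>i. \<exists>v. v \<in> carrier_vec m \<and> vmul v F = unit_vec n i"
    using surj by (meson unit_vec_carrier)
  then obtain v where v: "\<And>i. v i \<in> carrier_vec m" "\<And>i. vmul (v i) F = unit_vec n i" by metis
  let ?G = "mat_of_rows m (map v [0..<n])"
  have G: "?G \<in> carrier_mat n m" by (simp add: mat_of_rows_def)
  have "?G * F = 1\<^sub>m n"
  proof (rule eq_rowI)
    fix i assume "i < dim_row (1\<^sub>m n)"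
    then have i: "i < n" by simp
    have "row (?G * F) i = vmul (vmul (unit_vec n i) ?G) F"
      using i F G by (subst vmul_unit[symmetric, of _ n n]) (auto intro!: vmul_mult)
    also have "vmul (unit_vec n i) ?G = v i"
      using i v G by (subst vmul_unit) auto
    finally show "row (?G * F) i = row (1\<^sub>m n) i"
      using v i by simp
  qed (use F in auto)
  then show ?thesis using G by blast
qed

section \<open>Modules and short exact sequences\<close>

lemma mat_smult_mult: "dim_col A = dim_row B \<Longrightarrow> (x \<cdot>\<^sub>m A) * B = x \<cdot>\<^sub>m (A * (B :: 'a::comm_semiring_0 mat))"
  by (rule mult_smult_assoc_mat[of _ "dim_row A" "dim_row B" _ "dim_col B"]) auto

lemma mat_mult_smult: "dim_col A = dim_row B \<Longrightarrow> A * (x \<cdot>\<^sub>m B) = x \<cdot>\<^sub>m (A * (B :: 'a::comm_semiring_0 mat))"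
  by (rule mult_smult_distrib[of _ "dim_row A" "dim_row B" _ "dim_col B"]) auto

lemma mat_smult_add: "dim_row A = dim_row B \<Longrightarrow> dim_col A = dim_col B \<Longrightarrow>
    x \<cdot>\<^sub>m (A + B) = x \<cdot>\<^sub>m A + x \<cdot>\<^sub>m (B :: 'a::semiring mat)"
  by (intro eq_matI) (auto simp: distrib_left)

locale fdalg =
  fixes A :: "'k::field fdalg"
  assumes fd_algebra: "fd_algebra A"
begin

abbreviation module where "module \<equiv> is_module A"
abbreviation hom where "hom \<equiv> is_hom A"

lemma homI:
  "F \<in> carrier_mat (fst X) (fst Y) \<Longrightarrow> (\<And>a. a \<in> carrier_vec (dimA A) \<Longrightarrow> snd X a * F = F * snd Y a) \<Longrightarrow> hom X Y F"
  by (simp add: is_hom_def)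

lemma hom_carrier: "hom X Y F \<Longrightarrow> F \<in> carrier_mat (fst X) (fst Y)"
  by (simp add: is_hom_def)

lemma hom_dim: "hom X Y F \<Longrightarrow> dim_row F = fst X" "hom X Y F \<Longrightarrow> dim_col F = fst Y"
  by (auto simp: is_hom_def)

lemma hom_comm: "hom X Y F \<Longrightarrow> a \<in> carrier_vec (dimA A) \<Longrightarrow> snd X a * F = F * snd Y a"
  by (simp add: is_hom_def)

lemma module_dim:
  "module X \<Longrightarrow> a \<in> carrier_vec (dimA A) \<Longrightarrow> dim_row (snd X a) = fst X"
  "module X \<Longrightarrow> a \<in> carrier_vec (dimA A) \<Longrightarrow> dim_col (snd X a) = fst X"
  by (auto simp: is_module_def Let_def)

lemma hom_one: "module X \<Longrightarrow> hom X X (1\<^sub>m (fst X))"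
  by (intro homI) (auto simp: module_dim mat_ring)

lemma hom_zero: "module X \<Longrightarrow> module Y \<Longrightarrow> hom X Y (0\<^sub>m (fst X) (fst Y))"
  by (intro homI) (auto simp: module_dim mat_ring)

lemma hom_mult:
  assumes "module X" "module Y" "module Z" "hom X Y F" "hom Y Z G"
  shows "hom X Z (F * G)"
proof (rule homI)
  show "F * G \<in> carrier_mat (fst X) (fst Z)"
    using assms(4,5) by (intro carrier_matI) (simp_all add: hom_dim)
  fix a :: "'k vec" assume a: "a \<in> carrier_vec (dimA A)"
  note d = assms(1-3)[THEN module_dim(1), OF a] assms(1-3)[THEN module_dim(2), OF a]
    assms(4,5)[THEN hom_dim(1)] assms(4,5)[THEN hom_dim(2)]
  have "snd X a * (F * G) = F * (snd Y a * G)"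
    using mat_assoc_eq[OF hom_comm[OF assms(4) a]] d by (simp add: mat_assoc)
  then show "snd X a * (F * G) = F * G * snd Z a"
    using d by (simp add: hom_comm[OF assms(5) a] mat_assoc)
qed

lemma hom_add:
  assumes "module X" "module Y" "hom X Y F" "hom X Y G"
  shows "hom X Y (F + G)"
proof (rule homI)
  show "F + G \<in> carrier_mat (fst X) (fst Y)"
    using assms(3,4) by (intro carrier_matI) (simp_all add: hom_dim)
  fix a :: "'k vec" assume a: "a \<in> carrier_vec (dimA A)"
  note d = assms(1-2)[THEN module_dim(1), OF a] assms(1-2)[THEN module_dim(2), OF a]
    assms(3,4)[THEN hom_dim(1)] assms(3,4)[THEN hom_dim(2)]
  show "snd X a * (F + G) = (F + G) * snd Y a"
    using d by (simp add: mat_ring hom_comm[OF assms(3) a] hom_comm[OF assms(4) a])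
qed

lemma hom_uminus:
  assumes "module X" "module Y" "hom X Y F"
  shows "hom X Y (- F)"
  using assms by (intro homI) (auto simp: hom_dim hom_comm module_dim dest: hom_carrier)

lemma hom_minus:
  assumes "module X" "module Y" "hom X Y F" "hom X Y G"
  shows "hom X Y (F - G)"
proof -
  have "F - G = F + (- G)"
    using assms by (intro eq_matI) (auto simp: hom_dim)
  then show ?thesis
    using hom_add[OF assms(1-3) hom_uminus[OF assms(1,2,4)]] by simp
qed

text \<open>Only the inclusions \<open>s1\<close>, \<open>s2\<close>, the projections
  \<open>r1\<close>, \<open>r2\<close> and the biproduct identities are exported, so later arguments
  never look at block entries.\<close>

lemma direct_sum:
  assumes X: "module X" and Y: "module Y"
  obtains T s1 s2 r1 r2 where "module T" "hom X T s1" "hom Y T s2" "hom T X r1" "hom T Y r2"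
    "s1 * r1 = 1\<^sub>m (fst X)" "s2 * r2 = 1\<^sub>m (fst Y)" "s1 * r2 = 0\<^sub>m (fst X) (fst Y)"
    "s2 * r1 = 0\<^sub>m (fst Y) (fst X)" "r1 * s1 + r2 * s2 = 1\<^sub>m (fst T)"
proof -
  let ?x = "fst X" and ?y = "fst Y"
  define s1 :: "'k mat" where "s1 = mat ?x (?x + ?y) (\<lambda>(i, j). if i = j then 1 else 0)"
  define r1 :: "'k mat" where "r1 = mat (?x + ?y) ?x (\<lambda>(i, j). if i = j then 1 else 0)"
  define s2 :: "'k mat" where "s2 = mat ?y (?x + ?y) (\<lambda>(i, j). if ?x + i = j then 1 else 0)"
  define r2 :: "'k mat" where "r2 = mat (?x + ?y) ?y (\<lambda>(i, j). if i = ?x + j then 1 else 0)"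
  have d: "dim_row s1 = ?x" "dim_col s1 = ?x + ?y" "dim_row s2 = ?y" "dim_col s2 = ?x + ?y"
    "dim_row r1 = ?x + ?y" "dim_col r1 = ?x" "dim_row r2 = ?x + ?y" "dim_col r2 = ?y"
    by (auto simp: s1_def r1_def s2_def r2_def)
  have one: "(if i = j then 1 else 0) * c = (if j = i then c else 0)" for i j :: nat and c :: 'k
    by simp
  have "(s1 * r1) $$ (i, j) = 1\<^sub>m ?x $$ (i, j)" if "i < ?x" "j < ?x" for i j
    using that d by (subst mult_mat_entry[of _ _ _ _ "?x + ?y"]) (auto simp: s1_def r1_def one)
  moreover have "(s2 * r2) $$ (i, j) = 1\<^sub>m ?y $$ (i, j)" if "i < ?y" "j < ?y" for i j
    using that d by (subst mult_mat_entry[of _ _ _ _ "?x + ?y"]) (auto simp: s2_def r2_def one)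
  moreover have "(s1 * r2) $$ (i, j) = 0\<^sub>m ?x ?y $$ (i, j)" if "i < ?x" "j < ?y" for i j
    using that d by (subst mult_mat_entry[of _ _ _ _ "?x + ?y"]) (auto simp: s1_def r2_def one)
  moreover have "(s2 * r1) $$ (i, j) = 0\<^sub>m ?y ?x $$ (i, j)" if "i < ?y" "j < ?x" for i j
    using that d by (subst mult_mat_entry[of _ _ _ _ "?x + ?y"]) (auto simp: s2_def r1_def one)
  ultimately have sr: "s1 * r1 = 1\<^sub>m ?x" "s2 * r2 = 1\<^sub>m ?y" "s1 * r2 = 0\<^sub>m ?x ?y" "s2 * r1 = 0\<^sub>m ?y ?x"
    using d by (auto intro!: eq_matI simp del: index_mult_mat(1))
  have rs: "r1 * s1 + r2 * s2 = 1\<^sub>m (?x + ?y)"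
  proof (rule eq_matI)
    fix i j assume "i < dim_row (1\<^sub>m (?x + ?y))" "j < dim_col (1\<^sub>m (?x + ?y))"
    then have ij: "i < ?x + ?y" "j < ?x + ?y" by auto
    have 1: "(r1 * s1) $$ (i, j) = (if i = j \<and> i < ?x then 1 else 0)"
      using ij d by (subst mult_mat_entry[of _ _ _ _ "?x"]) (auto simp: r1_def s1_def one)
    have 2: "(r2 * s2) $$ (i, j) = (if i = j \<and> ?x \<le> i then 1 else 0)"
    proof -
      have "(r2 * s2) $$ (i, j) = (\<Sum>l<?y. r2 $$ (i, l) * s2 $$ (l, j))"
        by (rule mult_mat_entry) (use ij d in auto)
      also have "\<dots> = (\<Sum>l<?y. if l = i - ?x then (if i = j \<and> ?x \<le> i then 1 else 0) else 0)"
        using ij by (intro sum.cong) (auto simp: r2_def s2_def)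
      also have "\<dots> = (if i = j \<and> ?x \<le> i then 1 else 0)"
        using ij by auto
      finally show ?thesis .
    qed
    show "(r1 * s1 + r2 * s2) $$ (i, j) = 1\<^sub>m (?x + ?y) $$ (i, j)"
      using ij d by (simp add: 1 2 del: index_mult_mat(1))
  qed (auto simp: d)
  define \<tau> where "\<tau> a = r1 * (snd X a * s1) + r2 * (snd Y a * s2)" for a
  let ?T = "(?x + ?y, \<tau>)"
  note m = mat_ring mat_assoc_eq[OF sr(1)] mat_assoc_eq[OF sr(2)] mat_assoc_eq[OF sr(3)] mat_assoc_eq[OF sr(4)] sr
  have "module ?T"
    unfolding is_module_def Let_def fst_conv snd_conv
  proof (intro conjI ballI allI)
    fix a b :: "'k vec" and x :: 'k
    assume a: "a \<in> carrier_vec (dimA A)"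
    note da = module_dim[OF X a] module_dim[OF Y a]
    show "\<tau> a \<in> carrier_mat (?x + ?y) (?x + ?y)"
      by (intro carrier_matI) (simp_all add: \<tau>_def d da)
    have "\<tau> (x \<cdot>\<^sub>v a) = r1 * ((x \<cdot>\<^sub>m snd X a) * s1) + r2 * ((x \<cdot>\<^sub>m snd Y a) * s2)"
      using X Y a by (simp add: \<tau>_def is_module_def Let_def)
    also have "\<dots> = x \<cdot>\<^sub>m \<tau> a"
      unfolding \<tau>_def using da d by (simp add: mat_smult_mult mat_mult_smult mat_smult_add)
    finally show "\<tau> (x \<cdot>\<^sub>v a) = x \<cdot>\<^sub>m \<tau> a" .
    assume b: "b \<in> carrier_vec (dimA A)"
    note db = module_dim[OF X b] module_dim[OF Y b]
    have ab: "snd X (a + b) = snd X a + snd X b" "snd Y (a + b) = snd Y a + snd Y b"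
      "snd X (mulA A a b) = snd X a * snd X b" "snd Y (mulA A a b) = snd Y a * snd Y b"
      using X Y a b by (simp_all add: is_module_def Let_def)
    show "\<tau> (a + b) = \<tau> a + \<tau> b"
      unfolding \<tau>_def ab using d da db by (intro eq_matI) (simp_all add: mat_ring del: index_mult_mat(1))
    show "\<tau> (mulA A a b) = \<tau> a * \<tau> b"
      unfolding \<tau>_def ab using d da db by (simp add: m)
  next
    have "snd X (oneA A) = 1\<^sub>m ?x" "snd Y (oneA A) = 1\<^sub>m ?y"
      using X Y by (simp_all add: is_module_def Let_def)
    then show "\<tau> (oneA A) = 1\<^sub>m (?x + ?y)"
      by (simp add: \<tau>_def d mat_ring rs)
  qed
  moreover have "hom X ?T s1" "hom Y ?T s2" "hom ?T X r1" "hom ?T Y r2"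
    unfolding is_hom_def \<tau>_def fst_conv snd_conv
    by (auto intro!: carrier_matI simp: d m module_dim[OF X] module_dim[OF Y])
  ultimately show thesis
    using that[of ?T s1 s2 r1 r2] sr rs by simp
qed

text \<open>The image of an idempotent endomorphism \<open>b * c\<close> is a summand, with
  inclusion \<open>c\<close> and projection \<open>b\<close>. Since the idempotent commutes with the
  action, inserting it between two factors changes nothing, which makes the compressed action
  multiplicative.\<close>

lemma hom_retract:
  assumes P: "module P" and c: "c \<in> carrier_mat k (fst P)" and b: "b \<in> carrier_mat (fst P) k"
    and cb: "c * b = 1\<^sub>m k" and e: "hom P P (b * c)"
  shows "module (k, \<lambda>a. c * (snd P a * b))" (is "module ?K")
    "hom P (k, \<lambda>a. c * (snd P a * b)) b" "hom (k, \<lambda>a. c * (snd P a * b)) P c"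
proof -
  note d = carrier_matD[OF b] carrier_matD[OF c]
  note cb' = mat_assoc_eq[OF cb]
  have ba: "b * (c * (snd P a * b)) = snd P a * b" if a: "a \<in> carrier_vec (dimA A)" for a
  proof -
    note da = module_dim[OF P a]
    have "b * (c * (snd P a * b)) = ((b * c) * snd P a) * b"
      using d da by (simp add: mat_assoc)
    also have "\<dots> = snd P a * b"
      using d da hom_comm[OF e a] by (simp add: mat_ring cb flip: hom_comm[OF e a])
    finally show ?thesis .
  qed
  have ac: "c * (snd P a * (b * c)) = c * snd P a" if a: "a \<in> carrier_vec (dimA A)" for a
  proof -
    note da = module_dim[OF P a]
    show ?thesis
      using d da hom_comm[OF e a] by (simp add: mat_ring cb')
  qed
  show "hom P ?K b"
    by (rule homI) (use d ba b in auto)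
  show "hom ?K P c"
    by (rule homI) (use d ac c in \<open>auto simp: mat_assoc module_dim[OF P]\<close>)
  show "module ?K"
    unfolding is_module_def Let_def fst_conv snd_conv
  proof (intro conjI ballI allI)
    fix a b' :: "'k vec" and x :: 'k
    assume a: "a \<in> carrier_vec (dimA A)"
    note da = module_dim[OF P a]
    show "c * (snd P a * b) \<in> carrier_mat k k"
      using d da by auto
    have "snd P (x \<cdot>\<^sub>v a) = x \<cdot>\<^sub>m snd P a"
      using P a by (simp add: is_module_def Let_def)
    then show "c * (snd P (x \<cdot>\<^sub>v a) * b) = x \<cdot>\<^sub>m (c * (snd P a * b))"
      using d da by (simp add: mat_smult_mult mat_mult_smult)
    assume b': "b' \<in> carrier_vec (dimA A)"
    note db = module_dim[OF P b']
    have ab: "snd P (a + b') = snd P a + snd P b'" "snd P (mulA A a b') = snd P a * snd P b'"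
      using P a b' by (simp_all add: is_module_def Let_def)
    show "c * (snd P (a + b') * b) = c * (snd P a * b) + c * (snd P b' * b)"
      unfolding ab using d da db by (simp add: mat_ring)
    show "c * (snd P (mulA A a b') * b) = c * (snd P a * b) * (c * (snd P b' * b))"
      unfolding ab using d da db by (simp add: mat_ring ba[OF b'])
  next
    have "snd P (oneA A) = 1\<^sub>m (fst P)"
      using P by (simp add: is_module_def Let_def)
    then show "c * (snd P (oneA A) * b) = 1\<^sub>m k"
      using d by (simp add: mat_ring cb)
  qed
qed

text \<open>Exactness is recorded by splittings \<open>i'\<close>, \<open>p'\<close> that are linear
  but in general not module maps. Over a field they always exist, and they turn arguments with
  kernels and cokernels into matrix identities.\<close>

definition ses :: "'k fdmod \<Rightarrow> 'k fdmod \<Rightarrow> 'k fdmod \<Rightarrow> 'k mat \<Rightarrow> 'k mat \<Rightarrow> bool" where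
  "ses N F C i p \<longleftrightarrow> module N \<and> module F \<and> module C \<and> hom N F i \<and> hom F C p \<and>
    i * p = 0\<^sub>m (fst N) (fst C) \<and>
    (\<exists>i' p'. i' \<in> carrier_mat (fst F) (fst N) \<and> p' \<in> carrier_mat (fst C) (fst F) \<and>
      i * i' = 1\<^sub>m (fst N) \<and> p' * p = 1\<^sub>m (fst C) \<and> i' * i + p * p' = 1\<^sub>m (fst F))"

lemma sesE:
  assumes "ses N F C i p"
  obtains i' p' where "i' \<in> carrier_mat (fst F) (fst N)" "p' \<in> carrier_mat (fst C) (fst F)"
    "i * i' = 1\<^sub>m (fst N)" "p' * p = 1\<^sub>m (fst C)" "i' * i + p * p' = 1\<^sub>m (fst F)"
  using assms unfolding ses_def by blast

lemma sesD:
  assumes "ses N F C i p"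
  shows "module N" "module F" "module C" "hom N F i" "hom F C p" "i * p = 0\<^sub>m (fst N) (fst C)"
  using assms unfolding ses_def by blast+

lemma ses_dim:
  assumes "ses N F C i p"
  shows "dim_row i = fst N" "dim_col i = fst F" "dim_row p = fst F" "dim_col p = fst C"
  using sesD[OF assms] by (auto simp: hom_dim)

lemma ses_epi:
  assumes "ses N F C i p" "dim_row X = fst C" "dim_row Y = fst C" "p * X = p * Y"
  shows "X = Y"
proof -
  obtain i' p' where p': "p' \<in> carrier_mat (fst C) (fst F)" "p' * p = 1\<^sub>m (fst C)"
    using sesE[OF assms(1)] by metis
  note d = ses_dim[OF assms(1)] carrier_matD[OF p'(1)] assms(2,3)
  have "p' * (p * X) = p' * (p * Y)" using assms(4) by simp
  then show ?thesis
    using d by (simp add: mat_assoc_eq[OF p'(2)] mat_ring)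
qed

text \<open>The factor is \<open>p' * h\<close>. Although \<open>p'\<close> is only linear, this is
  a module map, because the required identity holds after composing with the epimorphism
  \<open>p\<close>.\<close>

lemma ses_factor:
  assumes "ses N F C i p" "module Z" "hom F Z h" "i * h = 0\<^sub>m (fst N) (fst Z)"
  obtains k where "hom C Z k" "h = p * k"
proof -
  obtain i' p' where i': "i' \<in> carrier_mat (fst F) (fst N)" and p': "p' \<in> carrier_mat (fst C) (fst F)"
    and ip: "i' * i + p * p' = 1\<^sub>m (fst F)"
    using sesE[OF assms(1)] by metis
  note d = ses_dim[OF assms(1)] carrier_matD[OF p'] carrier_matD[OF i'] hom_dim[OF assms(3)]
  have "h = (i' * i + p * p') * h"
    using d ip by (simp add: mat_ring)
  then have h: "h = p * (p' * h)"
    using d by (simp add: mat_ring assms(4))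
  have "hom C Z (p' * h)"
  proof (rule homI)
    show "p' * h \<in> carrier_mat (fst C) (fst Z)" using d by auto
    fix a :: "'k vec" assume a: "a \<in> carrier_vec (dimA A)"
    note da = module_dim[OF sesD(1)[OF assms(1)] a] module_dim[OF sesD(2)[OF assms(1)] a]
      module_dim[OF sesD(3)[OF assms(1)] a] module_dim[OF assms(2) a]
    have "p * (snd C a * (p' * h)) = snd F a * (p * (p' * h))"
      using d da by (simp add: mat_assoc_eq[OF hom_comm[OF sesD(5)[OF assms(1)] a, symmetric]] mat_assoc)
    also have "\<dots> = p * (p' * h * snd Z a)"
      using d da by (simp add: h[symmetric] hom_comm[OF assms(3) a] mat_assoc_eq3[OF h[symmetric]] mat_assoc)
    finally show "snd C a * (p' * h) = p' * h * snd Z a"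
      by (rule ses_epi[OF assms(1), rotated 2]) (use d da in auto)
  qed
  then show thesis using that h by blast
qed

lemma ses_lift:
  assumes "ses N F C i p" "module Z" "hom Z F h" "h * p = 0\<^sub>m (fst Z) (fst C)"
  obtains k where "hom Z N k" "h = k * i"
proof -
  obtain i' p' where i': "i' \<in> carrier_mat (fst F) (fst N)" and p': "p' \<in> carrier_mat (fst C) (fst F)"
    and ip: "i' * i + p * p' = 1\<^sub>m (fst F)" and ii: "i * i' = 1\<^sub>m (fst N)"
    using sesE[OF assms(1)] by metis
  note d = ses_dim[OF assms(1)] carrier_matD[OF p'] carrier_matD[OF i'] hom_dim[OF assms(3)]
  have "h = h * (i' * i + p * p')"
    using d ip by (simp add: mat_ring)
  also have "\<dots> = h * (i' * i)"
    using d by (simp add: mat_ring mat_assoc_eq[OF assms(4)])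
  finally have h: "h * (i' * i) = h" by simp
  have "hom Z N (h * i')"
  proof (rule homI)
    show "h * i' \<in> carrier_mat (fst Z) (fst N)" using d by auto
    fix a :: "'k vec" assume a: "a \<in> carrier_vec (dimA A)"
    note da = module_dim[OF sesD(1)[OF assms(1)] a] module_dim[OF sesD(2)[OF assms(1)] a]
      module_dim[OF sesD(3)[OF assms(1)] a] module_dim[OF assms(2) a]
    have "snd Z a * (h * i') = h * (snd F a * i')"
      using d da by (simp add: mat_assoc_eq[OF hom_comm[OF assms(3) a]] mat_assoc)
    also have "\<dots> = h * (i' * (i * (snd F a * i')))"
      using d da by (simp add: mat_assoc_eq3[OF h])
    also have "\<dots> = h * i' * snd N a"
      using d da by (simp add: mat_assoc_eq[OF hom_comm[OF sesD(4)[OF assms(1)] a, symmetric]] mat_assoc ii mat_mult_one)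
    finally show "snd Z a * (h * i') = h * i' * snd N a" .
  qed
  then show thesis using that h d by (simp add: mat_assoc)
qed

text \<open>The kernel of \<open>p\<close> is the image of the idempotent \<open>1 - p * p'\<close>.
  This idempotent is only linear, so \<open>hom_retract\<close> does not apply; what saves the
  action is that \<open>c * p = 0\<close> makes the image stable, which is
  \<open>ca\<close>.\<close>

lemma kernel_ses:
  assumes P: "module P" and C: "module C" and p: "hom P C p" and surj: "himage P p = mcar C"
  obtains N i where "ses N P C i p"
proof -
  have "\<exists>G\<in>carrier_mat (fst C) (fst P). G * p = 1\<^sub>m (fst C)"
  proof (rule surjective_right_inverse[OF hom_carrier[OF p]])
    fix w :: "'k vec" assume "w \<in> carrier_vec (fst C)"
    then have "w \<in> (\<lambda>v. vmul v p) ` carrier_vec (fst P)"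
      using surj by (simp add: himage_def mcar_def)
    then show "\<exists>v\<in>carrier_vec (fst P). vmul v p = w" by auto
  qed
  then obtain p' where p': "p' \<in> carrier_mat (fst C) (fst P)" and pp: "p' * p = 1\<^sub>m (fst C)" by blast
  note d = hom_dim[OF p] carrier_matD[OF p']
  define e where "e = 1\<^sub>m (fst P) - p * p'"
  have e: "e \<in> carrier_mat (fst P) (fst P)"
    using d by (auto simp: e_def)
  have ep: "e * p = 0\<^sub>m (fst P) (fst C)"
    unfolding e_def using d by (simp add: mat_ring pp)
  have "e * e = e * 1\<^sub>m (fst P) - e * (p * p')"
    by (subst (2) e_def) (use d e in \<open>simp add: mat_mult_minus\<close>)
  then have ee: "e * e = e"
    using d e by (simp add: mat_ring mat_assoc_eq[OF ep])
  obtain k b c where bc: "b \<in> carrier_mat (fst P) k" "c \<in> carrier_mat k (fst P)" "c * b = 1\<^sub>m k" "b * c = e"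
    using idempotent_splits[OF e ee] .
  note d2 = carrier_matD[OF bc(1)] carrier_matD[OF bc(2)]
  have c_alt: "c = c * e"
    using d2 bc(3) by (simp add: bc(4)[symmetric] mat_assoc_eq[OF bc(3)] mat_one_mult)
  have cp: "c * p = 0\<^sub>m k (fst C)"
    by (subst c_alt) (use d d2 e in \<open>simp add: mat_ring ep\<close>)
  have ca: "c * (snd P a * (b * c)) = c * snd P a" if a: "a \<in> carrier_vec (dimA A)" for a
  proof -
    note da = module_dim[OF P a] module_dim[OF C a]
    have "c * (snd P a * (p * p')) = 0\<^sub>m k (fst P)"
      using d d2 da by (simp add: mat_assoc_eq[OF hom_comm[OF p a]] mat_assoc_eq[OF cp] mat_ring)
    then show ?thesis
      unfolding bc(4) e_def using d d2 da by (simp add: mat_ring)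
  qed
  let ?N = "(k, \<lambda>a. c * (snd P a * b))"
  have "module ?N"
    unfolding is_module_def Let_def fst_conv snd_conv
  proof (intro conjI ballI allI)
    fix a b' :: "'k vec" and x :: 'k
    assume a: "a \<in> carrier_vec (dimA A)"
    note da = module_dim[OF P a]
    show "c * (snd P a * b) \<in> carrier_mat k k"
      using d2 da by auto
    have "snd P (x \<cdot>\<^sub>v a) = x \<cdot>\<^sub>m snd P a"
      using P a by (simp add: is_module_def Let_def)
    then show "c * (snd P (x \<cdot>\<^sub>v a) * b) = x \<cdot>\<^sub>m (c * (snd P a * b))"
      using d2 da by (simp add: mat_smult_mult mat_mult_smult)
    assume b': "b' \<in> carrier_vec (dimA A)"
    note db = module_dim[OF P b']
    have ab: "snd P (a + b') = snd P a + snd P b'" "snd P (mulA A a b') = snd P a * snd P b'"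
      using P a b' by (simp_all add: is_module_def Let_def)
    show "c * (snd P (a + b') * b) = c * (snd P a * b) + c * (snd P b' * b)"
      unfolding ab using d2 da db by (simp add: mat_ring)
    have "c * (snd P a * b) * (c * (snd P b' * b)) = (c * (snd P a * (b * c))) * (snd P b' * b)"
      using d2 da db by (simp add: mat_assoc)
    then show "c * (snd P (mulA A a b') * b) = c * (snd P a * b) * (c * (snd P b' * b))"
      unfolding ab ca[OF a] using d2 da db by (simp add: mat_assoc)
  next
    have "snd P (oneA A) = 1\<^sub>m (fst P)"
      using P by (simp add: is_module_def Let_def)
    then show "c * (snd P (oneA A) * b) = 1\<^sub>m k"
      using d2 by (simp add: mat_ring bc)
  qed
  moreover have "hom ?N P c"
    by (rule homI) (use d2 ca bc in \<open>auto simp: mat_assoc module_dim[OF P]\<close>)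
  moreover have "b * c + p * p' = 1\<^sub>m (fst P)"
    unfolding bc(4) e_def using d by (intro eq_matI) (auto simp del: index_mult_mat(1))
  ultimately have "ses ?N P C c p"
    unfolding ses_def fst_conv using P C p cp bc(1,3) p' pp by blast
  then show thesis using that by blast
qed

end

section \<open>Projective modules over a self-injective algebra\<close>

lemma linear_expansion:
  fixes \<phi> :: "'k::field vec \<Rightarrow> 'k"
  assumes add: "\<And>a b. a \<in> carrier_vec n \<Longrightarrow> b \<in> carrier_vec n \<Longrightarrow> \<phi> (a + b) = \<phi> a + \<phi> b"
    and smult: "\<And>x a. a \<in> carrier_vec n \<Longrightarrow> \<phi> (x \<cdot>\<^sub>v a) = x * \<phi> a"
    and a: "a \<in> carrier_vec n"
  shows "\<phi> a = (\<Sum>b<n. a $ b * \<phi> (unit_vec n b))"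
proof -
  define t where "t k = vec n (\<lambda>b. if b < k then a $ b else 0)" for k
  have t: "t k \<in> carrier_vec n" for k by (simp add: t_def)
  have "\<phi> (t k) = (\<Sum>b<k. a $ b * \<phi> (unit_vec n b))" if "k \<le> n" for k
    using that
  proof (induction k)
    case 0
    have "t 0 = 0 \<cdot>\<^sub>v a" using a by (auto simp: t_def)
    then show ?case using smult[OF a, of 0] by simp
  next
    case (Suc k)
    have "t (Suc k) = t k + a $ k \<cdot>\<^sub>v unit_vec n k"
      using Suc.prems by (auto simp: t_def unit_vec_def less_Suc_eq)
    then show ?case
      using Suc add[OF t[of k], of "a $ k \<cdot>\<^sub>v unit_vec n k"] smult[of "unit_vec n k"] by simp
  qed
  moreover have "t n = a" using a by (auto simp: t_def)
  ultimately show ?thesis by auto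
qed

context fdalg
begin

abbreviation (input) n where "n \<equiv> dimA A"

lemma mul_carrier: "a \<in> carrier_vec n \<Longrightarrow> b \<in> carrier_vec n \<Longrightarrow> mulA A a b \<in> carrier_vec n"
  and mul_add_left: "a \<in> carrier_vec n \<Longrightarrow> b \<in> carrier_vec n \<Longrightarrow> c \<in> carrier_vec n \<Longrightarrow>
    mulA A (a + b) c = mulA A a c + mulA A b c"
  and mul_add_right: "a \<in> carrier_vec n \<Longrightarrow> b \<in> carrier_vec n \<Longrightarrow> c \<in> carrier_vec n \<Longrightarrow>
    mulA A a (b + c) = mulA A a b + mulA A a c"
  and mul_assoc: "a \<in> carrier_vec n \<Longrightarrow> b \<in> carrier_vec n \<Longrightarrow> c \<in> carrier_vec n \<Longrightarrow>
    mulA A (mulA A a b) c = mulA A a (mulA A b c)"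
  and mul_smult_left: "a \<in> carrier_vec n \<Longrightarrow> b \<in> carrier_vec n \<Longrightarrow> mulA A (x \<cdot>\<^sub>v a) b = x \<cdot>\<^sub>v mulA A a b"
  and mul_smult_right: "a \<in> carrier_vec n \<Longrightarrow> b \<in> carrier_vec n \<Longrightarrow> mulA A a (x \<cdot>\<^sub>v b) = x \<cdot>\<^sub>v mulA A a b"
  and mul_one_left: "a \<in> carrier_vec n \<Longrightarrow> mulA A (oneA A) a = a"
  and mul_one_right: "a \<in> carrier_vec n \<Longrightarrow> mulA A a (oneA A) = a"
  and one_carrier: "oneA A \<in> carrier_vec n"
  using fd_algebra unfolding fd_algebra_def Let_def by blast+

lemma mul_expand_left:
  assumes "a \<in> carrier_vec n" "c \<in> carrier_vec n" "j < n"
  shows "mulA A a c $ j = (\<Sum>b<n. a $ b * mulA A (unit_vec n b) c $ j)"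
  by (rule linear_expansion[where \<phi> = "\<lambda>a. mulA A a c $ j"])
    (use assms mul_carrier in \<open>auto simp: mul_add_left mul_smult_left carrier_vecD[OF mul_carrier]\<close>)

lemma mul_expand_right:
  assumes "a \<in> carrier_vec n" "c \<in> carrier_vec n" "j < n"
  shows "mulA A c a $ j = (\<Sum>b<n. a $ b * mulA A c (unit_vec n b) $ j)"
  by (rule linear_expansion[where \<phi> = "\<lambda>a. mulA A c a $ j"])
    (use assms mul_carrier in \<open>auto simp: mul_add_right mul_smult_right carrier_vecD[OF mul_carrier]\<close>)

lemma module_add: "module X \<Longrightarrow> a \<in> carrier_vec n \<Longrightarrow> b \<in> carrier_vec n \<Longrightarrow> snd X (a + b) = snd X a + snd X b"
  and module_mult: "module X \<Longrightarrow> a \<in> carrier_vec n \<Longrightarrow> b \<in> carrier_vec n \<Longrightarrow> snd X (mulA A a b) = snd X a * snd X b"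
  and module_smult: "module X \<Longrightarrow> a \<in> carrier_vec n \<Longrightarrow> snd X (x \<cdot>\<^sub>v a) = x \<cdot>\<^sub>m snd X a"
  and module_one: "module X \<Longrightarrow> snd X (oneA A) = 1\<^sub>m (fst X)"
  by (simp_all add: is_module_def Let_def)

text \<open>A module structure is linear in the algebra element, hence given by the images of the
  standard basis. The factors \<open>L\<close> and \<open>M\<close> allow single entries of
  composite matrices to be expanded.\<close>

lemma module_expand:
  assumes X: "module X" and a: "a \<in> carrier_vec n" and L: "dim_col L = fst X" and M: "dim_row M = fst X"
    and ij: "i < dim_row L" "j < dim_col M"
  shows "(L * (snd X a * M)) $$ (i, j) = (\<Sum>b<n. a $ b * (L * (snd X (unit_vec n b) * M)) $$ (i, j))"
proof (rule linear_expansion[where \<phi> = "\<lambda>a. (L * (snd X a * M)) $$ (i, j)"])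
  fix a b :: "'k vec" and x :: 'k
  assume a: "a \<in> carrier_vec n"
  show "(L * (snd X (x \<cdot>\<^sub>v a) * M)) $$ (i, j) = x * (L * (snd X a * M)) $$ (i, j)"
    using L M ij by (simp add: module_smult[OF X a] module_dim[OF X a] mat_smult_mult mat_mult_smult del: index_mult_mat(1))
  assume b: "b \<in> carrier_vec n"
  show "(L * (snd X (a + b) * M)) $$ (i, j) = (L * (snd X a * M)) $$ (i, j) + (L * (snd X b * M)) $$ (i, j)"
    using L M ij by (simp add: module_add[OF X a b] module_dim[OF X a] module_dim[OF X b] mat_ring del: index_mult_mat(1))
qed (rule a)

section \<open>The regular module and its dual\<close>

lemma regular_apply: "snd (regular A) a = mat n n (\<lambda>(i, j). mulA A (unit_vec n i) a $ j)"
  and regular_fst: "fst (regular A) = n"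
  by (simp_all add: regular_def)

lemma module_regular: "module (regular A)"
  unfolding is_module_def Let_def regular_apply regular_fst
proof (intro conjI ballI allI)
  fix a b :: "'k vec" and x :: 'k
  assume a: "a \<in> carrier_vec n"
  show "mat n n (\<lambda>(i, j). mulA A (unit_vec n i) (x \<cdot>\<^sub>v a) $ j) = x \<cdot>\<^sub>m mat n n (\<lambda>(i, j). mulA A (unit_vec n i) a $ j)"
    using a by (intro eq_matI) (auto simp: mul_smult_right carrier_vecD[OF mul_carrier])
  assume b: "b \<in> carrier_vec n"
  show "mat n n (\<lambda>(i, j). mulA A (unit_vec n i) (a + b) $ j) =
      mat n n (\<lambda>(i, j). mulA A (unit_vec n i) a $ j) + mat n n (\<lambda>(i, j). mulA A (unit_vec n i) b $ j)"
    using a b by (intro eq_matI) (auto simp: mul_add_right carrier_vecD[OF mul_carrier])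
  show "mat n n (\<lambda>(i, j). mulA A (unit_vec n i) (mulA A a b) $ j) =
      mat n n (\<lambda>(i, j). mulA A (unit_vec n i) a $ j) * mat n n (\<lambda>(i, j). mulA A (unit_vec n i) b $ j)" (is "?L = ?M * ?N")
  proof (rule eq_matI)
    fix i j assume "i < dim_row (?M * ?N)" "j < dim_col (?M * ?N)"
    then have ij: "i < n" "j < n" by auto
    have "?L $$ (i, j) = mulA A (mulA A (unit_vec n i) a) b $ j"
      using ij a b by (simp add: mul_assoc)
    also have "\<dots> = (\<Sum>l<n. mulA A (unit_vec n i) a $ l * mulA A (unit_vec n l) b $ j)"
      using ij a b by (intro mul_expand_left mul_carrier) auto
    also have "\<dots> = (?M * ?N) $$ (i, j)"
      using ij by (subst mult_mat_entry[of _ _ _ _ n]) auto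
    finally show "?L $$ (i, j) = (?M * ?N) $$ (i, j)" .
  qed auto
next
  show "mat n n (\<lambda>(i, j). mulA A (unit_vec n i) (oneA A) $ j) = 1\<^sub>m n"
    by (intro eq_matI) (auto simp: mul_one_right unit_vec_def)
qed auto

text \<open>The space of linear functionals on \<open>A\<close> as a right module,
  \<open>(v a)(x) = v(a x)\<close>; a row vector lists the values of the functional on the standard
  basis.\<close>

definition dual_regular :: "'k fdmod" where
  "dual_regular = (n, \<lambda>a. mat n n (\<lambda>(i, j). mulA A a (unit_vec n j) $ i))"

lemma dual_regular_apply: "snd dual_regular a = mat n n (\<lambda>(i, j). mulA A a (unit_vec n j) $ i)"
  and dual_regular_fst: "fst dual_regular = n"
  by (simp_all add: dual_regular_def)

lemma module_dual_regular: "module dual_regular"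
  unfolding is_module_def Let_def dual_regular_apply dual_regular_fst
proof (intro conjI ballI allI)
  fix a b :: "'k vec" and x :: 'k
  assume a: "a \<in> carrier_vec n"
  show "mat n n (\<lambda>(i, j). mulA A (x \<cdot>\<^sub>v a) (unit_vec n j) $ i) = x \<cdot>\<^sub>m mat n n (\<lambda>(i, j). mulA A a (unit_vec n j) $ i)"
    using a by (intro eq_matI) (auto simp: mul_smult_left carrier_vecD[OF mul_carrier])
  assume b: "b \<in> carrier_vec n"
  show "mat n n (\<lambda>(i, j). mulA A (a + b) (unit_vec n j) $ i) =
      mat n n (\<lambda>(i, j). mulA A a (unit_vec n j) $ i) + mat n n (\<lambda>(i, j). mulA A b (unit_vec n j) $ i)"
    using a b by (intro eq_matI) (auto simp: mul_add_left carrier_vecD[OF mul_carrier])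
  show "mat n n (\<lambda>(i, j). mulA A (mulA A a b) (unit_vec n j) $ i) =
      mat n n (\<lambda>(i, j). mulA A a (unit_vec n j) $ i) * mat n n (\<lambda>(i, j). mulA A b (unit_vec n j) $ i)" (is "?L = ?M * ?N")
  proof (rule eq_matI)
    fix i j assume "i < dim_row (?M * ?N)" "j < dim_col (?M * ?N)"
    then have ij: "i < n" "j < n" by auto
    have "?L $$ (i, j) = mulA A a (mulA A b (unit_vec n j)) $ i"
      using ij a b by (simp add: mul_assoc)
    also have "\<dots> = (\<Sum>l<n. mulA A b (unit_vec n j) $ l * mulA A a (unit_vec n l) $ i)"
      using ij a b by (intro mul_expand_right mul_carrier) auto
    also have "\<dots> = (?M * ?N) $$ (i, j)"
      using ij by (subst mult_mat_entry[of _ _ _ _ n]) (auto simp: mult.commute)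
    finally show "?L $$ (i, j) = (?M * ?N) $$ (i, j)" .
  qed auto
next
  show "mat n n (\<lambda>(i, j). mulA A (oneA A) (unit_vec n j) $ i) = 1\<^sub>m n"
    by (intro eq_matI) (auto simp: mul_one_left unit_vec_def)
qed auto

text \<open>The map \<open>a \<mapsto> x a\<close> from the free module of rank one, for the element
  given by the row \<open>x\<close>.\<close>

definition from_regular :: "'k fdmod \<Rightarrow> 'k mat \<Rightarrow> 'k mat" where
  "from_regular X x = mat n (fst X) (\<lambda>(i, j). (x * snd X (unit_vec n i)) $$ (0, j))"

lemma from_regular:
  assumes X: "module X" and x: "x \<in> carrier_mat 1 (fst X)"
  shows "hom (regular A) X (from_regular X x)"
    and "mat 1 n (\<lambda>(_, j). oneA A $ j) * from_regular X x = x"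
proof -
  have expand: "(\<Sum>l<n. a $ l * (x * snd X (unit_vec n l)) $$ (0, j)) = (x * snd X a) $$ (0, j)"
    if a: "a \<in> carrier_vec n" and "j < fst X" for a j
    using module_expand[OF X a, of x "1\<^sub>m (fst X)" 0 j] that x module_dim[OF X]
    by (simp add: mat_mult_one del: index_mult_mat(1))
  show "hom (regular A) X (from_regular X x)"
  proof (rule homI)
    show "from_regular X x \<in> carrier_mat (fst (regular A)) (fst X)"
      by (simp add: from_regular_def regular_fst)
    fix a :: "'k vec" assume a: "a \<in> carrier_vec (dimA A)"
    note da = module_dim[OF X a]
    show "snd (regular A) a * from_regular X x = from_regular X x * snd X a" (is "?L = ?R")
    proof (rule eq_matI)
      fix i j assume "i < dim_row ?R" "j < dim_col ?R"
      then have ij: "i < n" "j < fst X" by (auto simp: from_regular_def da)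
      have "?L $$ (i, j) = (\<Sum>l<n. mulA A (unit_vec n i) a $ l * (x * snd X (unit_vec n l)) $$ (0, j))"
        using ij by (subst mult_mat_entry[of _ _ _ _ n]) (auto simp: regular_apply from_regular_def)
      also have "\<dots> = (x * snd X (mulA A (unit_vec n i) a)) $$ (0, j)"
        using ij a by (intro expand mul_carrier) auto
      also have "\<dots> = (x * snd X (unit_vec n i) * snd X a) $$ (0, j)"
        using a x by (simp add: module_mult[OF X] mat_assoc module_dim[OF X] del: index_mult_mat(1))
      also have "\<dots> = (\<Sum>l<fst X. (x * snd X (unit_vec n i)) $$ (0, l) * snd X a $$ (l, j))"
        using ij x da by (intro mult_mat_entry) (auto simp: module_dim[OF X])
      also have "\<dots> = ?R $$ (i, j)"
        using ij da by (subst mult_mat_entry[of _ _ _ _ "fst X"]) (auto simp: from_regular_def)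
      finally show "?L $$ (i, j) = ?R $$ (i, j)" .
    qed (auto simp: from_regular_def regular_apply da)
  qed
  show "mat 1 n (\<lambda>(_, j). oneA A $ j) * from_regular X x = x" (is "?o * _ = _")
  proof (rule eq_matI)
    fix i j assume "i < dim_row x" "j < dim_col x"
    then have ij: "i = 0" "j < fst X" using x by auto
    have "(?o * from_regular X x) $$ (i, j) = (\<Sum>l<n. oneA A $ l * (x * snd X (unit_vec n l)) $$ (0, j))"
      using ij by (subst mult_mat_entry[of _ _ _ _ n]) (auto simp: from_regular_def)
    then show "(?o * from_regular X x) $$ (i, j) = x $$ (i, j)"
      using expand[OF one_carrier, of j] ij x by (simp add: module_one[OF X] mat_mult_one)
  qed (use x in \<open>auto simp: from_regular_def\<close>)
qed

text \<open>The map \<open>v \<mapsto> (a \<mapsto> l(v a))\<close> attached to the linear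
  functional \<open>l\<close>, a column. Its entries are linear in the module structure, while
  \<open>l\<close> itself does not depend on that structure.\<close>

definition to_dual :: "'k fdmod \<Rightarrow> 'k mat \<Rightarrow> 'k mat" where
  "to_dual X l = mat (fst X) n (\<lambda>(i, j). (snd X (unit_vec n j) * l) $$ (i, 0))"

abbreviation one_col :: "'k mat" where
  "one_col \<equiv> mat n 1 (\<lambda>(j, _). oneA A $ j)"

lemma to_dual:
  assumes X: "module X" and l: "l \<in> carrier_mat (fst X) 1"
  shows "hom X dual_regular (to_dual X l)" and "to_dual X l * one_col = l"
proof -
  have expand: "(\<Sum>b<n. a $ b * (snd X (unit_vec n b) * l) $$ (i, 0)) = (snd X a * l) $$ (i, 0)"
    if a: "a \<in> carrier_vec n" and "i < fst X" for a i
    using module_expand[OF X a, of "1\<^sub>m (fst X)" l i 0] that l module_dim[OF X]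
    by (simp add: mat_one_mult del: index_mult_mat(1))
  show "hom X dual_regular (to_dual X l)"
  proof (rule homI)
    show "to_dual X l \<in> carrier_mat (fst X) (fst dual_regular)"
      by (simp add: to_dual_def dual_regular_fst)
    fix a :: "'k vec" assume a: "a \<in> carrier_vec (dimA A)"
    note da = module_dim[OF X a]
    show "snd X a * to_dual X l = to_dual X l * snd dual_regular a" (is "?L = ?R")
    proof (rule eq_matI)
      fix i j assume "i < dim_row ?R" "j < dim_col ?R"
      then have ij: "i < fst X" "j < n" by (auto simp: to_dual_def dual_regular_apply)
      have "?R $$ (i, j) = (\<Sum>b<n. mulA A a (unit_vec n j) $ b * (snd X (unit_vec n b) * l) $$ (i, 0))"
        using ij by (subst mult_mat_entry[of _ _ _ _ n]) (auto simp: dual_regular_apply to_dual_def mult.commute)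
      also have "\<dots> = (snd X (mulA A a (unit_vec n j)) * l) $$ (i, 0)"
        using ij a by (intro expand mul_carrier) auto
      also have "\<dots> = (snd X a * (snd X (unit_vec n j) * l)) $$ (i, 0)"
        using a l by (simp add: module_mult[OF X] mat_assoc module_dim[OF X] del: index_mult_mat(1))
      also have "\<dots> = (\<Sum>b<fst X. snd X a $$ (i, b) * (snd X (unit_vec n j) * l) $$ (b, 0))"
        using ij l da by (intro mult_mat_entry) (auto simp: module_dim[OF X])
      also have "\<dots> = ?L $$ (i, j)"
        using ij da by (subst mult_mat_entry[of _ _ _ _ "fst X"]) (auto simp: to_dual_def)
      finally show "?L $$ (i, j) = ?R $$ (i, j)" by simp
    qed (auto simp: to_dual_def dual_regular_apply da)
  qed
  show "to_dual X l * one_col = l"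
  proof (rule eq_matI)
    fix i j assume "i < dim_row l" "j < dim_col l"
    then have ij: "i < fst X" "j = 0" using l by auto
    have "(to_dual X l * one_col) $$ (i, j) = (\<Sum>b<n. oneA A $ b * (snd X (unit_vec n b) * l) $$ (i, 0))"
      using ij by (subst mult_mat_entry[of _ _ _ _ n]) (auto simp: to_dual_def mult.commute)
    then show "(to_dual X l * one_col) $$ (i, j) = l $$ (i, j)"
      using expand[OF one_carrier, of i] ij l by (simp add: module_one[OF X] mat_one_mult)
  qed (use l in \<open>auto simp: to_dual_def\<close>)
qed

text \<open>\<open>one_col\<close> evaluates a functional at the unit. A module map satisfies
  \<open>H(v)(a) = (H(v) a)(1) = H(v a)(1)\<close>, so it is recovered from its composite with this
  evaluation.\<close>

lemma hom_to_dual_eq: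
  assumes X: "module X" and H: "hom X dual_regular H"
  shows "H = to_dual X (H * one_col)"
proof (rule eq_matI)
  note d = hom_dim[OF H, unfolded dual_regular_fst]
  fix i j assume "i < dim_row (to_dual X (H * one_col))" "j < dim_col (to_dual X (H * one_col))"
  then have ij: "i < fst X" "j < n" by (auto simp: to_dual_def)
  have col: "snd dual_regular (unit_vec n j) * one_col = mat n 1 (\<lambda>(i, _). unit_vec n j $ i)"
  proof (rule eq_matI)
    fix r c assume "r < dim_row (mat n 1 (\<lambda>(i, _). unit_vec n j $ i))" "c < dim_col (mat n 1 (\<lambda>(i, _). unit_vec n j $ i))"
    then have r: "r < n" "c = 0" by auto
    have "(snd dual_regular (unit_vec n j) * one_col) $$ (r, c) =
        (\<Sum>b<n. oneA A $ b * mulA A (unit_vec n j) (unit_vec n b) $ r)"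
      using r by (subst mult_mat_entry[of _ _ _ _ n]) (auto simp: dual_regular_apply mult.commute)
    also have "\<dots> = mulA A (unit_vec n j) (oneA A) $ r"
      using r by (intro mul_expand_right[symmetric] one_carrier) auto
    finally show "(snd dual_regular (unit_vec n j) * one_col) $$ (r, c) = mat n 1 (\<lambda>(i, _). unit_vec n j $ i) $$ (r, c)"
      using r by (simp add: mul_one_right)
  qed (auto simp: dual_regular_apply)
  have "snd X (unit_vec n j) * (H * one_col) = H * (snd dual_regular (unit_vec n j) * one_col)"
    using mat_assoc_eq[OF hom_comm[OF H]] d by (simp add: module_dim[OF X] dual_regular_apply mat_assoc)
  also have "\<dots> = H * mat n 1 (\<lambda>(i, _). unit_vec n j $ i)"
    by (simp only: col)
  finally have "(snd X (unit_vec n j) * (H * one_col)) $$ (i, 0) = (H * mat n 1 (\<lambda>(i, _). unit_vec n j $ i)) $$ (i, 0)"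
    by (rule arg_cong)
  also have "\<dots> = (\<Sum>b<n. H $$ (i, b) * unit_vec n j $ b)"
    using ij d by (subst mult_mat_entry[of _ _ _ _ n]) auto
  also have "\<dots> = (\<Sum>b<n. if b = j then H $$ (i, j) else 0)"
    using ij by (intro sum.cong) (auto simp: unit_vec_def)
  finally show "H $$ (i, j) = to_dual X (H * one_col) $$ (i, j)"
    using ij by (simp add: to_dual_def)
qed (use hom_dim[OF H] in \<open>auto simp: to_dual_def dual_regular_fst\<close>)

text \<open>A finite sum of maps through \<open>B\<close> is a map through a finite power of
  \<open>B\<close>; the sum avoids building the power. For the identity of \<open>P\<close> it says
  that \<open>P\<close> is a summand of a power of \<open>B\<close>.\<close>

inductive thru :: "'k fdmod \<Rightarrow> 'k fdmod \<Rightarrow> 'k fdmod \<Rightarrow> 'k mat \<Rightarrow> bool" for B X Y where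
  zero: "thru B X Y (0\<^sub>m (fst X) (fst Y))"
| add: "thru B X Y h \<Longrightarrow> hom X B u \<Longrightarrow> hom B Y v \<Longrightarrow> thru B X Y (h + u * v)"

lemma thru_carrier: "thru B X Y h \<Longrightarrow> h \<in> carrier_mat (fst X) (fst Y)"
  by (induction rule: thru.induct) (auto intro!: carrier_matI simp: hom_dim)

lemma thru_single:
  assumes "hom X B u" "hom B Y v"
  shows "thru B X Y (u * v)"
  using thru.add[OF thru.zero assms] assms by (simp add: mat_zero_add hom_dim)

lemma thru_add:
  assumes "thru B X Y h" "thru B X Y h'"
  shows "thru B X Y (h + h')"
  using assms(2)
proof (induction rule: thru.induct)
  case zero
  then show ?case using assms(1) thru_carrier[OF assms(1)] by (simp add: mat_add_zero)
next
  case (add h' u v)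
  have "h + (h' + u * v) = h + h' + u * v"
    using thru_carrier[OF assms(1)] thru_carrier[OF add(1)] hom_dim[OF add(2)] hom_dim[OF add(3)]
    by (intro assoc_add_mat[symmetric, of _ "fst X" "fst Y"]) auto
  then show ?case using thru.add[OF add(4,2,3)] by simp
qed

lemma thru_mult_left:
  assumes "thru B X Y h" "module Z" "module X" "module B" "hom Z X k"
  shows "thru B Z Y (k * h)"
  using assms(1)
proof (induction rule: thru.induct)
  case zero
  then show ?case using thru.zero hom_dim[OF assms(5)] by (simp add: mat_ring)
next
  case (add h u v)
  note d = carrier_matD[OF thru_carrier[OF add(1)]] hom_dim[OF add(2)] hom_dim[OF add(3)] hom_dim[OF assms(5)]
  show ?case
    using thru.add[OF add(4) hom_mult[OF assms(2-4) assms(5) add(2)] add(3)] d by (simp add: mat_ring)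
qed

lemma thru_mult_right:
  assumes "thru B X Y h" "module B" "module Y" "module Z" "hom Y Z k"
  shows "thru B X Z (h * k)"
  using assms(1)
proof (induction rule: thru.induct)
  case zero
  then show ?case using thru.zero hom_dim[OF assms(5)] by (simp add: mat_ring)
next
  case (add h u v)
  note d = carrier_matD[OF thru_carrier[OF add(1)]] hom_dim[OF add(2)] hom_dim[OF add(3)] hom_dim[OF assms(5)]
  show ?case
    using thru.add[OF add(4,2) hom_mult[OF assms(2-4) add(3) assms(5)]] d by (simp add: mat_ring)
qed

lemma thru_uminus:
  assumes "thru B X Y h" "module X" "module B"
  shows "thru B X Y (- h)"
proof -
  have "- h = - 1\<^sub>m (fst X) * h"
    using thru_carrier[OF assms(1)] by (simp add: mat_one_mult)
  then show ?thesis
    using thru_mult_left[OF assms(1,2,2,3) hom_uminus[OF assms(2,2) hom_one[OF assms(2)]]] by simp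
qed

text \<open>Insert the identity of \<open>B\<close>, written as a sum of maps through
  \<open>D\<close>, into each summand \<open>u * v\<close>.\<close>

lemma thru_trans:
  assumes "thru B X Y h" "thru D B B (1\<^sub>m (fst B))" "module X" "module Y" "module B" "module D"
  shows "thru D X Y h"
  using assms(1)
proof (induction rule: thru.induct)
  case zero
  then show ?case by (rule thru.zero)
next
  case (add h u v)
  have "thru D X Y (u * 1\<^sub>m (fst B) * v)"
    using assms add by (intro thru_mult_right[of _ _ B] thru_mult_left[of _ B]) auto
  then show ?case
    using add hom_dim[OF add(2)] by (intro thru_add) (auto simp: mat_mult_one)
qed

lemma thru_of_identity:
  assumes "thru B P P (1\<^sub>m (fst P))" "module B" "module X" "module Y" "module P" "hom X P u" "hom P Y v"
  shows "thru B X Y (u * v)"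
proof -
  have "thru B X Y (u * 1\<^sub>m (fst P) * v)"
    using assms by (intro thru_mult_right[of _ _ P] thru_mult_left[of _ P]) auto
  then show ?thesis using hom_dim[OF assms(6)] by (simp add: mat_mult_one)
qed

section \<open>Projective modules as summands of free modules and of powers of the dual\<close>

lemma himage_surj:
  assumes "F \<in> carrier_mat (fst X) (fst Y)" "G \<in> carrier_mat (fst Y) (fst X)" "G * F = 1\<^sub>m (fst Y)"
  shows "himage X F = mcar Y"
proof -
  have "w \<in> (\<lambda>v. vmul v F) ` carrier_vec (fst X)" if w: "w \<in> carrier_vec (fst Y)" for w
    using vmul_mult[OF w assms(2,1)] vmul_one[OF w] assms(3) vmul_carrier[OF assms(2), of w]
    by (intro image_eqI[of _ _ "vmul w G"]) auto
  then show ?thesis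
    using vmul_carrier[OF assms(1)] by (auto simp: himage_def mcar_def)
qed

lemma hkernel_inj:
  assumes "F \<in> carrier_mat (fst X) (fst Y)" "G \<in> carrier_mat (fst Y) (fst X)" "F * G = 1\<^sub>m (fst X)"
  shows "hkernel X F = {0\<^sub>v (fst X)}"
proof -
  have "v = 0\<^sub>v (fst X)" if v: "v \<in> carrier_vec (fst X)" and "vmul v F = 0\<^sub>v (fst Y)" for v
    using vmul_mult[OF v assms(1,2)] vmul_one[OF v] assms(3) that vmul_zero_vec[OF assms(2)] by simp
  then show ?thesis
    using vmul_zero_vec[OF assms(1)] assms(1) by (auto simp: hkernel_def mcar_def)
qed

lemma projectiveD:
  assumes "projective A P" "module X" "module Y" "hom X Y g" "G \<in> carrier_mat (fst Y) (fst X)"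
    "G * g = 1\<^sub>m (fst Y)" "hom P Y f"
  obtains h where "hom P X h" "h * g = f"
  using assms himage_surj[OF hom_carrier[OF assms(4)] assms(5,6)] unfolding projective_def by meson

lemma projective_retract:
  assumes "projective A P" "module P" "module K" "hom P K b" "hom K P c" "c * b = 1\<^sub>m (fst K)"
  shows "projective A K"
  unfolding projective_def
proof (intro allI impI)
  fix N N' g f
  assume H: "module N \<and> module N' \<and> hom N N' g \<and> himage N g = mcar N' \<and> hom K N' f"
  then have "hom P N' (b * f)"
    using hom_mult[OF assms(2,3) _ assms(4)] by blast
  then obtain h where h: "hom P N h" "h * g = b * f"
    using assms(1) H unfolding projective_def by metis
  have "c * h * g = f"
    using h(2) H hom_dim[OF h(1)] hom_dim[OF assms(4)] hom_dim[OF assms(5)] mat_assoc_eq[OF assms(6)]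
    by (auto simp: mat_ring hom_dim)
  then show "\<exists>h. hom K N h \<and> h * g = f"
    using hom_mult[OF assms(3,2) _ assms(5) h(1)] H by blast
qed

lemma projective_direct_sum:
  assumes "projective A P" "projective A Q" "module P" "module Q" "module T"
    "hom P T s1" "hom Q T s2" "hom T P r1" "hom T Q r2" "r1 * s1 + r2 * s2 = 1\<^sub>m (fst T)"
  shows "projective A T"
  unfolding projective_def
proof (intro allI impI)
  fix N N' g f
  assume H: "module N \<and> module N' \<and> hom N N' g \<and> himage N g = mcar N' \<and> hom T N' f"
  then have "hom P N' (s1 * f)" "hom Q N' (s2 * f)"
    using hom_mult assms by blast+
  then obtain h k where h: "hom P N h" "h * g = s1 * f" and k: "hom Q N k" "k * g = s2 * f"
    using assms(1,2) H unfolding projective_def by metis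
  note d = assms(6-9)[THEN hom_dim(1)] assms(6-9)[THEN hom_dim(2)] hom_dim[OF h(1)] hom_dim[OF k(1)]
  have df: "dim_row f = fst T" "dim_row g = fst N"
    using H by (auto simp: hom_dim)
  have "(r1 * h + r2 * k) * g = (r1 * s1 + r2 * s2) * f"
    using d df h(2) k(2) by (simp add: mat_ring)
  then have "(r1 * h + r2 * k) * g = f"
    using df by (simp add: assms(10) mat_one_mult)
  moreover have "hom T N (r1 * h + r2 * k)"
    using H h k assms by (intro hom_add hom_mult[of T P N] hom_mult[of T Q N]) auto
  ultimately show "\<exists>h. hom T N h \<and> h * g = f" by blast
qed

lemma module_trivial: "module (0, \<lambda>_. 0\<^sub>m 0 0)"
  unfolding is_module_def by (auto simp: Let_def)

lemma thru_trivial: "thru B (0, \<lambda>_. 0\<^sub>m 0 0) (0, \<lambda>_. 0\<^sub>m 0 0) (1\<^sub>m 0)"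
proof -
  have "1\<^sub>m 0 = (0\<^sub>m 0 0 :: 'k mat)" by (intro eq_matI) auto
  then show ?thesis
    using thru.zero[of B "(0, \<lambda>_. 0\<^sub>m 0 0)" "(0, \<lambda>_. 0\<^sub>m 0 0)"] by simp
qed

text \<open>Starting from the zero module, one copy of \<open>A\<close> is added per coordinate of
  \<open>P\<close> until a free module maps onto \<open>P\<close>; projectivity splits this
  surjection.\<close>

lemma projective_thru_regular:
  assumes P: "module P" and proj: "projective A P"
  shows "thru (regular A) P P (1\<^sub>m (fst P))"
proof -
  let ?R = "regular A" and ?u = "\<lambda>c. mat 1 (fst P) (\<lambda>(_, j). if j = c then 1 else (0::'k))"
  note R = module_regular
  have "\<exists>N \<phi>. module N \<and> hom N P \<phi> \<and> thru ?R N N (1\<^sub>m (fst N)) \<and>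
      (\<forall>c<r. \<exists>k\<in>carrier_mat 1 (fst N). k * \<phi> = ?u c)" for r
  proof (induction r)
    case 0
    have "hom (0, \<lambda>_. 0\<^sub>m 0 0) P (0\<^sub>m 0 (fst P))"
      using hom_zero[OF module_trivial P] by simp
    then show ?case
      using module_trivial thru_trivial[of ?R]
      by (intro exI[of _ "(0, \<lambda>_. 0\<^sub>m 0 0)"] exI[of _ "0\<^sub>m 0 (fst P)"]) simp
  next
    case (Suc r)
    then obtain N \<phi> where N: "module N" "hom N P \<phi>" "thru ?R N N (1\<^sub>m (fst N))"
      and k: "\<And>c. c < r \<Longrightarrow> \<exists>k\<in>carrier_mat 1 (fst N). k * \<phi> = ?u c" by blast
    obtain T s1 s2 r1 r2 where T: "module T" "hom N T s1" "hom ?R T s2" "hom T N r1" "hom T ?R r2"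
      and sr: "s1 * r1 = 1\<^sub>m (fst N)" "s2 * r2 = 1\<^sub>m (fst ?R)" "s1 * r2 = 0\<^sub>m (fst N) (fst ?R)"
        "s2 * r1 = 0\<^sub>m (fst ?R) (fst N)" "r1 * s1 + r2 * s2 = 1\<^sub>m (fst T)"
      using direct_sum[OF N(1) R] .
    have u: "?u r \<in> carrier_mat 1 (fst P)" by simp
    \<comment> \<open>The new copy of \<open>A\<close> sends its unit to the unit row
      \<open>r\<close>; earlier coordinates stay in the image through the old summand.\<close>
    define V where "V = from_regular P (?u r)"
    note V = from_regular[OF P u, folded V_def]
    let ?o = "mat 1 n (\<lambda>(_, j). oneA A $ j)"
    let ?\<phi> = "r1 * \<phi> + r2 * V"
    note d = T(2-5)[THEN hom_dim(1)] T(2-5)[THEN hom_dim(2)] hom_dim[OF N(2)] hom_dim[OF V(1)] regular_fst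
    have "hom T P ?\<phi>"
      using T N V P R by (intro hom_add hom_mult[of T N P] hom_mult[of T ?R P]) auto
    moreover have "thru ?R T T (1\<^sub>m (fst T))"
      unfolding sr(5)[symmetric]
      using T N R by (intro thru_add thru_single thru_of_identity[of _ N]) auto
    moreover have "\<exists>k\<in>carrier_mat 1 (fst T). k * ?\<phi> = ?u c" if "c < Suc r" for c
    proof (cases "c = r")
      case True
      have "?o * s2 * ?\<phi> = ?o * V"
        using d by (simp add: mat_ring mat_assoc_eq[OF sr(2)] mat_assoc_eq[OF sr(4)])
      then show ?thesis
        using True V(2) d by (intro bexI[of _ "?o * s2"]) auto
    next
      case False
      then have "c < r" using that by simp
      from k[OF this] obtain k where k: "k \<in> carrier_mat 1 (fst N)" "k * \<phi> = ?u c" by blast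
      have "k * s1 * ?\<phi> = k * \<phi>"
        using d k(1) by (simp add: mat_ring mat_assoc_eq[OF sr(1)] mat_assoc_eq[OF sr(3)])
      then show ?thesis
        using k d by (intro bexI[of _ "k * s1"]) auto
    qed
    ultimately show ?case using T(1) by blast
  qed
  then obtain N \<phi> where N: "module N" "hom N P \<phi>" "thru ?R N N (1\<^sub>m (fst N))"
    and k: "\<And>c. c < fst P \<Longrightarrow> \<exists>k\<in>carrier_mat 1 (fst N). k * \<phi> = ?u c" by blast
  obtain G where G: "G \<in> carrier_mat (fst P) (fst N)" "G * \<phi> = 1\<^sub>m (fst P)"
    using stack_rows[OF hom_carrier[OF N(2)] k] by blast
  obtain h where h: "hom P N h" "h * \<phi> = 1\<^sub>m (fst P)"
    using projectiveD[OF proj N(1) P N(2) G hom_one[OF P]] .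
  show ?thesis
    unfolding h(2)[symmetric] using N h P R by (intro thru_of_identity[of _ N]) auto
qed

text \<open>Dual to the previous construction: the coordinate functionals embed \<open>A\<close>
  into a power of its dual, and injectivity of \<open>A\<close> provides a retraction.\<close>

lemma self_injective_thru_dual:
  assumes inj: "self_injective A"
  shows "thru dual_regular (regular A) (regular A) (1\<^sub>m (fst (regular A)))"
proof -
  let ?R = "regular A" and ?u = "\<lambda>c. mat n 1 (\<lambda>(i, _). if i = c then 1 else (0::'k))"
  note R = module_regular and D = module_dual_regular
  have "\<exists>N \<phi>. module N \<and> hom ?R N \<phi> \<and> thru dual_regular N N (1\<^sub>m (fst N)) \<and>
      (\<forall>c<r. \<exists>k\<in>carrier_mat (fst N) 1. \<phi> * k = ?u c)" for r
  proof (induction r)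
    case 0
    have "hom ?R (0, \<lambda>_. 0\<^sub>m 0 0) (0\<^sub>m n 0)"
      using hom_zero[OF R module_trivial] by (simp add: regular_fst)
    then show ?case
      using module_trivial thru_trivial[of dual_regular]
      by (intro exI[of _ "(0, \<lambda>_. 0\<^sub>m 0 0)"] exI[of _ "0\<^sub>m n 0"]) simp
  next
    case (Suc r)
    then obtain N \<phi> where N: "module N" "hom ?R N \<phi>" "thru dual_regular N N (1\<^sub>m (fst N))"
      and k: "\<And>c. c < r \<Longrightarrow> \<exists>k\<in>carrier_mat (fst N) 1. \<phi> * k = ?u c" by blast
    obtain T s1 s2 r1 r2 where T: "module T" "hom N T s1" "hom dual_regular T s2" "hom T N r1" "hom T dual_regular r2"
      and sr: "s1 * r1 = 1\<^sub>m (fst N)" "s2 * r2 = 1\<^sub>m (fst dual_regular)" "s1 * r2 = 0\<^sub>m (fst N) (fst dual_regular)"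
        "s2 * r1 = 0\<^sub>m (fst dual_regular) (fst N)" "r1 * s1 + r2 * s2 = 1\<^sub>m (fst T)"
      using direct_sum[OF N(1) D] .
    have u: "?u r \<in> carrier_mat (fst ?R) 1" by (simp add: regular_fst)
    define V where "V = to_dual ?R (?u r)"
    note V = to_dual[OF R u, folded V_def]
    let ?\<phi> = "\<phi> * s1 + V * s2"
    note d = T(2-5)[THEN hom_dim(1)] T(2-5)[THEN hom_dim(2)] hom_dim[OF N(2)] hom_dim[OF V(1)] regular_fst dual_regular_fst
    have "hom ?R T ?\<phi>"
      using T N V D R by (intro hom_add hom_mult[of ?R N T] hom_mult[of ?R dual_regular T]) auto
    moreover have "thru dual_regular T T (1\<^sub>m (fst T))"
      unfolding sr(5)[symmetric]
      using T N D by (intro thru_add thru_single thru_of_identity[of _ N]) auto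
    moreover have "\<exists>k\<in>carrier_mat (fst T) 1. ?\<phi> * k = ?u c" if "c < Suc r" for c
    proof (cases "c = r")
      case True
      have "?\<phi> * (r2 * one_col) = V * one_col"
        using d by (simp add: mat_ring mat_assoc_eq[OF sr(2)] mat_assoc_eq[OF sr(3)])
      then show ?thesis
        using True V(2) d by (intro bexI[of _ "r2 * one_col"]) auto
    next
      case False
      then have "c < r" using that by simp
      from k[OF this] obtain k where k: "k \<in> carrier_mat (fst N) 1" "\<phi> * k = ?u c" by blast
      have "?\<phi> * (r1 * k) = \<phi> * k"
        using d k(1) by (simp add: mat_ring mat_assoc_eq[OF sr(1)] mat_assoc_eq[OF sr(4)])
      then show ?thesis
        using k d by (intro bexI[of _ "r1 * k"]) auto
    qed
    ultimately show ?case using T(1) by blast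
  qed
  then obtain N \<phi> where N: "module N" "hom ?R N \<phi>" "thru dual_regular N N (1\<^sub>m (fst N))"
    and k: "\<And>c. c < n \<Longrightarrow> \<exists>k\<in>carrier_mat (fst N) 1. \<phi> * k = ?u c" by blast
  have "\<phi> \<in> carrier_mat n (fst N)"
    using hom_carrier[OF N(2)] by (simp add: regular_fst)
  then obtain G where "G \<in> carrier_mat (fst N) n" "\<phi> * G = 1\<^sub>m n"
    using stack_cols k by blast
  then have "hkernel ?R \<phi> = {0\<^sub>v (fst ?R)}"
    using hom_carrier[OF N(2)] by (intro hkernel_inj[of _ _ N G]) (auto simp: regular_fst)
  then obtain h where h: "hom N ?R h" "\<phi> * h = 1\<^sub>m (fst ?R)"
    using inj R N hom_one[OF R] unfolding self_injective_def injective_def by meson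
  show ?thesis
    unfolding h(2)[symmetric] using N h D R by (intro thru_of_identity[of _ N]) auto
qed

text \<open>Each summand is a map into \<open>A\<close> followed by a map out of \<open>A\<close>;
  the first extends along the monomorphism \<open>f\<close> because \<open>A\<close> is injective.
  The linear left inverse \<open>G\<close> expresses that \<open>f\<close> is injective.\<close>

lemma thru_regular_extend:
  assumes inj: "self_injective A" and "thru (regular A) X Y g" "module X" "module Y" "module Z" "hom X Z f"
    and G: "G \<in> carrier_mat (fst Z) (fst X)" "f * G = 1\<^sub>m (fst X)"
  shows "\<exists>h. hom Z Y h \<and> f * h = g"
  using assms(2)
proof (induction rule: thru.induct)
  case zero
  then show ?case
    using hom_zero[of Z Y] assms hom_dim[OF assms(6)] by (intro exI[of _ "0\<^sub>m (fst Z) (fst Y)"]) (auto simp: mat_mult_zero)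
next
  case (add g u v)
  then obtain h where h: "hom Z Y h" "f * h = g" by blast
  have "hkernel X f = {0\<^sub>v (fst X)}"
    by (rule hkernel_inj[OF hom_carrier[OF assms(6)] G])
  then obtain k where k: "hom Z (regular A) k" "f * k = u"
    using inj assms add(2) unfolding self_injective_def injective_def by meson
  have "f * (h + k * v) = g + u * v"
    using hom_dim[OF h(1)] hom_dim[OF k(1)] hom_dim[OF assms(6)] hom_dim[OF add(3)]
    by (simp add: mat_ring h(2) mat_assoc_eq[OF k(2)])
  moreover have "hom Z Y (h + k * v)"
    using assms h k add module_regular by (intro hom_add hom_mult[of Z "regular A"]) auto
  ultimately show ?case by blast
qed

text \<open>Projectives are injective: a map into \<open>P\<close> is a sum of maps through
  \<open>A\<close>, and those extend.\<close>

lemma projective_extend: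
  assumes "self_injective A" "projective A P" "module P" "ses N F C i p" "hom N P g"
  obtains h where "hom F P h" "i * h = g"
proof -
  have "thru (regular A) N P (g * 1\<^sub>m (fst P))"
    using assms projective_thru_regular module_regular sesD(1)[OF assms(4)]
    by (intro thru_mult_left[of _ P]) auto
  then have "thru (regular A) N P g"
    using hom_dim[OF assms(5)] by (simp add: mat_mult_one)
  moreover obtain i' where "i' \<in> carrier_mat (fst F) (fst N)" "i * i' = 1\<^sub>m (fst N)"
    using sesE[OF assms(4)] by metis
  ultimately show thesis
    using thru_regular_extend[OF assms(1) _ sesD(1)[OF assms(4)] assms(3) sesD(2,4)[OF assms(4)]] that by blast
qed

end

section \<open>Stable isomorphism and syzygies\<close>

context fdalg
begin

text \<open>One of the two composites in \<open>stab_cokernel\<close>; exchanging the two sequences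
  gives the other. The conclusion says that \<open>1 - c * c'\<close> factors through the projective
  middle term \<open>F\<close>.\<close>

lemma cokernel_stab_half:
  assumes inj: "self_injective A" and S: "ses N F C i p" and S': "ses N' F' C' i' p'"
    and R: "module R" "projective A R"
    and fg: "hom N N' f" "hom N' N g" "hom N R u" "hom R N v" "f * g + u * v = 1\<^sub>m (fst N)"
    and s: "hom F F' s" "i * s = f * i'" and t: "hom F' F t" "i' * t = g * i"
    and c: "hom C C' c" "s * p' = p * c" and c': "hom C' C c'" "t * p = p' * c'"
  obtains w where "hom C F w" "c * c' + w * p = 1\<^sub>m (fst C)"
proof -
  note SD = sesD[OF S] and SD' = sesD[OF S']
  obtain u1 where u1: "hom F R u1" "i * u1 = u"
    using projective_extend[OF inj R(2,1) S fg(3)] .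
  note d = ses_dim[OF S] ses_dim[OF S'] fg(1-4)[THEN hom_dim(1)] fg(1-4)[THEN hom_dim(2)]
    hom_dim[OF s(1)] hom_dim[OF t(1)] hom_dim[OF c(1)] hom_dim[OF c'(1)] hom_dim[OF u1(1)]
  \<comment> \<open>On \<open>N\<close> the map \<open>s * t\<close> restricts to
    \<open>f * g\<close> and the correction restricts to \<open>u * v\<close>, so \<open>h\<close>
    vanishes there and descends to a map \<open>w\<close> on the cokernel.\<close>
  define h where "h = 1\<^sub>m (fst F) - (s * t + u1 * (v * i))"
  have dh: "dim_row h = fst F" "dim_col h = fst F"
    using d by (auto simp: h_def)
  have "hom F F h"
    unfolding h_def using SD SD' R fg s t u1
    by (intro hom_minus hom_add hom_one hom_mult[of F F'] hom_mult[of F R] hom_mult[of R N]) auto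
  moreover have "i * h = 0\<^sub>m (fst N) (fst F)"
  proof -
    have "i * h = i - (f * g + u * v) * i"
      unfolding h_def 
      by (simp add: d mat_ring mat_assoc_eq[OF s(2)] t(2) mat_assoc_eq[OF u1(2)])
    then show ?thesis
      by (simp add: d fg(5) mat_ring)
  qed
  ultimately obtain w where w: "hom C F w" "h = p * w"
    using ses_factor[OF S SD(2)] by metis
  note dw = hom_dim[OF w(1)]
  have hp: "h * p = p * (w * p)"
    by (simp add: d dw w(2) mat_assoc)
  have "p * (c * c' + w * p) = s * t * p + h * p"
    by (simp add: d dw dh hp mat_mult_add mat_assoc_eq[OF c(2)[symmetric]] c'(2) mat_assoc)
  also have "\<dots> = (s * t + h) * p"
    by (simp add: d dh mat_add_mult)
  also have "\<dots> = (s * t + u1 * (v * i) + h) * p"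
  proof -
    have "u1 * (v * i) * p = 0\<^sub>m (fst F) (fst C)"
      by (simp add: d mat_ring SD(6))
    then show ?thesis
      by (simp add: d dh mat_add_mult mat_add_zero)
  qed
  also have "s * t + u1 * (v * i) + h = 1\<^sub>m (fst F)"
    unfolding h_def using d by (intro eq_matI) (auto simp del: index_mult_mat(1))
  finally have "p * (c * c' + w * p) = p * 1\<^sub>m (fst C)"
    by (simp add: d mat_ring)
  then have "c * c' + w * p = 1\<^sub>m (fst C)"
    by (rule ses_epi[OF S, rotated 2]) (use d dw in auto)
  then show thesis using that w(1) by blast
qed

text \<open>Isomorphism in the stable category: the two maps are inverse to each other up to maps that
  factor through projective modules.\<close>

definition stab :: "'k fdmod \<Rightarrow> 'k fdmod \<Rightarrow> bool" where
  "stab X Y \<longleftrightarrow> module X \<and> module Y \<and> (\<exists>f g R u v R' u' v'. hom X Y f \<and> hom Y X g \<and>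
    module R \<and> projective A R \<and> hom X R u \<and> hom R X v \<and> f * g + u * v = 1\<^sub>m (fst X) \<and>
    module R' \<and> projective A R' \<and> hom Y R' u' \<and> hom R' Y v' \<and> g * f + u' * v' = 1\<^sub>m (fst Y))"

lemma stab_iso:
  assumes "module X" "module Y" "module R" "projective A R"
    "hom X Y S" "hom Y X T" "S * T = 1\<^sub>m (fst X)" "T * S = 1\<^sub>m (fst Y)"
  shows "stab X Y"
proof -
  have "S * T + 0\<^sub>m (fst X) (fst R) * 0\<^sub>m (fst R) (fst X) = 1\<^sub>m (fst X)"
    "T * S + 0\<^sub>m (fst Y) (fst R) * 0\<^sub>m (fst R) (fst Y) = 1\<^sub>m (fst Y)"
    using assms(7,8) by (simp_all add: mat_ring)
  then show ?thesis
    unfolding stab_def using assms(1-6) hom_zero[OF assms(1,3)] hom_zero[OF assms(3,1)]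
      hom_zero[OF assms(2,3)] hom_zero[OF assms(3,2)] by blast
qed

lemma stab_iso_trans:
  assumes "module X" "hom X Y S" "hom Y X T" "S * T = 1\<^sub>m (fst X)" "T * S = 1\<^sub>m (fst Y)" "stab Y Z"
  shows "stab X Z"
proof -
  obtain f g R u v R' u' v' where YZ: "module Y" "module Z" "hom Y Z f" "hom Z Y g"
    and R: "module R" "projective A R" "hom Y R u" "hom R Y v" "f * g + u * v = 1\<^sub>m (fst Y)"
    and R': "module R'" "projective A R'" "hom Z R' u'" "hom R' Z v'" "g * f + u' * v' = 1\<^sub>m (fst Z)"
    using assms(6) unfolding stab_def by blast
  note d = hom_dim[OF assms(2)] hom_dim[OF assms(3)] hom_dim[OF YZ(3)] hom_dim[OF YZ(4)]
    hom_dim[OF R(3)] hom_dim[OF R(4)]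
  have "hom X Z (S * f)" "hom Z X (g * T)" "hom X R (S * u)" "hom R X (v * T)"
    using hom_mult assms YZ R by blast+
  moreover have "S * f * (g * T) + S * u * (v * T) = 1\<^sub>m (fst X)"
  proof -
    have "S * f * (g * T) + S * u * (v * T) = S * ((f * g + u * v) * T)"
      by (simp add: d mat_ring)
    then show ?thesis by (simp add: d R(5) mat_one_mult assms(4))
  qed
  moreover have "g * T * (S * f) + u' * v' = 1\<^sub>m (fst Z)"
    by (simp add: d R'(5) mat_ring mat_assoc_eq[OF assms(5)])
  ultimately show ?thesis
    unfolding stab_def using assms(1) YZ R R' by blast
qed

text \<open>Schanuel's lemma in the cosyzygy direction: \<open>f\<close> and \<open>g\<close> extend
  to the middle terms because projectives are injective, and the extensions induce maps of
  cokernels.\<close>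

lemma stab_cokernel:
  assumes inj: "self_injective A" and S: "ses N F C i p" and S': "ses N' F' C' i' p'"
    and F: "projective A F" "projective A F'" and st: "stab N N'"
  shows "stab C C'"
proof -
  obtain f g R u v R' u' v' where fg: "hom N N' f" "hom N' N g"
    and R: "module R" "projective A R" "hom N R u" "hom R N v" "f * g + u * v = 1\<^sub>m (fst N)"
    and R': "module R'" "projective A R'" "hom N' R' u'" "hom R' N' v'" "g * f + u' * v' = 1\<^sub>m (fst N')"
    using st unfolding stab_def by blast
  note SD = sesD[OF S] and SD' = sesD[OF S']
  obtain s where s: "hom F F' s" "i * s = f * i'"
    using projective_extend[OF inj F(2) SD'(2) S hom_mult[OF SD(1) SD'(1,2) fg(1) SD'(4)]] .
  obtain t where t: "hom F' F t" "i' * t = g * i"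
    using projective_extend[OF inj F(1) SD(2) S' hom_mult[OF SD'(1) SD(1,2) fg(2) SD(4)]] .
  note d = ses_dim[OF S] ses_dim[OF S'] hom_dim[OF fg(1)] hom_dim[OF fg(2)] hom_dim[OF s(1)] hom_dim[OF t(1)]
  have "i * (s * p') = 0\<^sub>m (fst N) (fst C')"
    by (simp add: d mat_assoc_eq[OF s(2)] mat_ring SD'(6))
  then obtain c where c: "hom C C' c" "s * p' = p * c"
    using ses_factor[OF S SD'(3) hom_mult[OF SD(2) SD'(2,3) s(1) SD'(5)]] by metis
  have "i' * (t * p) = 0\<^sub>m (fst N') (fst C)"
    by (simp add: d mat_assoc_eq[OF t(2)] mat_ring SD(6))
  then obtain c' where c': "hom C' C c'" "t * p = p' * c'"
    using ses_factor[OF S' SD(3) hom_mult[OF SD'(2) SD(2,3) t(1) SD(5)]] by metis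
  obtain w where "hom C F w" "c * c' + w * p = 1\<^sub>m (fst C)"
    using cokernel_stab_half[OF inj S S' R(1,2) fg R(3-5) s t c c'] .
  moreover obtain w' where "hom C' F' w'" "c' * c + w' * p' = 1\<^sub>m (fst C')"
    using cokernel_stab_half[OF inj S' S R'(1,2) fg(2,1) R'(3-5) t s c' c] .
  ultimately show ?thesis
    unfolding stab_def using SD SD' F c(1) c'(1) by blast
qed

text \<open>An extension of \<open>L\<close> by \<open>W\<close> with projective middle term can be replaced by one of \<open>L\<close> by a direct
  summand of \<open>W\<close> if the projection onto the complement factors through a free module: this complement
  splits off the middle term.\<close>

lemma ses_reduce:
  assumes inj: "self_injective A" and T: "projective A T" and S: "ses W T L \<iota> \<theta>"
    and M: "module M" "hom M W h" "hom W M h'" "h * h' = 1\<^sub>m (fst M)"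
    and E: "thru (regular A) W W (1\<^sub>m (fst W) - h' * h)"
  obtains P' i2 p2 where "projective A P'" "ses M P' L i2 p2"
proof -
  note SD = sesD[OF S]
  obtain \<iota>' \<theta>' where inv: "\<iota>' \<in> carrier_mat (fst T) (fst W)" "\<theta>' \<in> carrier_mat (fst L) (fst T)"
    and sp: "\<iota> * \<iota>' = 1\<^sub>m (fst W)" "\<theta>' * \<theta> = 1\<^sub>m (fst L)" "\<iota>' * \<iota> + \<theta> * \<theta>' = 1\<^sub>m (fst T)"
    using sesE[OF S] .
  define E where "E = 1\<^sub>m (fst W) - h' * h"
  note d = ses_dim[OF S] hom_dim[OF M(2)] hom_dim[OF M(3)] carrier_matD[OF inv(1)] carrier_matD[OF inv(2)]
  have dE: "dim_row E = fst W" "dim_col E = fst W"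
    using d by (auto simp: E_def)
  have homE: "hom W W E"
    unfolding E_def using M SD by (intro hom_minus hom_one hom_mult[of W M]) auto
  have hE: "h * E = 0\<^sub>m (fst M) (fst W)"
    unfolding E_def by (simp add: d mat_ring mat_assoc_eq[OF M(4)])
  have Eh: "E * h' = 0\<^sub>m (fst W) (fst M)"
    unfolding E_def by (simp add: d mat_ring M(4))
  have EE: "E * E = E"
  proof -
    have "E * E = E * 1\<^sub>m (fst W) - E * (h' * h)"
      by (subst (2) E_def) (simp add: d dE mat_ring)
    then show ?thesis by (simp add: d dE mat_ring mat_assoc_eq[OF Eh])
  qed
  \<comment> \<open>\<open>E\<close> is the projection onto the complement of \<open>M\<close> in
    \<open>W\<close>. It factors through free modules, so it extends from \<open>W\<close> to
    \<open>T\<close>.\<close>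
  obtain z0 where z0: "hom T W z0" "\<iota> * z0 = E"
    using thru_regular_extend[OF inj E SD(1,1,2,4) inv(1) sp(1)] unfolding E_def by blast
  \<comment> \<open>Composing with \<open>E\<close> once more gives \<open>z * E = z\<close> while
    keeping \<open>\<iota> * z = E\<close>; together they make \<open>z * \<iota>\<close>
    idempotent.\<close>
  define z where "z = z0 * E"
  have z: "hom T W z"
    unfolding z_def using hom_mult[OF SD(2,1,1) z0(1) homE] .
  note dz = hom_dim[OF z] hom_dim[OF z0(1)]
  have iz: "\<iota> * z = E"
    unfolding z_def by (simp add: d dz dE mat_assoc_eq[OF z0(2)] EE)
  have zE: "z * E = z"
    unfolding z_def by (simp add: d dz dE mat_assoc EE)
  \<comment> \<open>\<open>z * \<iota>\<close> projects \<open>T\<close> onto the copy of the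
    complement. What remains, cut out by \<open>\<epsilon>\<close>, is the new middle term
    \<open>P'\<close>.\<close>
  define \<epsilon> where "\<epsilon> = 1\<^sub>m (fst T) - z * \<iota>"
  have de: "dim_row \<epsilon> = fst T" "dim_col \<epsilon> = fst T"
    using d dz by (auto simp: \<epsilon>_def)
  have hom\<epsilon>: "hom T T \<epsilon>"
    unfolding \<epsilon>_def using SD z by (intro hom_minus hom_one hom_mult[of T W]) auto
  have ez: "\<epsilon> * z = 0\<^sub>m (fst T) (fst W)"
    unfolding \<epsilon>_def by (simp add: d dz dE mat_ring iz zE)
  have "\<epsilon> * \<epsilon> = \<epsilon> * 1\<^sub>m (fst T) - \<epsilon> * (z * \<iota>)"
    by (subst (2) \<epsilon>_def) (simp add: d de dz mat_ring)
  then have ee: "\<epsilon> * \<epsilon> = \<epsilon>"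
    by (simp add: d de dz mat_ring mat_assoc_eq[OF ez])
  obtain k b c where bc: "b \<in> carrier_mat (fst T) k" "c \<in> carrier_mat k (fst T)" "c * b = 1\<^sub>m k" "b * c = \<epsilon>"
    using idempotent_splits[of \<epsilon> "fst T"] ee hom_carrier[OF hom\<epsilon>] by metis
  note dbc = carrier_matD[OF bc(1)] carrier_matD[OF bc(2)]
  define P' where "P' = (k, \<lambda>a. c * (snd T a * b))"
  have P': "module P'" "hom T P' b" "hom P' T c" "fst P' = k"
    using hom_retract[OF SD(2) bc(2,1,3)] hom\<epsilon> by (auto simp: P'_def bc(4))
  have projP': "projective A P'"
    using projective_retract[OF T SD(2) P'(1-3)] P'(4) bc(3) by simp
  have eps_b: "\<epsilon> * b = b"
    by (simp add: dbc bc(4)[symmetric] mat_ring bc(3))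
  have zib: "z * (\<iota> * b) = 0\<^sub>m (fst T) k"
  proof -
    have "\<epsilon> * b = b - z * (\<iota> * b)"
      unfolding \<epsilon>_def by (simp add: d dz dbc mat_ring)
    then have "b - z * (\<iota> * b) = b" using eps_b by simp
    then have "z * (\<iota> * b) = b - b"
      using d dz dbc by (intro eq_matI) (auto simp: mat_eq_iff simp del: index_mult_mat(1))
    then show ?thesis by (simp add: dbc mat_minus_self)
  qed
  have Eib: "E * (\<iota> * b) = 0\<^sub>m (fst W) k"
    using d dz dbc zib by (simp add: iz[symmetric] mat_assoc mat_mult_zero)
  have i_eps: "\<iota> * \<epsilon> = \<iota> - E * \<iota>"
    unfolding \<epsilon>_def by (simp add: d dz mat_ring mat_assoc_eq[OF iz])
  have eps_th: "\<epsilon> * \<theta> = \<theta>"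
    unfolding \<epsilon>_def by (simp add: d dz mat_ring SD(6))
  have th_eps: "\<theta> * \<theta>' = 1\<^sub>m (fst T) - \<iota>' * \<iota>"
    using sp(3) d by (auto simp: mat_eq_iff algebra_simps simp del: index_mult_mat(1))
  define i2 p2 i2' p2' where "i2 = h * (\<iota> * b)" and "p2 = c * \<theta>" and "i2' = c * (\<iota>' * h')" and "p2' = \<theta>' * b"
  have "ses M P' L i2 p2"
    unfolding ses_def
  proof (intro conjI exI)
    show "module M" "module P'" "module L" using M P' SD by auto
    show "hom M P' i2" "hom P' L p2"
      unfolding i2_def p2_def using M P' SD
      by (auto intro: hom_mult[of M W] hom_mult[of W T] hom_mult[of P' T])
    show "i2' \<in> carrier_mat (fst P') (fst M)" "p2' \<in> carrier_mat (fst L) (fst P')"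
      using d dbc P'(4) by (auto simp: i2'_def p2'_def)
    show "i2 * p2 = 0\<^sub>m (fst M) (fst L)"
      unfolding i2_def p2_def 
      by (simp add: d dbc mat_ring mat_assoc_eq[OF bc(4)] eps_th SD(6))
    have "\<epsilon> * (\<iota>' * h') = \<iota>' * h' - z * h'"
      unfolding \<epsilon>_def by (simp add: d dz mat_ring mat_assoc_eq[OF sp(1)])
    moreover have "\<iota> * (\<iota>' * h' - z * h') = h'"
      by (simp add: d dz mat_ring mat_assoc_eq[OF sp(1)] mat_assoc_eq[OF iz] Eh)
    ultimately show "i2 * i2' = 1\<^sub>m (fst M)"
      unfolding i2_def i2'_def 
      by (simp add: d dz dbc mat_assoc mat_assoc_eq[OF bc(4)] M(4))
    have "\<epsilon> * \<theta> = \<theta>" by (rule eps_th)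
    then show "p2' * p2 = 1\<^sub>m (fst L)"
      unfolding p2_def p2'_def by (simp add: d dbc mat_assoc mat_assoc_eq[OF bc(4)] sp(2))
    \<comment> \<open>The complement of \<open>M\<close> dies in \<open>P'\<close>, so projecting to
      \<open>M\<close> first makes no difference.\<close>
    have hhib: "h' * (h * (\<iota> * b)) = \<iota> * b"
    proof -
      have "E * (\<iota> * b) = \<iota> * b - h' * (h * (\<iota> * b))"
        unfolding E_def by (simp add: d dbc mat_ring)
      then have "\<iota> * b - h' * (h * (\<iota> * b)) = 0\<^sub>m (dim_row (\<iota> * b)) (dim_col (\<iota> * b))"
        using Eib d dbc by simp
      then show ?thesis
        using mat_eq_iff_minus[of "\<iota> * b" "h' * (h * (\<iota> * b))"] d dbc by simp
    qed
    have "i2' * i2 + p2 * p2' = c * ((\<iota>' * \<iota> + \<theta> * \<theta>') * b)"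
      unfolding i2_def p2_def i2'_def p2'_def by (simp add: d dbc mat_ring hhib)
    then show "i2' * i2 + p2 * p2' = 1\<^sub>m (fst P')"
      by (simp add: dbc P'(4) sp(3) mat_one_mult bc(3))
  qed
  then show thesis using that projP' by blast
qed

text \<open>Adding the identity of \<open>R\<close> to the sequence replaces \<open>K\<close> by
  \<open>W = K + R\<close> and leaves \<open>L\<close> alone. Since
  \<open>f * g + u * v = 1\<close>, \<open>M\<close> is a genuine summand of \<open>W\<close>, and
  \<open>ses_reduce\<close> removes its complement.\<close>

lemma stab_ses:
  assumes inj: "self_injective A" and st: "stab M K" and S: "ses K P L i p" and P: "projective A P"
  obtains P' i2 p2 where "projective A P'" "ses M P' L i2 p2"
proof -
  obtain f g R u v R' u' v' where MK: "module M" "module K" "hom M K f" "hom K M g"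
    and R: "module R" "projective A R" "hom M R u" "hom R M v" "f * g + u * v = 1\<^sub>m (fst M)"
    and R': "module R'" "projective A R'" "hom K R' u'" "hom R' K v'" "g * f + u' * v' = 1\<^sub>m (fst K)"
    using st unfolding stab_def by blast
  note SD = sesD[OF S]
  obtain i' p' where inv: "i' \<in> carrier_mat (fst P) (fst K)" "p' \<in> carrier_mat (fst L) (fst P)"
    and sp: "i * i' = 1\<^sub>m (fst K)" "p' * p = 1\<^sub>m (fst L)" "i' * i + p * p' = 1\<^sub>m (fst P)"
    using sesE[OF S] .
  obtain W a1 a2 b1 b2 where W: "module W" "hom K W a1" "hom R W a2" "hom W K b1" "hom W R b2"
    and ab: "a1 * b1 = 1\<^sub>m (fst K)" "a2 * b2 = 1\<^sub>m (fst R)" "a1 * b2 = 0\<^sub>m (fst K) (fst R)"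
      "a2 * b1 = 0\<^sub>m (fst R) (fst K)" "b1 * a1 + b2 * a2 = 1\<^sub>m (fst W)"
    using direct_sum[OF MK(2) R(1)] .
  obtain T s1 s2 r1 r2 where T: "module T" "hom P T s1" "hom R T s2" "hom T P r1" "hom T R r2"
    and sr: "s1 * r1 = 1\<^sub>m (fst P)" "s2 * r2 = 1\<^sub>m (fst R)" "s1 * r2 = 0\<^sub>m (fst P) (fst R)"
      "s2 * r1 = 0\<^sub>m (fst R) (fst P)" "r1 * s1 + r2 * s2 = 1\<^sub>m (fst T)"
    using direct_sum[OF SD(2) R(1)] .
  have projT: "projective A T"
    by (rule projective_direct_sum[OF P R(2) SD(2) R(1) T sr(5)])
  note d = ses_dim[OF S] carrier_matD[OF inv(1)] carrier_matD[OF inv(2)] W(2-5)[THEN hom_dim(1)] W(2-5)[THEN hom_dim(2)]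
    T(2-5)[THEN hom_dim(1)] T(2-5)[THEN hom_dim(2)] MK(3,4)[THEN hom_dim(1)] MK(3,4)[THEN hom_dim(2)]
    R(3,4)[THEN hom_dim(1)] R(3,4)[THEN hom_dim(2)] R'(3,4)[THEN hom_dim(1)] R'(3,4)[THEN hom_dim(2)]
  note ab' = ab(1-4)[THEN mat_assoc_eq] and sr' = sr(1-4)[THEN mat_assoc_eq]
  \<comment> \<open>The direct sum of \<open>i\<close> and the identity of \<open>R\<close>; its
    cokernel is still \<open>L\<close>.\<close>
  define \<iota> where "\<iota> = b1 * (i * s1) + b2 * s2"
  define \<theta> where "\<theta> = r1 * p"
  have S': "ses W T L \<iota> \<theta>"
    unfolding ses_def
  proof (intro conjI exI)
    show "module W" "module T" "module L" using W T SD by auto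
    show "hom W T \<iota>"
      unfolding \<iota>_def by (rule hom_add[OF W(1) T(1) hom_mult[OF W(1) MK(2) T(1) W(4)
        hom_mult[OF MK(2) SD(2) T(1) SD(4) T(2)]] hom_mult[OF W(1) R(1) T(1) W(5) T(3)]])
    show "hom T L \<theta>"
      unfolding \<theta>_def by (rule hom_mult[OF T(1) SD(2,3) T(4) SD(5)])
    show "\<iota> * \<theta> = 0\<^sub>m (fst W) (fst L)"
      unfolding \<iota>_def \<theta>_def by (simp add: d mat_ring sr' SD(6))
    show "r1 * (i' * a1) + r2 * a2 \<in> carrier_mat (fst T) (fst W)" "p' * s1 \<in> carrier_mat (fst L) (fst T)"
      using d by auto
    show "\<iota> * (r1 * (i' * a1) + r2 * a2) = 1\<^sub>m (fst W)"
      unfolding \<iota>_def by (simp add: d ab(5) mat_ring sr' mat_assoc_eq[OF sp(1)])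
    show "p' * s1 * \<theta> = 1\<^sub>m (fst L)"
      unfolding \<theta>_def by (simp add: d mat_ring sr' sp(2))
    have "(r1 * (i' * a1) + r2 * a2) * \<iota> + \<theta> * (p' * s1) = r1 * (i' * (i * s1)) + r2 * s2 + r1 * (p * (p' * s1))"
      unfolding \<iota>_def \<theta>_def by (simp add: d mat_ring ab')
    also have "\<dots> = r1 * (i' * (i * s1)) + r1 * (p * (p' * s1)) + r2 * s2"
      using d by (intro eq_matI) (auto simp: add_ac simp del: index_mult_mat(1))
    also have "\<dots> = r1 * ((i' * i + p * p') * s1) + r2 * s2"
      by (simp add: d mat_ring)
    finally show "(r1 * (i' * a1) + r2 * a2) * \<iota> + \<theta> * (p' * s1) = 1\<^sub>m (fst T)"
      by (simp add: d sp(3) mat_one_mult sr(5))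
  qed
  define h where "h = f * a1 + u * a2"
  define h' where "h' = b1 * g + b2 * v"
  have h: "hom M W h" "hom W M h'"
    unfolding h_def h'_def
    by (rule hom_add[OF MK(1) W(1) hom_mult[OF MK(1,2) W(1) MK(3) W(2)] hom_mult[OF MK(1) R(1) W(1) R(3) W(3)]]
        hom_add[OF W(1) MK(1) hom_mult[OF W(1) MK(2,1) W(4) MK(4)] hom_mult[OF W(1) R(1) MK(1) W(5) R(4)]])+
  have hh: "h * h' = 1\<^sub>m (fst M)"
    unfolding h_def h'_def by (simp add: d R(5) mat_ring ab')
  let ?A = "regular A"
  have thru_R: "thru ?A X Y (x * y)" if "module X" "module Y" "hom X R x" "hom R Y y" for X Y x y
    by (rule thru_of_identity[OF projective_thru_regular[OF R(1,2)] module_regular that(1,2) R(1) that(3,4)])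
  have thru_R': "thru ?A X Y (x * y)" if "module X" "module Y" "hom X R' x" "hom R' Y y" for X Y x y
    by (rule thru_of_identity[OF projective_thru_regular[OF R'(1,2)] module_regular that(1,2) R'(1) that(3,4)])
  \<comment> \<open>The blocks of \<open>1 - h' * h\<close>. The one on \<open>K\<close> is
    \<open>1 - g * f = u' * v'\<close> and passes through \<open>R'\<close>; every other block
    starts or ends in \<open>R\<close>. Hence all pass through projectives.\<close>
  let ?X = "(b1 * u') * (v' * a1) + b2 * a2 + - ((b1 * (g * u)) * a2) + - (b2 * (v * (f * a1))) + - (b2 * (v * (u * a2)))"
  have "thru ?A W W ?X"
    by (intro thru_add
        thru_R'[OF W(1,1) hom_mult[OF W(1) MK(2) R'(1) W(4) R'(3)] hom_mult[OF R'(1) MK(2) W(1) R'(4) W(2)]]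
        thru_R[OF W(1,1) W(5) W(3)]
        thru_uminus[OF thru_R[OF W(1,1) hom_mult[OF W(1) MK(2) R(1) W(4) hom_mult[OF MK(2,1) R(1) MK(4) R(3)]] W(3)] W(1) module_regular]
        thru_uminus[OF thru_R[OF W(1,1) W(5) hom_mult[OF R(1) MK(1) W(1) R(4) hom_mult[OF MK(1,2) W(1) MK(3) W(2)]]] W(1) module_regular]
        thru_uminus[OF thru_R[OF W(1,1) W(5) hom_mult[OF R(1) MK(1) W(1) R(4) hom_mult[OF MK(1) R(1) W(1) R(3) W(3)]]] W(1) module_regular])
  moreover have "1\<^sub>m (fst W) - h' * h = ?X"
  proof -
    have 1: "h' * h = b1 * (g * (f * a1)) + b2 * (v * (f * a1)) + (b1 * (g * (u * a2)) + b2 * (v * (u * a2)))"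
      unfolding h_def h'_def by (simp add: d mat_ring)
    have "1\<^sub>m (fst W) = b1 * ((g * f + u' * v') * a1) + b2 * a2"
      by (simp add: d R'(5) mat_one_mult ab(5))
    also have "\<dots> = b1 * (g * (f * a1)) + b1 * (u' * (v' * a1)) + b2 * a2"
      by (simp add: d mat_ring)
    finally have 2: "1\<^sub>m (fst W) = b1 * (g * (f * a1)) + b1 * (u' * (v' * a1)) + b2 * a2" .
    have 3: "?X = b1 * (u' * (v' * a1)) + b2 * a2 + - (b1 * (g * (u * a2))) + - (b2 * (v * (f * a1))) + - (b2 * (v * (u * a2)))"
      by (simp add: d mat_assoc)
    show ?thesis
      unfolding 1 2 3 using d by (intro eq_matI) (auto simp del: index_mult_mat(1))
  qed
  ultimately have "thru ?A W W (1\<^sub>m (fst W) - h' * h)" by simp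
  then show thesis
    using ses_reduce[OF inj projT S' MK(1) h hh] that by blast
qed

section \<open>Resolutions as chains of short exact sequences\<close>

lemma hkernel_mono:
  assumes "ses N F C i p" "hom X N q"
  shows "hkernel X (q * i) = hkernel X q"
proof -
  obtain i' where i': "i' \<in> carrier_mat (fst F) (fst N)" "i * i' = 1\<^sub>m (fst N)"
    using sesE[OF assms(1)] by metis
  note i = hom_carrier[OF sesD(4)[OF assms(1)]] and q = hom_carrier[OF assms(2)]
  have "vmul v (q * i) = 0\<^sub>v (fst F) \<longleftrightarrow> vmul v q = 0\<^sub>v (fst N)" if v: "v \<in> carrier_vec (fst X)" for v
  proof -
    have w: "vmul v q \<in> carrier_vec (fst N)" using vmul_carrier[OF q] .
    have "vmul (vmul (vmul v q) i) i' = vmul v q"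
      using vmul_mult[OF w i i'(1)] i'(2) vmul_one[OF w] by simp
    then show ?thesis
      unfolding vmul_mult[OF v q i] using vmul_zero_vec[OF i] vmul_zero_vec[OF i'(1)] by metis
  qed
  then show ?thesis
    using i q by (auto simp: hkernel_def mcar_def)
qed

lemma himage_ses:
  assumes S: "ses N F C i p" and q: "hom X N q" and G: "G \<in> carrier_mat (fst N) (fst X)" "G * q = 1\<^sub>m (fst N)"
  shows "himage X (q * i) = hkernel F p"
proof -
  obtain i' p' where inv: "i' \<in> carrier_mat (fst F) (fst N)" "p' \<in> carrier_mat (fst C) (fst F)"
    "i' * i + p * p' = 1\<^sub>m (fst F)"
    using sesE[OF S] by metis
  note i = hom_carrier[OF sesD(4)[OF S]] and p = hom_carrier[OF sesD(5)[OF S]] and qc = hom_carrier[OF q]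
  have "vmul v (q * i) \<in> hkernel F p" if v: "v \<in> carrier_vec (fst X)" for v
  proof -
    have "vmul (vmul v (q * i)) p = vmul (vmul v q) (i * p)"
      using vmul_mult[OF v qc i] vmul_mult[OF vmul_carrier[OF qc] i p] by simp
    then show ?thesis
      using sesD(6)[OF S] vmul_zero_mat[OF vmul_carrier[OF qc]] p vmul_carrier[OF mult_carrier_mat[OF qc i]]
      by (simp add: hkernel_def mcar_def)
  qed
  moreover have "w \<in> (\<lambda>v. vmul v (q * i)) ` carrier_vec (fst X)" if "w \<in> hkernel F p" for w
  proof (rule image_eqI)
    have w: "w \<in> carrier_vec (fst F)" and wp: "vmul w p = 0\<^sub>v (fst C)"
      using that p by (auto simp: hkernel_def mcar_def)
    have "w = vmul w (i' * i) + vmul w (p * p')"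
      using vmul_add_mat[OF w mult_carrier_mat[OF inv(1) i] mult_carrier_mat[OF p inv(2)]] inv(3) vmul_one[OF w] by simp
    also have "vmul w (p * p') = 0\<^sub>v (fst F)"
      using vmul_mult[OF w p inv(2)] wp vmul_zero_vec[OF inv(2)] by simp
    finally have w_eq: "w = vmul (vmul w i') i"
      using vmul_mult[OF w inv(1) i] vmul_carrier[OF mult_carrier_mat[OF inv(1) i], of w] by simp
    have x: "vmul w i' \<in> carrier_vec (fst N)" using vmul_carrier[OF inv(1)] .
    have "vmul (vmul w i') (G * q) = vmul w i'"
      using G(2) vmul_one[OF x] by simp
    then have "vmul (vmul (vmul w i') G) q = vmul w i'"
      using vmul_mult[OF x G(1) qc] by simp
    then show "w = vmul (vmul (vmul w i') G) (q * i)"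
      using w_eq vmul_mult[OF vmul_carrier[OF G(1)] qc i] by simp
    show "vmul (vmul w i') G \<in> carrier_vec (fst X)" using vmul_carrier[OF G(1)] .
  qed
  ultimately show ?thesis by (auto simp: himage_def mcar_def)
qed

text \<open>The differential is the projection onto the syzygy followed by its inclusion. The first
  is onto and the second injective, so image and kernel are those required.\<close>

lemma splice_resolution:
  assumes S: "\<And>t. ses (L (Suc t)) (Q t) (L t) (i t) (p t)" and proj: "\<And>t. projective A (Q t)"
  shows "proj_resolution A (L 0) Q (\<lambda>t. p (Suc t) * i t) (p 0)"
proof -
  note SD = sesD[OF S]
  have im: "himage (Q (Suc t)) (p (Suc t) * i t) = hkernel (Q t) (p t)" for t
    using himage_ses[OF S SD(5)] sesE[OF S[of "Suc t"]] by metis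
  have ker: "hkernel (Q (Suc t)) (p (Suc t) * i t) = hkernel (Q (Suc t)) (p (Suc t))" for t
    by (rule hkernel_mono[OF S SD(5)])
  have "himage (Q 0) (p 0) = mcar (L 0)"
    using himage_surj[OF hom_carrier[OF SD(5)]] sesE[OF S[of 0]] by metis
  moreover have "hom (Q (Suc t)) (Q t) (p (Suc t) * i t)" for t
    by (rule hom_mult[OF SD(2,1,2) SD(5,4)])
  ultimately show ?thesis
    unfolding proj_resolution_def using SD proj im ker by (simp add: numeral_nat)
qed

text \<open>Syzygies are realised as modules on coordinate spaces, chosen one after another; each
  differential is factored through the kernel just chosen.\<close>

lemma resolution_syzygies:
  assumes M: "module M" and res: "proj_resolution A M P d e"
  shows "\<exists>K i p. K 0 = M \<and> (\<forall>t. ses (K (Suc t)) (P t) (K t) (i t) (p t))"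
proof -
  have P: "module (P t)" "projective A (P t)" "hom (P (Suc t)) (P t) (d t)" for t
    using res unfolding proj_resolution_def by blast+
  have ex: "himage (P (Suc (Suc t))) (d (Suc t)) = hkernel (P (Suc t)) (d t)" for t
    using res unfolding proj_resolution_def by blast+
  \<comment> \<open>The invariant: \<open>p\<close> presents the \<open>t\<close>-th syzygy as a
    quotient of \<open>P t\<close> whose kernel is the image of the next differential. The last
    clause pins the start to \<open>M\<close> itself.\<close>
  define good where "good t = (\<lambda>(K, p). module K \<and> hom (P t) K p \<and> himage (P t) p = mcar K \<and>
    himage (P (Suc t)) (d t) = hkernel (P t) p \<and> (t = 0 \<longrightarrow> K = M))" for t
  have "\<exists>s. \<forall>t. good t (s t) \<and> (\<exists>i. ses (fst (s (Suc t))) (P t) (fst (s t)) i (snd (s t)))"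
  proof (rule dependent_nat_choice)
    show "\<exists>x. good 0 x"
      using res M unfolding proj_resolution_def One_nat_def good_def by (intro exI[of _ "(M, e)"]) simp
    fix x t assume "good t x"
    obtain K p where x: "x = (K, p)" by (cases x)
    have K: "module K" "hom (P t) K p" "himage (P t) p = mcar K" "himage (P (Suc t)) (d t) = hkernel (P t) p"
      using \<open>good t x\<close> by (auto simp: x good_def)
    obtain N i where S: "ses N (P t) K i p"
      using kernel_ses[OF P(1) K(1-3)] .
    obtain i' where i': "i' \<in> carrier_mat (fst (P t)) (fst N)" "i * i' = 1\<^sub>m (fst N)"
      using sesE[OF S] by metis
    note pc = hom_carrier[OF K(2)] and dc = hom_carrier[OF P(3)[of t]] and ic = hom_carrier[OF sesD(4)[OF S]]
    have "d t * p = 0\<^sub>m (fst (P (Suc t))) (fst K)"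
    proof (rule mat_eq_if_vmul_eq)
      fix v :: "'k vec" assume v: "v \<in> carrier_vec (fst (P (Suc t)))"
      then have "vmul v (d t) \<in> hkernel (P t) p"
        using K(4) by (auto simp: himage_def mcar_def)
      then show "vmul v (d t * p) = vmul v (0\<^sub>m (fst (P (Suc t))) (fst K))"
        using vmul_mult[OF v dc pc] vmul_zero_mat[OF v] pc by (auto simp: hkernel_def)
    qed (use dc pc in auto)
    then obtain q where q: "hom (P (Suc t)) N q" "d t = q * i"
      using ses_lift[OF S P(1) P(3)] by metis
    note qc = hom_carrier[OF q(1)]
    have "himage (P (Suc t)) q = mcar N"
    proof -
      have "w \<in> himage (P (Suc t)) q" if w: "w \<in> carrier_vec (fst N)" for w
      proof -
        have "vmul (vmul w i) p = 0\<^sub>v (fst K)"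
          using vmul_mult[OF w ic pc] sesD(6)[OF S] vmul_zero_mat[OF w] by simp
        then have "vmul w i \<in> himage (P (Suc t)) (d t)"
          unfolding K(4) using vmul_carrier[OF ic] pc by (auto simp: hkernel_def mcar_def)
        then obtain v where v: "v \<in> carrier_vec (fst (P (Suc t)))" "vmul w i = vmul v (d t)"
          by (auto simp: himage_def mcar_def)
        then have "vmul w i = vmul (vmul v q) i"
          using vmul_mult[OF v(1) qc ic] q(2) by simp
        then have "vmul (vmul w i) i' = vmul (vmul (vmul v q) i) i'" by simp
        then have "w = vmul v q"
          using vmul_mult[OF w ic i'(1)] vmul_mult[OF vmul_carrier[OF qc] ic i'(1)] i'(2) vmul_one[OF w]
            vmul_one[OF vmul_carrier[OF qc]] by simp
        then show ?thesis using v(1) by (auto simp: himage_def mcar_def)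
      qed
      then show ?thesis
        using vmul_carrier[OF qc] by (auto simp: himage_def mcar_def)
    qed
    moreover have "himage (P (Suc (Suc t))) (d (Suc t)) = hkernel (P (Suc t)) q"
      unfolding ex q(2) by (rule hkernel_mono[OF S q(1)])
    ultimately show "\<exists>y. good (Suc t) y \<and> (\<exists>i. ses (fst y) (P t) (fst x) i (snd x))"
      using S q(1) sesD(1)[OF S] by (intro exI[of _ "(N, q)"]) (auto simp: good_def x)
  qed
  then obtain s where s: "\<And>t. good t (s t)" "\<And>t. \<exists>i. ses (fst (s (Suc t))) (P t) (fst (s t)) i (snd (s t))"
    by blast
  then obtain i where "\<forall>t. ses (fst (s (Suc t))) (P t) (fst (s t)) (i t) (snd (s t))" by metis
  moreover have "fst (s 0) = M"
    using s(1)[of 0] by (auto simp: good_def split: prod.splits)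
  ultimately show ?thesis
    by (intro exI[of _ "\<lambda>t. fst (s t)"] exI[of _ i] exI[of _ "\<lambda>t. snd (s t)"] conjI)
qed

text \<open>By \<open>stab_ses\<close> the module \<open>M\<close> can take the place of
  \<open>K m\<close> as kernel over \<open>K (m - 1)\<close>. The chain from \<open>K 0 = M\<close>
  back to \<open>M\<close> then closes up and is repeated modulo \<open>m\<close>.\<close>

lemma periodic_if_stab:
  assumes inj: "self_injective A" and K0: "K 0 = M" and S: "\<And>t. ses (K (Suc t)) (P t) (K t) (i t) (p t)"
    and P: "\<And>t. projective A (P t)" and m: "m \<ge> 1" and st: "stab M (K m)"
  shows "periodic A M"
proof -
  have "ses (K m) (P (m - 1)) (K (m - 1)) (i (m - 1)) (p (m - 1))"
    using S[of "m - 1"] m by simp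
  then obtain P' i2 p2 where P': "projective A P'" "ses M P' (K (m - 1)) i2 p2"
    using stab_ses[OF inj st _ P] by metis
  define L where "L t = K (t mod m)" for t
  \<comment> \<open>Index \<open>m - 1\<close> is the step whose kernel would be \<open>K m\<close>;
    there the altered sequence with kernel \<open>M\<close> is used.\<close>
  define Q where "Q t = (if t mod m = m - 1 then P' else P (t mod m))" for t
  define i' where "i' t = (if t mod m = m - 1 then i2 else i (t mod m))" for t
  define p' where "p' t = (if t mod m = m - 1 then p2 else p (t mod m))" for t
  have "ses (L (Suc t)) (Q t) (L t) (i' t) (p' t)" for t
  proof (cases "t mod m = m - 1")
    case True
    then have "Suc t mod m = 0" using m by (simp add: mod_Suc)
    then show ?thesis using True P'(2) K0 by (simp add: L_def Q_def i'_def p'_def)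
  next
    case False
    then have "Suc t mod m = Suc (t mod m)" using m by (auto simp: mod_Suc)
    then show ?thesis using False S by (simp add: L_def Q_def i'_def p'_def)
  qed
  moreover have "projective A (Q t)" for t
    using P P'(1) by (simp add: Q_def)
  ultimately have "proj_resolution A (L 0) Q (\<lambda>t. p' (Suc t) * i' t) (p' 0)"
    by (rule splice_resolution)
  moreover have "L 0 = M" by (simp add: L_def K0)
  moreover have "Q (t + m) = Q t" "p' (Suc (t + m)) * i' (t + m) = p' (Suc t) * i' t" for t
  proof -
    have "Suc (t + m) mod m = Suc t mod m"
      using mod_add_self2[of "Suc t" m] by simp
    then show "Q (t + m) = Q t" "p' (Suc (t + m)) * i' (t + m) = p' (Suc t) * i' t"
      by (simp_all add: Q_def p'_def i'_def)
  qed
  ultimately show ?thesis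
    unfolding periodic_def using m by (intro exI[of _ Q] exI[of _ "\<lambda>t. p' (Suc t) * i' t"] exI[of _ "p' 0"] exI[of _ m]) auto
qed

end

section \<open>Open conditions on module structures\<close>

lemma sum_lessThan_add:
  fixes g :: "nat \<Rightarrow> 'a::comm_monoid_add"
  shows "(\<Sum>l<c + e. g l) = (\<Sum>l<c. g l) + (\<Sum>l<e. g (c + l))"
  by (induction e) (auto simp: add.assoc)

text \<open>Block matrices: \<open>stack\<close> puts rows below rows, \<open>side\<close> columns
  beside columns.\<close>

definition stack :: "'a::zero mat \<Rightarrow> 'a mat \<Rightarrow> 'a mat" where
  "stack F G = mat (dim_row F + dim_row G) (dim_col F)
     (\<lambda>(i, j). if i < dim_row F then F $$ (i, j) else G $$ (i - dim_row F, j))"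

definition side :: "'a::zero mat \<Rightarrow> 'a mat \<Rightarrow> 'a mat" where
  "side F G = mat (dim_row F) (dim_col F + dim_col G)
     (\<lambda>(i, j). if j < dim_col F then F $$ (i, j) else G $$ (i, j - dim_col F))"

lemma stack_side_entry:
  fixes F :: "'a::semiring_0 mat"
  assumes "F \<in> carrier_mat c m" "G \<in> carrier_mat e m" "X \<in> carrier_mat m c" "Y \<in> carrier_mat m e"
    and "i < c + e" "j < c + e"
  shows "(stack F G * side X Y) $$ (i, j) =
    (if i < c then if j < c then (F * X) $$ (i, j) else (F * Y) $$ (i, j - c)
     else if j < c then (G * X) $$ (i - c, j) else (G * Y) $$ (i - c, j - c))"
proof -
  have "(stack F G * side X Y) $$ (i, j) = (\<Sum>l<m. stack F G $$ (i, l) * side X Y $$ (l, j))"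
    by (rule mult_mat_entry) (use assms in \<open>auto simp: stack_def side_def\<close>)
  also have "\<dots> = (\<Sum>l<m. (if i < c then F $$ (i, l) else G $$ (i - c, l)) * (if j < c then X $$ (l, j) else Y $$ (l, j - c)))"
    using assms by (intro sum.cong) (auto simp: stack_def side_def)
  finally show ?thesis
    using assms by (auto simp: mult_mat_entry[where n = "m"] simp del: index_mult_mat(1))
qed

text \<open>Together with \<open>side_stack\<close> this says that the identities of a linearly
  split exact sequence express that two square matrices are inverse. Exactness near a given sequence
  is thereby controlled by a determinant.\<close>

lemma stack_side_one_iff:
  fixes F :: "'a::semiring_1 mat"
  assumes c: "F \<in> carrier_mat c m" "G \<in> carrier_mat e m" "X \<in> carrier_mat m c" "Y \<in> carrier_mat m e"
  shows "stack F G * side X Y = 1\<^sub>m (c + e) \<longleftrightarrow>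
    F * X = 1\<^sub>m c \<and> F * Y = 0\<^sub>m c e \<and> G * X = 0\<^sub>m e c \<and> G * Y = 1\<^sub>m e" (is "?L \<longleftrightarrow> ?R")
proof
  assume L: ?L
  have E: "(if i < c then if j < c then (F * X) $$ (i, j) else (F * Y) $$ (i, j - c)
     else if j < c then (G * X) $$ (i - c, j) else (G * Y) $$ (i - c, j - c)) = (if i = j then 1 else 0)"
    if "i < c + e" "j < c + e" for i j
    using stack_side_entry[OF c that] that by (simp add: L)
  show ?R
  proof (intro conjI eq_matI)
    show "(F * X) $$ (i, j) = 1\<^sub>m c $$ (i, j)" if "i < dim_row (1\<^sub>m c)" "j < dim_col (1\<^sub>m c)" for i j
      using E[of i j] that by (simp del: index_mult_mat(1))
    show "(F * Y) $$ (i, j) = 0\<^sub>m c e $$ (i, j)" if "i < dim_row (0\<^sub>m c e)" "j < dim_col (0\<^sub>m c e)" for i j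
      using E[of i "c + j"] that by (simp del: index_mult_mat(1))
    show "(G * X) $$ (i, j) = 0\<^sub>m e c $$ (i, j)" if "i < dim_row (0\<^sub>m e c)" "j < dim_col (0\<^sub>m e c)" for i j
      using E[of "c + i" j] that by (simp del: index_mult_mat(1))
    show "(G * Y) $$ (i, j) = 1\<^sub>m e $$ (i, j)" if "i < dim_row (1\<^sub>m e)" "j < dim_col (1\<^sub>m e)" for i j
      using E[of "c + i" "c + j"] that by (simp del: index_mult_mat(1))
  qed (use c in auto)
next
  assume R: ?R
  show ?L
  proof (rule eq_matI)
    fix i j assume "i < dim_row (1\<^sub>m (c + e) :: 'a mat)" "j < dim_col (1\<^sub>m (c + e) :: 'a mat)"
    then have ij: "i < c + e" "j < c + e" by auto
    show "(stack F G * side X Y) $$ (i, j) = 1\<^sub>m (c + e) $$ (i, j)"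
      unfolding stack_side_entry[OF c ij] using ij R by auto
  qed (use c in \<open>auto simp: stack_def side_def\<close>)
qed

lemma side_stack:
  fixes F :: "'a::semiring_0 mat"
  assumes c: "F \<in> carrier_mat c m" "G \<in> carrier_mat e m" "X \<in> carrier_mat m c" "Y \<in> carrier_mat m e"
  shows "side X Y * stack F G = X * F + Y * G"
proof (rule eq_matI)
  fix i j assume "i < dim_row (X * F + Y * G)" "j < dim_col (X * F + Y * G)"
  then have ij: "i < m" "j < m" using c by auto
  have "(side X Y * stack F G) $$ (i, j) = (\<Sum>l<c + e. side X Y $$ (i, l) * stack F G $$ (l, j))"
    by (rule mult_mat_entry) (use c ij in \<open>auto simp: stack_def side_def\<close>)
  also have "\<dots> = (\<Sum>l<c. X $$ (i, l) * F $$ (l, j)) + (\<Sum>l<e. Y $$ (i, l) * G $$ (l, j))"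
    unfolding sum_lessThan_add using c ij by (intro arg_cong2[of _ _ _ _ "(+)"] sum.cong) (auto simp: stack_def side_def)
  also have "\<dots> = (X * F + Y * G) $$ (i, j)"
    using c ij by (simp add: mult_mat_entry[where n = "c"] mult_mat_entry[where n = "e"] del: index_mult_mat(1))
  finally show "(side X Y * stack F G) $$ (i, j) = (X * F + Y * G) $$ (i, j)" .
qed (use c in \<open>auto simp: stack_def side_def\<close>)

context fdalg
begin

text \<open>The quotient structure is given by the explicit formula
  \<open>p' * (snd F a * p)\<close>, which makes the cokernel depend rationally on the embedding. It
  is multiplicative because \<open>i' * i\<close> contributes nothing after the action and
  \<open>p\<close>.\<close>

lemma cokernel_ses:
  assumes N: "module N" and F: "module F" and i: "hom N F i"
    and c: "i' \<in> carrier_mat (fst F) (fst N)" "p' \<in> carrier_mat e (fst F)" "p \<in> carrier_mat (fst F) e"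
    and eqs: "i * i' = 1\<^sub>m (fst N)" "i * p = 0\<^sub>m (fst N) e" "p' * p = 1\<^sub>m e" "i' * i + p * p' = 1\<^sub>m (fst F)"
  shows "ses N F (e, \<lambda>a. p' * (snd F a * p)) i p"
proof -
  note d = hom_dim[OF i] c[THEN carrier_matD(1)] c[THEN carrier_matD(2)]
  have ac: "p * (p' * (snd F a * p)) = snd F a * p" if a: "a \<in> carrier_vec (dimA A)" for a
  proof -
    note da = module_dim[OF F a] module_dim[OF N a]
    have "snd F a * p = (i' * i + p * p') * (snd F a * p)"
      by (simp add: d da eqs(4) mat_one_mult)
    also have "\<dots> = p * (p' * (snd F a * p))"
      by (simp add: d da mat_ring mat_assoc_eq[OF hom_comm[OF i a, symmetric]] eqs(2))
    finally show ?thesis by simp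
  qed
  let ?C = "(e, \<lambda>a. p' * (snd F a * p))"
  have "module ?C"
    unfolding is_module_def Let_def fst_conv snd_conv
  proof (intro conjI ballI allI)
    fix a b :: "'k vec" and x :: 'k
    assume a: "a \<in> carrier_vec (dimA A)"
    note da = module_dim[OF F a]
    show "p' * (snd F a * p) \<in> carrier_mat e e"
      using d da by auto
    show "p' * (snd F (x \<cdot>\<^sub>v a) * p) = x \<cdot>\<^sub>m (p' * (snd F a * p))"
      by (simp add: d da module_smult[OF F a] mat_smult_mult mat_mult_smult)
    assume b: "b \<in> carrier_vec (dimA A)"
    note db = module_dim[OF F b]
    show "p' * (snd F (a + b) * p) = p' * (snd F a * p) + p' * (snd F b * p)"
      by (simp add: d da db module_add[OF F a b] mat_ring)
    show "p' * (snd F (mulA A a b) * p) = p' * (snd F a * p) * (p' * (snd F b * p))"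
      by (simp add: d da db module_mult[OF F a b] mat_assoc ac[OF b])
  next
    show "p' * (snd F (oneA A) * p) = 1\<^sub>m e"
      by (simp add: d module_one[OF F] mat_one_mult eqs(3))
  qed
  moreover have "hom F ?C p"
    by (rule homI) (use ac c in auto)
  ultimately show ?thesis
    unfolding ses_def fst_conv using N F i c eqs by blast
qed

text \<open>Polynomial functions on \<open>D\<close>-dimensional module structures, in the matrix entries of the images of
  the standard basis of the algebra.\<close>

inductive_set polys :: "nat \<Rightarrow> (('k vec \<Rightarrow> 'k mat) \<Rightarrow> 'k) set" for D where
  const: "(\<lambda>_. x) \<in> polys D"
| coord: "b < n \<Longrightarrow> r < D \<Longrightarrow> c < D \<Longrightarrow> (\<lambda>\<sigma>. \<sigma> (unit_vec n b) $$ (r, c)) \<in> polys D"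
| add: "f \<in> polys D \<Longrightarrow> g \<in> polys D \<Longrightarrow> (\<lambda>\<sigma>. f \<sigma> + g \<sigma>) \<in> polys D"
| mult: "f \<in> polys D \<Longrightarrow> g \<in> polys D \<Longrightarrow> (\<lambda>\<sigma>. f \<sigma> * g \<sigma>) \<in> polys D"

lemma polys_sum: "(\<And>i. i \<in> I \<Longrightarrow> f i \<in> polys D) \<Longrightarrow> (\<lambda>\<sigma>. \<Sum>i\<in>I. f i \<sigma>) \<in> polys D"
  by (induction I rule: infinite_finite_induct) (auto intro: polys.intros)

lemma polys_prod: "(\<And>i. i \<in> I \<Longrightarrow> f i \<in> polys D) \<Longrightarrow> (\<lambda>\<sigma>. \<Prod>i\<in>I. f i \<sigma>) \<in> polys D"
  by (induction I rule: infinite_finite_induct) (auto intro: polys.intros)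

lemma polys_power: "f \<in> polys D \<Longrightarrow> (\<lambda>\<sigma>. f \<sigma> ^ k) \<in> polys D"
  by (induction k) (auto intro: polys.intros)

text \<open>Structures are arbitrary functions on vectors; only their values on the standard basis
  matter to a polynomial.\<close>

lemma polys_cong:
  assumes "f \<in> polys D" "\<And>b. b < n \<Longrightarrow> \<sigma> (unit_vec n b) = \<tau> (unit_vec n b)"
  shows "f \<sigma> = f \<tau>"
  using assms(1) by (induction rule: polys.induct) (auto simp: assms(2))

lemma polys_det:
  assumes "\<And>i j. i < m \<Longrightarrow> j < m \<Longrightarrow> q i j \<in> polys D"
  shows "(\<lambda>\<sigma>. det (mat m m (\<lambda>(i, j). q i j \<sigma>))) \<in> polys D"
proof -
  have "det (mat m m (\<lambda>(i, j). q i j \<sigma>)) =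
      (\<Sum>p | p permutes {0..<m}. signof p * (\<Prod>i = 0..<m. q i (p i) \<sigma>))" for \<sigma>
    by (subst det_def'[of _ m]) (auto intro!: sum.cong prod.cong simp: permutes_in_image)
  moreover have "(\<lambda>\<sigma>. \<Sum>p | p permutes {0..<m}. signof p * (\<Prod>i = 0..<m. q i (p i) \<sigma>)) \<in> polys D"
    using assms by (intro polys_sum polys.mult polys.const polys_prod) (auto dest: permutes_in_image)
  ultimately show ?thesis by simp
qed

text \<open>Cofactors are signed minors. With \<open>polys_det\<close>, an inverse matrix is
  polynomial up to division by the determinant.\<close>

lemma polys_adj:
  assumes "\<And>i j. i < m \<Longrightarrow> j < m \<Longrightarrow> q i j \<in> polys D" and ij: "i < m" "j < m"
  shows "(\<lambda>\<sigma>. adj_mat (mat m m (\<lambda>(i, j). q i j \<sigma>)) $$ (i, j)) \<in> polys D"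
proof -
  have del: "mat_delete (mat m m (\<lambda>(i, j). q i j \<sigma>)) j i =
      mat (m - 1) (m - 1) (\<lambda>(r, c). q (if r < j then r else Suc r) (if c < i then c else Suc c) \<sigma>)" for \<sigma>
    using ij by (intro eq_matI) (auto simp: mat_delete_def)
  have "(\<lambda>\<sigma>. (-1)^(j + i) * det (mat (m - 1) (m - 1) (\<lambda>(r, c).
      q (if r < j then r else Suc r) (if c < i then c else Suc c) \<sigma>))) \<in> polys D"
    using assms by (intro polys.mult polys.const polys_det) auto
  then show ?thesis
    using ij by (simp add: adj_mat_def cofactor_def del)
qed

text \<open>Change of coordinates from generators to the standard basis. A generator acts as a fixed
  linear combination of basis elements, but only at module structures, so the functions are compared
  just there.\<close>

lemma polyfun_polys:
  assumes "f \<in> polyfun (length gs) D" "set gs \<subseteq> carrier_vec n"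
  shows "\<exists>g\<in>polys D. \<forall>\<sigma>. module (D, \<sigma>) \<longrightarrow> f (map \<sigma> gs) = g \<sigma>"
  using assms(1)
proof (induction rule: polyfun.induct)
  case (const c)
  show ?case by (rule bexI[of _ "\<lambda>_. c"]) (simp_all add: polys.const)
next
  case (coord i r c)
  have gi: "gs ! i \<in> carrier_vec n" using coord(1) assms(2) by (meson nth_mem subsetD)
  have "(map \<sigma> gs ! i) $$ (r, c) = (\<Sum>b<n. gs ! i $ b * \<sigma> (unit_vec n b) $$ (r, c))" if X: "module (D, \<sigma>)" for \<sigma>
    using module_expand[OF X gi, of "1\<^sub>m D" "1\<^sub>m D" r c] coord module_dim[OF X] gi
    by (simp add: mat_one_mult mat_mult_one del: index_mult_mat(1))
  note * = this
  have "(\<lambda>\<sigma>. \<Sum>b<n. gs ! i $ b * \<sigma> (unit_vec n b) $$ (r, c)) \<in> polys D"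
    using coord by (intro polys_sum polys.mult polys.const polys.coord) auto
  then show ?case by (rule bexI[rotated]) (simp add: *)
next
  case (add f g)
  then obtain f' g' where "f' \<in> polys D" "g' \<in> polys D"
    "\<forall>\<sigma>. module (D, \<sigma>) \<longrightarrow> f (map \<sigma> gs) = f' \<sigma>" "\<forall>\<sigma>. module (D, \<sigma>) \<longrightarrow> g (map \<sigma> gs) = g' \<sigma>" by blast
  then show ?case by (intro bexI[of _ "\<lambda>\<sigma>. f' \<sigma> + g' \<sigma>"] polys.add) auto
next
  case (mul f g)
  then obtain f' g' where "f' \<in> polys D" "g' \<in> polys D"
    "\<forall>\<sigma>. module (D, \<sigma>) \<longrightarrow> f (map \<sigma> gs) = f' \<sigma>" "\<forall>\<sigma>. module (D, \<sigma>) \<longrightarrow> g (map \<sigma> gs) = g' \<sigma>" by blast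
  then show ?case by (intro bexI[of _ "\<lambda>\<sigma>. f' \<sigma> * g' \<sigma>"] polys.mult) auto
qed

text \<open>A map into \<open>P\<close> extends to a polynomial family of maps from all modules of the same dimension,
  because it is a combination of maps into the injective module \<open>dual_regular\<close>, and those correspond
  to arbitrary linear functionals.\<close>

lemma polynomial_deformation:
  assumes inj: "self_injective A" and P: "module P" "projective A P" and K: "module K" and i: "hom K P i"
  obtains q where "\<And>r j. r < fst K \<Longrightarrow> j < fst P \<Longrightarrow> q r j \<in> polys (fst K)"
    "\<And>\<sigma>. module (fst K, \<sigma>) \<Longrightarrow> hom (fst K, \<sigma>) P (mat (fst K) (fst P) (\<lambda>(r, j). q r j \<sigma>))"
    "mat (fst K) (fst P) (\<lambda>(r, j). q r j (snd K)) = i"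
proof -
  let ?k = "fst K" and ?p = "fst P"
  have "thru dual_regular P P (1\<^sub>m ?p)"
    by (rule thru_trans[OF projective_thru_regular[OF P] self_injective_thru_dual[OF inj] P(1) P(1)
        module_regular module_dual_regular])
  then have "thru dual_regular K P (i * 1\<^sub>m ?p)"
    by (rule thru_mult_left[OF _ K P(1) module_dual_regular i])
  then have "thru dual_regular K P i"
    using hom_dim[OF i] by (simp add: mat_mult_one)
  then have "\<exists>q. (\<forall>r<?k. \<forall>j<?p. q r j \<in> polys ?k) \<and>
    (\<forall>\<sigma>. module (?k, \<sigma>) \<longrightarrow> hom (?k, \<sigma>) P (mat ?k ?p (\<lambda>(r, j). q r j \<sigma>))) \<and>
    mat ?k ?p (\<lambda>(r, j). q r j (snd K)) = i"
  proof (induction rule: thru.induct)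
    case zero
    have 0: "mat ?k ?p (\<lambda>_. 0 :: 'k) = 0\<^sub>m ?k ?p" by (intro eq_matI) auto
    show ?case
      using hom_zero[OF _ P(1), of "(?k, _)"]
      by (intro exI[of _ "\<lambda>_ _ _. 0"]) (auto simp: 0 polys.const)
  next
    case (add h u v)
    then obtain q where q: "\<And>r j. r < ?k \<Longrightarrow> j < ?p \<Longrightarrow> q r j \<in> polys ?k"
      "\<And>\<sigma>. module (?k, \<sigma>) \<Longrightarrow> hom (?k, \<sigma>) P (mat ?k ?p (\<lambda>(r, j). q r j \<sigma>))"
      "mat ?k ?p (\<lambda>(r, j). q r j (snd K)) = h" by blast
    \<comment> \<open>The functional behind \<open>u\<close>. Keeping \<open>l\<close> and
      \<open>v\<close> fixed while the structure varies gives the family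
      \<open>to_dual (fst K, \<sigma>) l * v\<close>, whose entries are \<open>w\<close>.\<close>
    define l where "l = u * one_col"
    have l: "l \<in> carrier_mat ?k 1"
      using hom_dim[OF add(2)] by (auto simp: l_def)
    have u: "u = to_dual K l"
      unfolding l_def by (rule hom_to_dual_eq[OF K add(2)])
    define w where "w = (\<lambda>r j (\<sigma> :: 'k vec \<Rightarrow> 'k mat). \<Sum>t<n. (\<Sum>b<?k. \<sigma> (unit_vec n t) $$ (r, b) * l $$ (b, 0)) * v $$ (t, j))"
    have w: "to_dual (?k, \<sigma>) l * v = mat ?k ?p (\<lambda>(r, j). w r j \<sigma>)" if X: "module (?k, \<sigma>)" for \<sigma>
    proof (rule eq_matI)
      fix r j assume "r < dim_row (mat ?k ?p (\<lambda>(r, j). w r j \<sigma>))" "j < dim_col (mat ?k ?p (\<lambda>(r, j). w r j \<sigma>))"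
      then have rj: "r < ?k" "j < ?p" by auto
      have "(to_dual (?k, \<sigma>) l * v) $$ (r, j) = (\<Sum>t<n. to_dual (?k, \<sigma>) l $$ (r, t) * v $$ (t, j))"
        by (rule mult_mat_entry) (use rj hom_dim[OF add(3)] in \<open>auto simp: to_dual_def dual_regular_fst\<close>)
      also have "\<dots> = w r j \<sigma>"
        unfolding w_def
      proof (intro sum.cong refl arg_cong2[of _ _ _ _ "(*)"])
        fix t assume "t \<in> {..<n}"
        then have "to_dual (?k, \<sigma>) l $$ (r, t) = (\<sigma> (unit_vec n t) * l) $$ (r, 0)"
          using rj by (simp add: to_dual_def)
        also have "\<dots> = (\<Sum>b<?k. \<sigma> (unit_vec n t) $$ (r, b) * l $$ (b, 0))"
          by (rule mult_mat_entry) (use rj l module_dim[OF X, of "unit_vec n t"] in auto)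
        finally show "to_dual (?k, \<sigma>) l $$ (r, t) = (\<Sum>b<?k. \<sigma> (unit_vec n t) $$ (r, b) * l $$ (b, 0))" .
      qed
      finally show "(to_dual (?k, \<sigma>) l * v) $$ (r, j) = mat ?k ?p (\<lambda>(r, j). w r j \<sigma>) $$ (r, j)"
        using rj by simp
    qed (use hom_dim[OF add(3)] in \<open>auto simp: to_dual_def\<close>)
    have sum: "mat ?k ?p (\<lambda>(r, j). q r j \<sigma> + w r j \<sigma>) = mat ?k ?p (\<lambda>(r, j). q r j \<sigma>) + mat ?k ?p (\<lambda>(r, j). w r j \<sigma>)" for \<sigma>
      by (intro eq_matI) auto
    show ?case
    proof (intro exI[of _ "\<lambda>r j \<sigma>. q r j \<sigma> + w r j \<sigma>"] conjI allI impI)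
      show "(\<lambda>\<sigma>. q r j \<sigma> + w r j \<sigma>) \<in> polys ?k" if "r < ?k" "j < ?p" for r j
        unfolding w_def using that q(1)
        by (intro polys.add polys_sum polys.mult polys.const polys.coord) auto
      show "hom (?k, \<sigma>) P (mat ?k ?p (\<lambda>(r, j). q r j \<sigma> + w r j \<sigma>))" if X: "module (?k, \<sigma>)" for \<sigma>
        unfolding sum w[OF X, symmetric]
        using l by (intro hom_add[OF X P(1)] q(2)[OF X] hom_mult[OF X module_dual_regular P(1) _ add(3)] to_dual(1)[OF X]) simp
      have "module (?k, snd K)" using K by simp
      then show "mat ?k ?p (\<lambda>(r, j). q r j (snd K) + w r j (snd K)) = h + u * v"
        using w[of "snd K"] by (simp add: sum q(3) u)
    qed
  qed
  then show thesis using that by blast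
qed

text \<open>The cokernels of a polynomial family of monomorphisms are described by rational functions; the
  denominators are powers of the determinant of a square matrix completing the monomorphism.\<close>

lemma open_pullback:
  assumes inj: "self_injective A" and S: "ses K P C i p" and P: "projective A P"
    and f: "f \<in> polys (fst C)" "f (snd C) \<noteq> 0"
  obtains g where "g \<in> polys (fst K)" "g (snd K) \<noteq> 0"
    "\<And>\<sigma>. module (fst K, \<sigma>) \<Longrightarrow> g \<sigma> \<noteq> 0 \<Longrightarrow> \<exists>\<tau> i2 p2. ses (fst K, \<sigma>) P (fst C, \<tau>) i2 p2 \<and> f \<tau> \<noteq> 0"
proof -
  note SD = sesD[OF S]
  let ?k = "fst K" and ?e = "fst C" and ?m = "fst P"
  obtain i' p' where i': "i' \<in> carrier_mat ?m ?k" and p': "p' \<in> carrier_mat ?e ?m"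
    and sp: "i * i' = 1\<^sub>m ?k" "p' * p = 1\<^sub>m ?e" "i' * i + p * p' = 1\<^sub>m ?m"
    using sesE[OF S] .
  note ic = hom_carrier[OF SD(4)] and pc = hom_carrier[OF SD(5)]
  obtain q where q: "\<And>r j. r < ?k \<Longrightarrow> j < ?m \<Longrightarrow> q r j \<in> polys ?k"
    "\<And>\<sigma>. module (?k, \<sigma>) \<Longrightarrow> hom (?k, \<sigma>) P (mat ?k ?m (\<lambda>(r, j). q r j \<sigma>))"
    "mat ?k ?m (\<lambda>(r, j). q r j (snd K)) = i"
    using polynomial_deformation[OF inj SD(2) P SD(1,4)] by blast
  \<comment> \<open>Multiplying the splitting identity by \<open>p'\<close> and \<open>i'\<close>
    gives \<open>x = x + x\<close> for \<open>x = p' * i'\<close>.\<close>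
  have p'i': "p' * i' = 0\<^sub>m ?e ?k"
  proof -
    have "p' * ((i' * i + p * p') * i') = p' * i' + p' * i'"
      using carrier_matD[OF i'] carrier_matD[OF p'] carrier_matD[OF ic] carrier_matD[OF pc]
      by (simp add: mat_ring sp(1) mat_assoc_eq[OF sp(2)])
    then have *: "p' * i' = p' * i' + p' * i'"
      using carrier_matD[OF i'] carrier_matD[OF p'] by (simp add: sp(3) mat_one_mult)
    show ?thesis
    proof (rule eq_matI)
      fix r c assume "r < dim_row (0\<^sub>m ?e ?k :: 'k mat)" "c < dim_col (0\<^sub>m ?e ?k :: 'k mat)"
      then have rc: "r < ?e" "c < ?k" by auto
      have "(p' * i') $$ (r, c) = (p' * i' + p' * i') $$ (r, c)"
        by (rule arg_cong[OF *])
      also have "\<dots> = (p' * i') $$ (r, c) + (p' * i') $$ (r, c)"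
        by (rule index_add_mat(1)) (use rc i' p' in auto)
      finally have "(p' * i') $$ (r, c) = 0"
        by (metis add_cancel_right_right)
      then show "(p' * i') $$ (r, c) = 0\<^sub>m ?e ?k $$ (r, c)"
        using rc by simp
    qed (use i' p' in auto)
  qed
  have BA: "stack i p' * side i' p = 1\<^sub>m (?k + ?e)"
    using stack_side_one_iff[OF ic p' i' pc] sp SD(6) p'i' by simp
  have AB: "side i' p * stack i p' = 1\<^sub>m ?m"
    using side_stack[OF ic p' i' pc] sp(3) by simp
  have sc: "stack i p' \<in> carrier_mat (?k + ?e) ?m" "side i' p \<in> carrier_mat ?m (?k + ?e)"
    using ic pc i' p' by (auto simp: stack_def side_def)
  have m: "?k + ?e = ?m"
    using right_inverse_le[OF sc BA] right_inverse_le[OF sc(2,1) AB] by simp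
  \<comment> \<open>Only the embedding is deformed; the completing rows \<open>p'\<close> stay
    fixed. At \<open>K\<close> the matrix is invertible with inverse
    \<open>side i' p\<close>.\<close>
  define B where "B = (\<lambda>r j \<sigma>. if r < ?k then q r j \<sigma> else p' $$ (r - ?k, j))"
  define M where "M \<sigma> = mat ?m ?m (\<lambda>(r, j). B r j \<sigma>)" for \<sigma>
  define \<phi> where "\<phi> \<sigma> = mat ?k ?m (\<lambda>(r, j). q r j \<sigma>)" for \<sigma>
  define \<Delta> where "\<Delta> \<sigma> = det (M \<sigma>)" for \<sigma>
  have Mc: "M \<sigma> \<in> carrier_mat ?m ?m" for \<sigma> by (simp add: M_def)
  have \<phi>c: "\<phi> \<sigma> \<in> carrier_mat ?k ?m" for \<sigma> by (simp add: \<phi>_def)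
  have M_stack: "M \<sigma> = stack (\<phi> \<sigma>) p'" for \<sigma>
    using p' m by (intro eq_matI) (auto simp: M_def B_def \<phi>_def stack_def)
  have Bp: "B r j \<in> polys ?k" if "r < ?m" "j < ?m" for r j
    using that q(1) polys.const by (cases "r < ?k") (simp_all add: B_def)
  have \<Delta>p: "\<Delta> \<in> polys ?k"
    unfolding \<Delta>_def M_def by (rule polys_det) (use Bp in auto)
  \<comment> \<open>The two column blocks of the inverse of \<open>M \<sigma>\<close> by Cramer's
    rule: \<open>\<alpha>\<close> is a linear retraction of the embedding and \<open>\<pi>\<close>
    its cokernel map.\<close>
  define \<alpha> where "\<alpha> \<sigma> = mat ?m ?k (\<lambda>(l, j). adj_mat (M \<sigma>) $$ (l, j) / \<Delta> \<sigma>)" for \<sigma>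
  define \<pi> where "\<pi> \<sigma> = mat ?m ?e (\<lambda>(l, j). adj_mat (M \<sigma>) $$ (l, ?k + j) / \<Delta> \<sigma>)" for \<sigma>
  define \<tau> where "\<tau> \<sigma> a = p' * (snd P a * \<pi> \<sigma>)" for \<sigma> a
  have ac: "\<alpha> \<sigma> \<in> carrier_mat ?m ?k" "\<pi> \<sigma> \<in> carrier_mat ?m ?e" for \<sigma>
    by (auto simp: \<alpha>_def \<pi>_def)
  have inverse: "\<phi> \<sigma> * \<alpha> \<sigma> = 1\<^sub>m ?k" "\<phi> \<sigma> * \<pi> \<sigma> = 0\<^sub>m ?k ?e" "p' * \<pi> \<sigma> = 1\<^sub>m ?e"
    "\<alpha> \<sigma> * \<phi> \<sigma> + \<pi> \<sigma> * p' = 1\<^sub>m ?m" if nz: "\<Delta> \<sigma> \<noteq> 0" for \<sigma>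
  proof -
    have side: "side (\<alpha> \<sigma>) (\<pi> \<sigma>) = inverse (\<Delta> \<sigma>) \<cdot>\<^sub>m adj_mat (M \<sigma>)"
      using m by (intro eq_matI)
        (auto simp: side_def \<alpha>_def \<pi>_def divide_inverse carrier_matD[OF adj_mat(1)[OF Mc]])
    note dM = carrier_matD[OF Mc] carrier_matD[OF adj_mat(1)[OF Mc]]
    have cancel: "inverse (det (M \<sigma>)) \<cdot>\<^sub>m (det (M \<sigma>) \<cdot>\<^sub>m 1\<^sub>m ?m) = 1\<^sub>m ?m"
      using nz by (intro eq_matI) (auto simp: \<Delta>_def)
    have "M \<sigma> * side (\<alpha> \<sigma>) (\<pi> \<sigma>) = 1\<^sub>m ?m" "side (\<alpha> \<sigma>) (\<pi> \<sigma>) * M \<sigma> = 1\<^sub>m ?m"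
      unfolding side
      by (simp_all add: mat_mult_smult mat_smult_mult dM adj_mat(2,3)[OF Mc] \<Delta>_def cancel)
    then show "\<phi> \<sigma> * \<alpha> \<sigma> = 1\<^sub>m ?k" "\<phi> \<sigma> * \<pi> \<sigma> = 0\<^sub>m ?k ?e" "p' * \<pi> \<sigma> = 1\<^sub>m ?e"
      "\<alpha> \<sigma> * \<phi> \<sigma> + \<pi> \<sigma> * p' = 1\<^sub>m ?m"
      using stack_side_one_iff[OF \<phi>c p' ac, of \<sigma> \<sigma> \<sigma>] side_stack[OF \<phi>c p' ac, of \<sigma> \<sigma> \<sigma>] m
      by (simp_all add: M_stack)
  qed
  have \<phi>K: "\<phi> (snd K) = i" by (simp add: \<phi>_def q(3))
  have \<Delta>K: "\<Delta> (snd K) \<noteq> 0"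
  proof -
    have "\<Delta> (snd K) * det (side i' p) = 1"
      unfolding \<Delta>_def M_stack \<phi>K using sc m BA by (simp flip: det_mult[of _ ?m])
    then show ?thesis by auto
  qed
  have \<pi>K: "\<pi> (snd K) = p"
  proof -
    note I = inverse[OF \<Delta>K, unfolded \<phi>K]
    have "p = (\<alpha> (snd K) * i + \<pi> (snd K) * p') * p"
      using pc by (simp add: I(4) mat_one_mult)
    also have "\<dots> = \<pi> (snd K)"
      using carrier_matD[OF ac(1)] carrier_matD[OF ac(2)] carrier_matD[OF ic] carrier_matD[OF pc] carrier_matD[OF p']
      by (simp add: mat_ring SD(6) sp(2))
    finally show ?thesis by simp
  qed
  have \<tau>K: "\<tau> (snd K) (unit_vec n b) = snd C (unit_vec n b)" if "b < n" for b
    unfolding \<tau>_def \<pi>K using module_dim[OF SD(3)] module_dim[OF SD(2)] carrier_matD[OF p'] carrier_matD[OF pc]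
    by (simp add: hom_comm[OF SD(5)] mat_assoc_eq[OF sp(2)] mat_one_mult)
  \<comment> \<open>Clearing denominators by induction on \<open>f\<close>: a coordinate costs one
    factor \<open>\<Delta>\<close>, and sums and products add the exponents.\<close>
  have "\<exists>k. \<exists>g\<in>polys ?k. \<forall>\<sigma>. \<Delta> \<sigma> \<noteq> 0 \<longrightarrow> f (\<tau> \<sigma>) * \<Delta> \<sigma> ^ k = g \<sigma>"
    using f(1)
  proof (induction rule: polys.induct)
    case (const x)
    then show ?case by (intro exI[of _ 0] bexI[of _ "\<lambda>_. x"]) (auto intro: polys.const)
  next
    case (coord b r c)
    define L where "L = p' * snd P (unit_vec n b)"
    have dL: "dim_row L = ?e" "dim_col L = ?m"
      using p' module_dim[OF SD(2), of "unit_vec n b"] by (auto simp: L_def)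
    have *: "(\<tau> \<sigma> (unit_vec n b)) $$ (r, c) * \<Delta> \<sigma> ^ 1 = (\<Sum>l<?m. L $$ (r, l) * adj_mat (M \<sigma>) $$ (l, ?k + c))"
      if nz: "\<Delta> \<sigma> \<noteq> 0" for \<sigma>
    proof -
      have "\<tau> \<sigma> (unit_vec n b) = L * \<pi> \<sigma>"
        unfolding \<tau>_def L_def using p' ac[of \<sigma>] module_dim[OF SD(2), of "unit_vec n b"] by (simp add: mat_assoc)
      then have "(\<tau> \<sigma> (unit_vec n b)) $$ (r, c) = (\<Sum>l<?m. L $$ (r, l) * \<pi> \<sigma> $$ (l, c))"
        using coord dL ac(2)[of \<sigma>] by (simp add: mult_mat_entry[where n = "?m"] del: index_mult_mat(1))
      also have "\<dots> = (\<Sum>l<?m. L $$ (r, l) * (adj_mat (M \<sigma>) $$ (l, ?k + c) / \<Delta> \<sigma>))"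
        using coord by (intro sum.cong) (auto simp: \<pi>_def)
      finally show ?thesis
        using nz by (simp add: sum_distrib_right)
    qed
    have poly: "(\<lambda>\<sigma>. \<Sum>l<?m. L $$ (r, l) * adj_mat (M \<sigma>) $$ (l, ?k + c)) \<in> polys ?k"
      unfolding M_def using coord m Bp by (intro polys_sum polys.mult polys.const polys_adj) auto
    show ?case by (rule exI[of _ 1], rule bexI[OF _ poly], intro allI impI *)
  next
    case (add f g)
    then obtain s t f' g' where fg: "f' \<in> polys ?k" "g' \<in> polys ?k"
      "\<forall>\<sigma>. \<Delta> \<sigma> \<noteq> 0 \<longrightarrow> f (\<tau> \<sigma>) * \<Delta> \<sigma> ^ s = f' \<sigma>" "\<forall>\<sigma>. \<Delta> \<sigma> \<noteq> 0 \<longrightarrow> g (\<tau> \<sigma>) * \<Delta> \<sigma> ^ t = g' \<sigma>" by blast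
    have *: "(f (\<tau> \<sigma>) + g (\<tau> \<sigma>)) * \<Delta> \<sigma> ^ (s + t) = f' \<sigma> * \<Delta> \<sigma> ^ t + g' \<sigma> * \<Delta> \<sigma> ^ s" if "\<Delta> \<sigma> \<noteq> 0" for \<sigma>
    proof -
      have "(f (\<tau> \<sigma>) + g (\<tau> \<sigma>)) * \<Delta> \<sigma> ^ (s + t) = (f (\<tau> \<sigma>) * \<Delta> \<sigma> ^ s) * \<Delta> \<sigma> ^ t + (g (\<tau> \<sigma>) * \<Delta> \<sigma> ^ t) * \<Delta> \<sigma> ^ s"
        by (simp add: power_add algebra_simps)
      then show ?thesis using fg(3,4) that by simp
    qed
    have poly: "(\<lambda>\<sigma>. f' \<sigma> * \<Delta> \<sigma> ^ t + g' \<sigma> * \<Delta> \<sigma> ^ s) \<in> polys ?k"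
      using fg \<Delta>p by (intro polys.add polys.mult polys_power) auto
    show ?case by (rule exI[of _ "s + t"], rule bexI[OF _ poly], intro allI impI *)
  next
    case (mult f g)
    then obtain s t f' g' where fg: "f' \<in> polys ?k" "g' \<in> polys ?k"
      "\<forall>\<sigma>. \<Delta> \<sigma> \<noteq> 0 \<longrightarrow> f (\<tau> \<sigma>) * \<Delta> \<sigma> ^ s = f' \<sigma>" "\<forall>\<sigma>. \<Delta> \<sigma> \<noteq> 0 \<longrightarrow> g (\<tau> \<sigma>) * \<Delta> \<sigma> ^ t = g' \<sigma>" by blast
    have *: "(f (\<tau> \<sigma>) * g (\<tau> \<sigma>)) * \<Delta> \<sigma> ^ (s + t) = f' \<sigma> * g' \<sigma>" if "\<Delta> \<sigma> \<noteq> 0" for \<sigma>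
    proof -
      have "(f (\<tau> \<sigma>) * g (\<tau> \<sigma>)) * \<Delta> \<sigma> ^ (s + t) = (f (\<tau> \<sigma>) * \<Delta> \<sigma> ^ s) * (g (\<tau> \<sigma>) * \<Delta> \<sigma> ^ t)"
        by (simp add: power_add algebra_simps)
      then show ?thesis using fg(3,4) that by simp
    qed
    have poly: "(\<lambda>\<sigma>. f' \<sigma> * g' \<sigma>) \<in> polys ?k"
      using fg by (intro polys.mult)
    show ?case by (rule exI[of _ "s + t"], rule bexI[OF _ poly], intro allI impI *)
  qed
  then obtain t g where g: "g \<in> polys ?k" "\<And>\<sigma>. \<Delta> \<sigma> \<noteq> 0 \<Longrightarrow> f (\<tau> \<sigma>) * \<Delta> \<sigma> ^ t = g \<sigma>" by blast
  show thesis
  \<comment> \<open>The extra factor \<open>\<Delta>\<close> restricts to structures where the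
    deformed map is still a split embedding.\<close>
  proof (rule that[of "\<lambda>\<sigma>. \<Delta> \<sigma> * g \<sigma>"])
    show "(\<lambda>\<sigma>. \<Delta> \<sigma> * g \<sigma>) \<in> polys ?k"
      using \<Delta>p g(1) by (rule polys.mult)
    have "f (\<tau> (snd K)) = f (snd C)"
      using polys_cong[OF f(1), of "\<tau> (snd K)" "snd C"] \<tau>K by blast
    then show "\<Delta> (snd K) * g (snd K) \<noteq> 0"
      using g(2)[OF \<Delta>K] f(2) \<Delta>K by auto
    fix \<sigma> assume X: "module (?k, \<sigma>)" and nz: "\<Delta> \<sigma> * g \<sigma> \<noteq> 0"
    then have \<Delta>: "\<Delta> \<sigma> \<noteq> 0" and "g \<sigma> \<noteq> 0" by auto
    then have "f (\<tau> \<sigma>) \<noteq> 0" using g(2)[OF \<Delta>] by auto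
    moreover have "ses (?k, \<sigma>) P (?e, \<tau> \<sigma>) (\<phi> \<sigma>) (\<pi> \<sigma>)"
      unfolding \<tau>_def using cokernel_ses[OF X SD(2) q(2)[OF X, folded \<phi>_def], of "\<alpha> \<sigma>" p' ?e "\<pi> \<sigma>"]
        ac p' inverse[OF \<Delta>] by simp
    ultimately show "\<exists>\<tau> i2 p2. ses (?k, \<sigma>) P (?e, \<tau>) i2 p2 \<and> f \<tau> \<noteq> 0" by blast
  qed
qed

text \<open>The \<open>j\<close>-th level consists of the modules with a \<open>j\<close>-fold cosyzygy isomorphic to \<open>M\<close>, formed by
  embeddings into the given projective modules.\<close>

fun level :: "'k fdmod \<Rightarrow> (nat \<Rightarrow> 'k fdmod) \<Rightarrow> nat \<Rightarrow> 'k fdmod \<Rightarrow> bool" where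
  "level M P 0 Y \<longleftrightarrow> module Y \<and>
    (\<exists>S T. hom M Y S \<and> hom Y M T \<and> S * T = 1\<^sub>m (fst M) \<and> T * S = 1\<^sub>m (fst Y))"
| "level M P (Suc j) Y \<longleftrightarrow> (\<exists>C i p. ses Y (P j) C i p \<and> level M P j C)"

text \<open>Iterates \<open>open_pullback\<close>. Cokernels of nearby embeddings into
  \<open>P j\<close> keep the dimension of \<open>K j\<close>, so the polynomial found at stage
  \<open>j\<close> can be evaluated on them.\<close>

lemma level_open:
  assumes inj: "self_injective A" and K0: "K 0 = M" and S: "\<And>t. ses (K (Suc t)) (P t) (K t) (i t) (p t)"
    and P: "\<And>t. projective A (P t)"
    and f0: "f0 \<in> polys (fst M)" "f0 (snd M) \<noteq> 0" "\<And>\<sigma>. module (fst M, \<sigma>) \<Longrightarrow> f0 \<sigma> \<noteq> 0 \<Longrightarrow> level M P 0 (fst M, \<sigma>)"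
  shows "\<exists>f\<in>polys (fst (K j)). f (snd (K j)) \<noteq> 0 \<and>
    (\<forall>\<sigma>. module (fst (K j), \<sigma>) \<longrightarrow> f \<sigma> \<noteq> 0 \<longrightarrow> level M P j (fst (K j), \<sigma>))"
proof (induction j)
  case 0
  then show ?case using f0 K0 by blast
next
  case (Suc j)
  then obtain f where f: "f \<in> polys (fst (K j))" "f (snd (K j)) \<noteq> 0"
    "\<And>\<sigma>. module (fst (K j), \<sigma>) \<Longrightarrow> f \<sigma> \<noteq> 0 \<Longrightarrow> level M P j (fst (K j), \<sigma>)" by blast
  obtain g where g: "g \<in> polys (fst (K (Suc j)))" "g (snd (K (Suc j))) \<noteq> 0"
    "\<And>\<sigma>. module (fst (K (Suc j)), \<sigma>) \<Longrightarrow> g \<sigma> \<noteq> 0 \<Longrightarrow>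
      \<exists>\<tau> i2 p2. ses (fst (K (Suc j)), \<sigma>) (P j) (fst (K j), \<tau>) i2 p2 \<and> f \<tau> \<noteq> 0"
    using open_pullback[OF inj S P f(1,2)] by blast
  have "level M P (Suc j) (fst (K (Suc j)), \<sigma>)" if X: "module (fst (K (Suc j)), \<sigma>)" and nz: "g \<sigma> \<noteq> 0" for \<sigma>
  proof -
    obtain \<tau> i2 p2 where T: "ses (fst (K (Suc j)), \<sigma>) (P j) (fst (K j), \<tau>) i2 p2" "f \<tau> \<noteq> 0"
      using g(3)[OF X nz] by blast
    then show ?thesis using f(3)[OF sesD(3)[OF T(1)] T(2)] by auto
  qed
  then show ?case using g(1,2) by blast
qed

text \<open>Cosyzygies are taken of \<open>Y\<close> and of \<open>K m\<close> in parallel. After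
  \<open>j\<close> steps the first has become \<open>M\<close> up to isomorphism and the second
  \<open>K (m - j)\<close>.\<close>

lemma level_stab:
  assumes inj: "self_injective A" and M: "module M" and S: "\<And>t. ses (K (Suc t)) (P t) (K t) (i t) (p t)"
    and P: "\<And>t. projective A (P t)"
  shows "level M P j Y \<Longrightarrow> j \<le> m \<Longrightarrow> stab Y (K m) \<Longrightarrow> stab M (K (m - j))"
proof (induction j arbitrary: Y m)
  case 0
  then obtain S T where "hom M Y S" "hom Y M T" "S * T = 1\<^sub>m (fst M)" "T * S = 1\<^sub>m (fst Y)" by auto
  then show ?case using stab_iso_trans[OF M] 0(3) by simp
next
  case (Suc j)
  then obtain C i' p' where C: "ses Y (P j) C i' p'" "level M P j C" by auto
  obtain m' where m': "m = Suc m'" "j \<le> m'" using Suc.prems(2) by (cases m) auto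
  have "stab C (K m')"
    using stab_cokernel[OF inj C(1) S P P] Suc.prems(3) m' by simp
  then show ?case using Suc.IH[OF C(2) m'(2)] m'(1) by simp
qed

lemma noetherian_polys:
  obtains R where "is_subring R" "noetherian R" "polys D \<subseteq> R"
proof -
  let ?T = "(\<lambda>(b, r, c). \<lambda>\<sigma>. \<sigma> (unit_vec n b) $$ (r, c)) ` ({..<n} \<times> {..<D} \<times> {..<D}) :: (('k vec \<Rightarrow> 'k mat) \<Rightarrow> 'k) set"
  have "finite ?T" by simp
  from noetherian_function_ring[OF this] obtain R :: "(('k vec \<Rightarrow> 'k mat) \<Rightarrow> 'k) set"
    where R: "is_subring R" "noetherian R" "range (\<lambda>c x. c) \<union> ?T \<subseteq> R" by blast
  have "f \<in> R" if "f \<in> polys D" for f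
    using that
  proof (induction rule: polys.induct)
    case (const x)
    then show ?case using R(3) by blast
  next
    case (coord b r c)
    then have "(\<lambda>\<sigma>. \<sigma> (unit_vec n b) $$ (r, c)) \<in> ?T"
      by (intro image_eqI[of _ _ "(b, r, c)"]) auto
    then show ?case using R(3) by blast
  next
    case (add f g)
    then show ?case using subring_add[OF R(1), of f g] by (simp add: plus_fun_def)
  next
    case (mult f g)
    then show ?case using subring_mult[OF R(1), of f g] by (simp add: times_fun_def)
  qed
  then show thesis using that R(1,2) by blast
qed

lemma sum_fun_apply: "(\<Sum>i\<in>I. f i) x = (\<Sum>i\<in>I. f i x)"
  by (induction I rule: infinite_finite_induct) auto

lemma ses_le: "ses N F C i p \<Longrightarrow> fst N \<le> fst F"
  using right_inverse_le sesE sesD(4) hom_carrier by metis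

lemma periodic_if_bounded:
  assumes inj: "self_injective A" and M: "module M" and res: "proj_resolution A M P d e"
    and bound: "\<And>t. t \<ge> 1 \<Longrightarrow> fst (P t) \<le> c"
    and f0: "f0 \<in> polys (fst M)" "f0 (snd M) \<noteq> 0"
      "\<And>\<sigma>. module (fst M, \<sigma>) \<Longrightarrow> f0 \<sigma> \<noteq> 0 \<Longrightarrow> level M P 0 (fst M, \<sigma>)"
  shows "periodic A M"
proof -
  have P: "projective A (P t)" "module (P t)" for t
    using res by (auto simp: proj_resolution_def)
  obtain K i p where K0: "K 0 = M" and "\<forall>t. ses (K (Suc t)) (P t) (K t) (i t) (p t)"
    using resolution_syzygies[OF M res] by (elim exE conjE)
  then have S: "ses (K (Suc t)) (P t) (K t) (i t) (p t)" for t by simp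
  \<comment> \<open>\<open>K t\<close> embeds in \<open>P (t - 1)\<close>, whose dimension is
    bounded only from index 1 on.\<close>
  have "fst (K t) \<le> c" if t2: "t \<ge> 2" for t
  proof -
    have "fst (K (Suc (t - 1))) \<le> fst (P (t - 1))"
      by (rule ses_le[OF S])
    also have "\<dots> \<le> c" by (rule bound) (use t2 in simp)
    finally show ?thesis using t2 by simp
  qed
  then have "(\<lambda>t. fst (K t)) ` {2..} \<subseteq> {..c}" by auto
  then have "finite ((\<lambda>t. fst (K t)) ` {2..})"
    using finite_subset by blast
  then obtain D where D: "infinite {t \<in> {2..}. fst (K t) = D}"
    using pigeonhole_infinite[of "{2..}" "\<lambda>t. fst (K t)"] infinite_Ici by blast
  obtain s :: "nat \<Rightarrow> nat" where s_mono: "strict_mono s" and s_in: "\<forall>l. s l \<in> {t \<in> {2..}. fst (K t) = D}"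
    using infinite_enumerate[OF D] by (elim exE conjE)
  have s: "fst (K (s l)) = D" for l
    using s_in by simp
  define Q where "Q l f \<longleftrightarrow> f \<in> polys D \<and> f (snd (K (s l))) \<noteq> 0 \<and>
      (\<forall>\<sigma>. module (D, \<sigma>) \<longrightarrow> f \<sigma> \<noteq> 0 \<longrightarrow> level M P (s l) (D, \<sigma>))" for l f
  have "\<exists>f. Q l f" for l
    using level_open[where K = K and P = P and i = i and p = p, OF inj K0 S P(1) f0, of "s l"] unfolding Q_def s Bex_def .
  then obtain F where "\<And>l. Q l (F l)" by metis
  then have F: "F l \<in> polys D" "F l (snd (K (s l))) \<noteq> 0"
    "module (D, \<sigma>) \<Longrightarrow> F l \<sigma> \<noteq> 0 \<Longrightarrow> level M P (s l) (D, \<sigma>)" for l \<sigma>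
    unfolding Q_def by blast+
  obtain R where R: "is_subring R" "noetherian R" "polys D \<subseteq> R"
    using noetherian_polys .
  have "\<forall>l. F l \<in> R" using F(1) R(3) by blast
  then obtain m where "F m \<in> span_below R F m"
    using R(2)[unfolded noetherian_def, rule_format, of F] by blast
  then obtain r where r: "F m = (\<Sum>l<m. r l * F l)"
    by (rule span_belowE)
  let ?\<sigma> = "snd (K (s m))"
  have "F m ?\<sigma> = (\<Sum>l<m. r l ?\<sigma> * F l ?\<sigma>)"
    by (subst r) (simp add: sum_fun_apply)
  then have "(\<Sum>l<m. r l ?\<sigma> * F l ?\<sigma>) \<noteq> 0" using F(2)[of m] by simp
  then obtain l where l: "l < m" "F l ?\<sigma> \<noteq> 0"
    using sum.neutral[of "{..<m}" "\<lambda>l. r l ?\<sigma> * F l ?\<sigma>"] by auto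
  have Km: "K (s m) = (D, ?\<sigma>)" using s[of m] by (simp add: prod_eq_iff)
  have modK: "module (K t)" for t using sesD(3)[OF S] .
  have "level M P (s l) (K (s m))"
    using F(3)[OF _ l(2)] modK[of "s m"] unfolding Km[symmetric] .
  moreover have "s l < s m" using s_mono l(1) by (simp add: strict_mono_less)
  \<comment> \<open>The same module is seen as an \<open>s l\<close>-fold syzygy of \<open>M\<close>
    and as the \<open>s m\<close>-th kernel of the resolution; reflexivity starts the parallel
    cancellation.\<close>
  moreover have "stab (K (s m)) (K (s m))"
    using modK[of "s m"] by (intro stab_iso[OF _ _ P(2,1) hom_one hom_one]) (auto simp: mat_mult_one)
  ultimately have "stab M (K (s m - s l))"
    using level_stab[where K = K and P = P and i = i and p = p, OF inj M S P(1), of "s l" "K (s m)" "s m"] by simp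
  then show ?thesis
    using periodic_if_stab[where K = K and P = P and i = i and p = p, OF inj K0 S P(1), of "s m - s l"] \<open>s l < s m\<close> by simp
qed

section \<open>From the open orbit to a polynomial condition, and conclusion\<close>

lemma orbit_iso:
  assumes gs: "set gs \<subseteq> carrier_vec n" "gen_subalg A gs = carrier_vec n"
    and X: "module (d, \<rho>)" and Y: "module (d, \<sigma>)" and orb: "map \<sigma> gs \<in> orbit gs (d, \<rho>)"
  obtains S T where "hom (d, \<sigma>) (d, \<rho>) S" "hom (d, \<rho>) (d, \<sigma>) T" "S * T = 1\<^sub>m d" "T * S = 1\<^sub>m d"
proof -
  obtain S T where ST: "S \<in> carrier_mat d d" "T \<in> carrier_mat d d" "S * T = 1\<^sub>m d" "T * S = 1\<^sub>m d"
    and eq: "map \<sigma> gs = map (\<lambda>g. S * \<rho> g * T) gs"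
    using orb by (auto simp: orbit_def)
  note dST = carrier_matD[OF ST(1)] carrier_matD[OF ST(2)]
  note dX = module_dim[OF X, unfolded fst_conv snd_conv]
  \<comment> \<open>Conjugacy is known on the generators only; it passes to sums and products, hence
    to the whole algebra.\<close>
  have conj: "\<sigma> a = S * (\<rho> a * T)" if "a \<in> gen_subalg A gs" for a
    using that
  proof (induction rule: gen_subalg.induct)
    case one
    show ?case
      using module_one[OF X] module_one[OF Y] by (simp add: dST mat_ring ST)
  next
    case (gen g)
    then show ?case using eq gs(1) dST dX by (auto simp: mat_assoc)
  next
    case (add a b)
    then have "a \<in> carrier_vec n" "b \<in> carrier_vec n" using gs by auto
    then show ?case
      using module_add[OF X] module_add[OF Y] add by (simp add: dST dX mat_ring)
  next
    case (smult a x)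
    then have "a \<in> carrier_vec n" using gs by auto
    then show ?case
      using module_smult[OF X] module_smult[OF Y] smult by (simp add: dST dX mat_smult_mult mat_mult_smult)
  next
    case (mul a b)
    then have "a \<in> carrier_vec n" "b \<in> carrier_vec n" using gs by auto
    then show ?case
      using module_mult[OF X] module_mult[OF Y] mul by (simp add: dST dX mat_assoc mat_assoc_eq[OF ST(4)] mat_one_mult)
  qed
  have "hom (d, \<sigma>) (d, \<rho>) S"
    by (rule homI) (use conj gs ST in \<open>auto simp: dST dX mat_assoc mat_mult_one\<close>)
  moreover have "hom (d, \<rho>) (d, \<sigma>) T"
    by (rule homI) (use conj gs ST in \<open>auto simp: dST dX mat_assoc mat_assoc_eq[OF ST(4)] mat_one_mult\<close>)
  ultimately show thesis using that ST(3,4) by blast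
qed

text \<open>\<open>M\<close> is in its own orbit, so one of the equations of the closed complement
  fails at \<open>M\<close>. Wherever this single function is nonzero, the structure lies in the
  orbit.\<close>

lemma open_orbit_polys:
  assumes gs: "set gs \<subseteq> carrier_vec n" "gen_subalg A gs = carrier_vec n" and X: "module (d, \<rho>)"
    and op: "zariski_open_in (length gs) d (modvar A gs d) (orbit gs (d, \<rho>))"
  obtains f where "f \<in> polys d" "f \<rho> \<noteq> 0" "\<And>\<sigma>. module (d, \<sigma>) \<Longrightarrow> f \<sigma> \<noteq> 0 \<Longrightarrow> level (d, \<rho>) P 0 (d, \<sigma>)"
proof -
  let ?V = "modvar A gs d" and ?O = "orbit gs (d, \<rho>)"
  obtain F where F: "F \<subseteq> polyfun (length gs) d" "?V - ?O = {x \<in> ?V. \<forall>f\<in>F. f x = 0}"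
    using op unfolding zariski_open_in_def by blast
  have V: "map \<sigma> gs \<in> ?V" if "module (d, \<sigma>)" for \<sigma>
    using that by (auto simp: modvar_def)
  have "map \<rho> gs = map (\<lambda>g. 1\<^sub>m d * \<rho> g * 1\<^sub>m d) gs"
    using gs(1) module_dim[OF X] by (auto simp: mat_one_mult mat_mult_one subset_iff)
  then have "map \<rho> gs \<in> ?O"
    unfolding orbit_def by (intro CollectI exI[of _ "1\<^sub>m d"]) simp
  then obtain f where f: "f \<in> F" "f (map \<rho> gs) \<noteq> 0"
    using F(2) V[OF X] by blast
  then obtain g where g: "g \<in> polys d" "\<And>\<sigma>. module (d, \<sigma>) \<Longrightarrow> f (map \<sigma> gs) = g \<sigma>"
    using polyfun_polys[OF _ gs(1)] F(1) by blast
  have "level (d, \<rho>) P 0 (d, \<sigma>)" if Y: "module (d, \<sigma>)" and "g \<sigma> \<noteq> 0" for \<sigma>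
  proof -
    have "f (map \<sigma> gs) \<noteq> 0"
      using g(2)[OF Y] that(2) by simp
    then have "map \<sigma> gs \<in> ?O"
      using V[OF Y] F(2) f(1) by blast
    then obtain S T where "hom (d, \<sigma>) (d, \<rho>) S" "hom (d, \<rho>) (d, \<sigma>) T" "S * T = 1\<^sub>m d" "T * S = 1\<^sub>m d"
      using orbit_iso[OF gs X Y] by metis
    then show ?thesis using Y by auto
  qed
  then show thesis using that g(1) g(2)[OF X] f(2) by simp
qed

end

theorem theorem1:
  fixes A :: "'k::field fdalg" and gs :: "'k vec list" and d :: nat and \<rho> :: "'k vec \<Rightarrow> 'k mat"
  assumes "alg_closed_field TYPE('k)"
    and "fd_algebra A" and "basic A" and "self_injective A"
    and "presentation_gens A gs"
    and "is_module A (d, \<rho>)"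
    and "complexity A (d, \<rho>) = 1"
    and "zariski_open_in (length gs) d (modvar A gs d) (orbit gs (d, \<rho>))"
  shows "periodic A (d, \<rho>)"
proof -
  interpret fdalg A by (rule fdalg.intro) (rule assms(2))
  define N where "N = {enat n | n. \<exists>P d' e. minimal_proj_resolution A (d, \<rho>) P d' e \<and>
      (\<exists>C::real. C > 0 \<and> (\<forall>t::nat. t \<ge> 1 \<longrightarrow> real (fst (P t)) \<le> C * (real t) powi (int n - 1)))}"
  have "Inf N = 1"
    using assms(7) unfolding complexity_def N_def .
  \<comment> \<open>The infimum of the empty set is infinite. A nonempty set of extended naturals
    attains its infimum, so the exponent 1 itself has a witness.\<close>
  moreover have "N \<noteq> {}"
    using \<open>Inf N = 1\<close> by (auto simp: Inf_enat_def)
  ultimately have "1 \<in> N"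
    by (metis (no_types, lifting) Inf_enat_def LeastI ex_in_conv)
  \<comment> \<open>For exponent 1 the growth function is \<open>t\<close> to the power 0, so the
    dimensions are bounded by the constant \<open>C\<close>.\<close>
  then obtain P d' e and C :: real where res: "minimal_proj_resolution A (d, \<rho>) P d' e"
    and C: "\<And>t. t \<ge> 1 \<Longrightarrow> real (fst (P t)) \<le> C"
    unfolding N_def by (auto simp: one_enat_def)
  have bound: "fst (P t) \<le> nat \<lceil>C\<rceil>" if "t \<ge> 1" for t
    using C[OF that] by linarith
  have gs: "set gs \<subseteq> carrier_vec (dimA A)" "gen_subalg A gs = carrier_vec (dimA A)"
    using assms(5) by (auto simp: presentation_gens_def)
  have "proj_resolution A (d, \<rho>) P d' e"
    using res by (simp add: minimal_proj_resolution_def)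
  note * = periodic_if_bounded[OF assms(4,6) this bound]
  show ?thesis
  proof (rule open_orbit_polys[where P = P, OF gs assms(6,8)])
    fix f assume "f \<in> polys d" "f \<rho> \<noteq> 0"
      "\<And>\<sigma>. module (d, \<sigma>) \<Longrightarrow> f \<sigma> \<noteq> 0 \<Longrightarrow> level (d, \<rho>) P 0 (d, \<sigma>)"
    then show ?thesis by (intro *[of f]) simp_all
  qed
qed

end
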